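(* Let $\Omega\subset\mathbb{C}$ be a bounded connected open set and $\varphi:\mathbb{D}\to\Omega$ an analytic covering map. Let $\alpha\in\partial\mathbb{D}$ be such that the radial limit $p=\lim_{r\to1^-}\varphi(r\alpha)$ exists (so $p\in\partial\Omega$). (1) If $p$ is not isolated in $\partial\Omega$, then for every sufficiently small simple closed curve $S$ in $\mathbb{C}$ containing $p$ in its interior (bounded complementary domain), there is a component $\widehat S$ of $\varphi^{-1}(S)$ whose closure in $\overline{\mathbb{D}}$ is an arc separating $\alpha$ from $0$ in $\overline{\mathbb{D}}$. (2) If $p$ is isolated in $\partial\Omega$, then for every sufficiently small simple closed curve $S\subset\Omega$ containing $p$ in its interior, there is a component $\widehat S$ of $\varphi^{-1}(S)$ whose closure is a simple closed curve meeting $\partial\mathbb{D}$ exactly in $\{\alpha\}$. Moreover, in both cases the diameter of $\widehat S$ can be made arbitrarily small by choosing $S$ sufficiently small.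
   Context: $\mathbb{D}$ is the open unit disk in $\mathbb{C}$. *)

theory Defs
  imports "HOL-Analysis.Analysis"
begin

end

theory Submission
  imports Defs "HOL-Complex_Analysis.Complex_Analysis"
begin

text \<open>
  Let \<^emph>\<open>S\<close> be the curve. The preimage of \<^emph>\<open>S\<close> separates 0 from the end of the radius, hence so does one of its
  components \<^emph>\<open>C\<close>, which is the image of an injective lift of an open arc of \<^emph>\<open>S\<close> or of the universal cover of \<^emph>\<open>S\<close>.
  A lemma of Koebe shows that connected sets near the circle on which the covering map is close to a constant are
  small; this gives the diameter estimate and, when \<^emph>\<open>S\<close> leaves the domain, convergence of both ends of \<^emph>\<open>C\<close>.

  If the two ends of \<^emph>\<open>C\<close> coincided, then by Lindelof's theorem the image of the region enclosed by \<^emph>\<open>C\<close> would have its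
  boundary in \<^emph>\<open>S\<close>, so it would contain the whole inside of \<^emph>\<open>S\<close> and in particular the boundary point \<^emph>\<open>p\<close>. If an end
  were \<^emph>\<open>\<alpha>\<close>, then by Lindelof's theorem its limit value on \<^emph>\<open>S\<close> would be the radial limit \<^emph>\<open>p\<close>.

  If \<^emph>\<open>S\<close> lies in the domain, \<^emph>\<open>C\<close> is invariant under a fixed point free deck transformation, which in a half plane
  coordinate is \<^emph>\<open>y \<mapsto> a y + i b\<close>. For \<^emph>\<open>a \<noteq> 1\<close> its ends are the two fixed points, neither of which is \<^emph>\<open>\<alpha>\<close>, since otherwise
  the radius would project into a compact subset of the domain. For \<^emph>\<open>a = 1\<close> both ends agree and \<^emph>\<open>p\<close> is isolated;
  conversely, if \<^emph>\<open>p\<close> is isolated, lifting the exponential map to a punctured disc around \<^emph>\<open>p\<close> shows that both ends are \<^emph>\<open>\<alpha>\<close>.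
\<close>

section \<open>Koebe's lemma\<close>

text \<open>The driving fact is that \<open>p\<close>, being a radial limit, is omitted by
  \<open>\<phi>\<close>: by compactness values near \<open>p\<close> are taken only near the circle,
  and boundedness of \<open>\<Omega>\<close> makes the maximum principle quantitative. No
  almost-everywhere boundary theorem enters; limits are taken along the radius, along the ends of
  \<open>C\<close>, or in a region enclosed by a loop. The obstacle is the behaviour of the ends of
  \<open>C\<close>. When the curve leaves \<open>\<Omega>\<close>, an end runs towards an omitted
  value, and Koebe's lemma makes it Cauchy. When the curve stays in \<open>\<Omega>\<close>, no
  omitted value is approached and that argument has nothing to start from; the period of the curve
  supplies a deck transformation, whose fixed points give the ends. Two ends, or an arc and the
  radius, may carry different limit values at one boundary point. Lindelof's theorem is therefore
  stated for the limit 0 and applied to a product \<open>(\<phi> z - x) * (\<phi> z - y)\<close>,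
  which is small as soon as one factor is.\<close>

lemma paths_cross_box_complex:
  fixes f g :: "real \<Rightarrow> complex"
  assumes "path f" "path g" "path_image f \<subseteq> cbox a b" "path_image g \<subseteq> cbox a b"
    and "Re (pathstart f) = Re a" "Re (pathfinish f) = Re b"
    and "Im (pathstart g) = Im a" "Im (pathfinish g) = Im b"
  shows "path_image f \<inter> path_image g \<noteq> {}"
proof -
  \<comment> \<open>The Fashoda theorem lives in \<open>real^2\<close>; \<open>v\<close> is the
    coordinate map that carries it to \<open>complex\<close>.\<close>
  define v :: "complex \<Rightarrow> real^2" where "v z = vector [Re z, Im z]" for z
  have v1: "v z $ 1 = Re z" and v2: "v z $ 2 = Im z" for z
    by (simp_all add: v_def)
  have vinj: "v z = v w \<Longrightarrow> z = w" for z w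
    by (metis complex_eqI v1 v2)
  have contv: "continuous_on S v" for S
  proof -
    have "continuous_on S (\<lambda>z. v z $ i)" for i
    proof -
      have "(\<lambda>z. v z $ i) = Re \<or> (\<lambda>z. v z $ i) = Im"
        using exhaust_2[of i] v1 v2 by auto
      then show ?thesis
        using continuous_on_Re[OF continuous_on_id] continuous_on_Im[OF continuous_on_id] by metis
    qed
    then have "continuous_on S (\<lambda>z. \<chi> i. v z $ i)"
      by (intro continuous_on_vec_lambda)
    then show ?thesis by simp
  qed
  have vbox: "v z \<in> cbox (v a) (v b)" if "z \<in> cbox a b" for z
    using that by (auto simp: mem_box_cart forall_2 v1 v2 in_cbox_complex_iff)
  obtain z where "z \<in> path_image (v \<circ> f)" "z \<in> path_image (v \<circ> g)"
  proof (rule fashoda[of "v \<circ> f" "v \<circ> g" "v a" "v b"])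
    show "path (v \<circ> f)" "path (v \<circ> g)"
      using assms contv by (auto intro: path_continuous_image)
    show "path_image (v \<circ> f) \<subseteq> cbox (v a) (v b)" "path_image (v \<circ> g) \<subseteq> cbox (v a) (v b)"
      using assms vbox by (auto simp: path_image_compose)
  qed (use assms in \<open>auto simp: pathstart_compose pathfinish_compose v1 v2\<close>)
  then show ?thesis
    using vinj by (auto simp: path_image_compose)
qed

text \<open>Both paths are prolonged to the sides of a large square, \<open>P\<close> horizontally
  and \<open>l\<close> vertically, and must then cross. The crossing lies on the original paths: the
  horizontal pieces stay outside the vertical strip that holds \<open>l\<close>, the vertical pieces
  outside the horizontal strip that holds \<open>P\<close>.\<close>

lemma paths_cross_strips:
  fixes l P :: "real \<Rightarrow> complex"
  assumes l: "path l" "\<And>z. z \<in> path_image l \<Longrightarrow> u < Re z \<and> Re z < v"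
    and lI: "Im (pathstart l) \<le> c" "d \<le> Im (pathfinish l)"
    and P: "path P" "\<And>z. z \<in> path_image P \<Longrightarrow> c < Im z \<and> Im z < d"
    and PR: "Re (pathstart P) \<le> u" "v \<le> Re (pathfinish P)"
  shows "path_image l \<inter> path_image P \<noteq> {}"
proof -
  have "bounded (path_image l \<union> path_image P)"
    by (simp add: assms bounded_path_image)
  then obtain M where M: "\<And>z. z \<in> path_image l \<union> path_image P \<Longrightarrow> norm z \<le> M"
    unfolding bounded_iff by blast
  have M': "\<bar>Re z\<bar> \<le> M" "\<bar>Im z\<bar> \<le> M" if "z \<in> path_image l \<union> path_image P" for z
    using M[OF that] abs_Re_le_cmod abs_Im_le_cmod order_trans by blast+
  define P0 P1 l0 l1 where "P0 = pathstart P" "P1 = pathfinish P" "l0 = pathstart l" "l1 = pathfinish l"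
  note defs = this
  have ends: "P0 \<in> path_image P" "P1 \<in> path_image P" "l0 \<in> path_image l" "l1 \<in> path_image l"
    by (auto simp: defs)
  define f where "f = linepath (Complex (-M) (Im P0)) P0 +++ P +++ linepath P1 (Complex M (Im P1))"
  define g where "g = linepath (Complex (Re l0) (-M)) l0 +++ l +++ linepath l1 (Complex (Re l1) M)"
  define B where "B = cbox (Complex (-M) (-M)) (Complex M M)"
  have Bz: "z \<in> B \<longleftrightarrow> \<bar>Re z\<bar> \<le> M \<and> \<bar>Im z\<bar> \<le> M" for z
    by (auto simp: B_def in_cbox_complex_iff)
  have pf: "path f" "path g"
    using l P by (auto simp: f_def g_def defs)
  have imf: "path_image f = closed_segment (Complex (-M) (Im P0)) P0 \<union> path_image P \<union> closed_segment P1 (Complex M (Im P1))"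
    using l P by (auto simp: f_def defs path_image_join)
  have img: "path_image g = closed_segment (Complex (Re l0) (-M)) l0 \<union> path_image l \<union> closed_segment l1 (Complex (Re l1) M)"
    using l P by (auto simp: g_def defs path_image_join)
  have Msgn: "-M \<le> Re z" "Re z \<le> M" "-M \<le> Im z" "Im z \<le> M" if "z \<in> path_image l \<union> path_image P" for z
    using M'[OF that] by auto
  have sf0: "z \<in> closed_segment (Complex (-M) (Im P0)) P0 \<Longrightarrow> Im z = Im P0 \<and> -M \<le> Re z \<and> Re z \<le> Re P0" for z
    using closed_segment_same_Im[of "Complex (-M) (Im P0)" P0] Msgn[of P0] ends
    by (auto simp: closed_segment_eq_real_ivl)
  have sf1: "z \<in> closed_segment P1 (Complex M (Im P1)) \<Longrightarrow> Im z = Im P1 \<and> Re P1 \<le> Re z \<and> Re z \<le> M" for z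
    using closed_segment_same_Im[of P1 "Complex M (Im P1)"] Msgn[of P1] ends
    by (auto simp: closed_segment_eq_real_ivl)
  have sg0: "z \<in> closed_segment (Complex (Re l0) (-M)) l0 \<Longrightarrow> Re z = Re l0 \<and> -M \<le> Im z \<and> Im z \<le> Im l0" for z
    using closed_segment_same_Re[of "Complex (Re l0) (-M)" l0] Msgn[of l0] ends
    by (auto simp: closed_segment_eq_real_ivl)
  have sg1: "z \<in> closed_segment l1 (Complex (Re l1) M) \<Longrightarrow> Re z = Re l1 \<and> Im l1 \<le> Im z \<and> Im z \<le> M" for z
    using closed_segment_same_Re[of l1 "Complex (Re l1) M"] Msgn[of l1] ends
    by (auto simp: closed_segment_eq_real_ivl)
  have "path_image f \<inter> path_image g \<noteq> {}"
  proof (rule paths_cross_box_complex[OF pf])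
    have "path_image P \<subseteq> B" "path_image l \<subseteq> B" using M' by (auto simp: Bz)
    moreover have "closed_segment (Complex (-M) (Im P0)) P0 \<subseteq> B"
      "closed_segment P1 (Complex M (Im P1)) \<subseteq> B"
      using sf0 sf1 M'[of P0] M'[of P1] ends unfolding subset_iff Bz abs_le_iff
      by (smt (verit) UnCI)+
    moreover have "closed_segment (Complex (Re l0) (-M)) l0 \<subseteq> B"
      "closed_segment l1 (Complex (Re l1) M) \<subseteq> B"
      using sg0 sg1 M'[of l0] M'[of l1] ends unfolding subset_iff Bz abs_le_iff
      by (smt (verit) UnCI)+
    ultimately show "path_image f \<subseteq> cbox (Complex (-M) (-M)) (Complex M M)"
      "path_image g \<subseteq> cbox (Complex (-M) (-M)) (Complex M M)"
      unfolding B_def[symmetric] imf img by blast+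
  qed (auto simp: f_def g_def)
  then obtain z where z: "z \<in> path_image f" "z \<in> path_image g" by auto
  have "Re P0 \<le> u" "v \<le> Re P1" "Im l0 \<le> c" "d \<le> Im l1"
    using lI PR by (auto simp: defs)
  then show ?thesis
    using z l(2) P(2) sf0[of z] sf1[of z] sg0[of z] sg1[of z] ends unfolding imf img
    by (smt (verit) Un_iff disjoint_iff)
qed

text \<open>
  The quadratic \<^term>\<open>Re ((z - c)\<^sup>2) / h\<^sup>2\<close> with centre \<^term>\<open>c\<close> the midpoint of the left side is harmonic,
  at most 1 on the rectangle and nonpositive on three of its sides; it bounds from below the harmonic
  measure of a curve that cuts off the fourth side.
\<close>

lemma two_constants_rectangle:
  fixes F :: "complex \<Rightarrow> complex"
  assumes F: "F holomorphic_on {z. Re z < 0}" "\<And>z. Re z < 0 \<Longrightarrow> norm (F z) \<le> 1"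
    and x0: "0 < x0" "x0 < h"
    and l: "path l" "\<And>z. z \<in> path_image l \<Longrightarrow> -x0 < Re z \<and> Re z < 0"
    and lI: "Im (pathstart l) \<le> \<theta> - h" "\<theta> + h \<le> Im (pathfinish l)"
    and \<epsilon>: "0 < \<epsilon>" "\<epsilon> \<le> 1" and le: "\<And>z. z \<in> path_image l \<Longrightarrow> norm (F z) \<le> \<epsilon>"
  shows "norm (F (Complex (-x0) \<theta>)) \<le> \<epsilon> powr (((h - x0) / h)\<^sup>2)"
proof -
  define B where "B = {z. -h < Re z \<and> Re z < 0 \<and> \<theta> - h < Im z \<and> Im z < \<theta> + h}"
  define c where "c = Complex (-h) \<theta>"
  define \<zeta> where "\<zeta> = Complex (-x0) \<theta>"
  have opB: "open B"
    unfolding B_def by (intro open_Collect_conj open_Collect_less continuous_intros)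
  define W where "W = connected_component_set (B - path_image l) \<zeta>"
  have cl: "compact (path_image l)" using l by blast
  have opBl: "open (B - path_image l)"
    using opB cl by (simp add: compact_imp_closed open_Diff)
  have \<zeta>: "\<zeta> \<in> B - path_image l"
    using x0 l(2)[of \<zeta>] by (auto simp: B_def \<zeta>_def)
  have "compact (Re ` path_image l)" "Re ` path_image l \<noteq> {}"
    using cl by (auto intro!: compact_continuous_image continuous_intros)
  then obtain s where s: "s \<in> Re ` path_image l" "\<And>t. t \<in> Re ` path_image l \<Longrightarrow> t \<le> s"
    by (meson compact_attains_sup)
  have s0: "s < 0" "-x0 < s" using s l(2) by auto
  have WB: "W \<subseteq> B - path_image l"
    unfolding W_def by (rule connected_component_subset)
  have opW: "open W" unfolding W_def by (intro open_connected_component opBl)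
  have pcW: "path_connected W"
    by (metis opW W_def connected_connected_component connected_open_path_connected)
  \<comment> \<open>With \<open>s\<close> the largest real part on \<open>l\<close>, the path
    \<open>l\<close> runs across the whole height of the box between \<open>\<zeta>\<close> and the
    line \<open>Re z = s / 2\<close>; so a path in \<open>W\<close> to that line would meet
    \<open>l\<close>. This keeps the closure of \<open>W\<close> inside the open half plane, where
    \<open>F\<close> is holomorphic.\<close>
  have Ws: "Re z < s / 2" if z: "z \<in> W" for z
  proof (rule ccontr)
    assume n: "\<not> Re z < s / 2"
    have "\<zeta> \<in> W" using \<zeta> by (simp add: W_def)
    then obtain P where P: "path P" "path_image P \<subseteq> W" "pathstart P = \<zeta>" "pathfinish P = z"
      using pcW z unfolding path_connected_def by blast
    have "path_image l \<inter> path_image P \<noteq> {}"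
    proof (rule paths_cross_strips[OF l(1) _ lI P(1)])
      show "-x0 < Re z \<and> Re z < s/2" if "z \<in> path_image l" for z
        using s(2)[of "Re z"] l(2)[OF that] that s0 by fastforce
      show "\<theta> - h < Im z \<and> Im z < \<theta> + h" if "z \<in> path_image P" for z
        using that P(2) WB by (auto simp: B_def)
    qed (use P n in \<open>auto simp: \<zeta>_def\<close>)
    then show False using P(2) WB by auto
  qed
  have clW: "closure W \<subseteq> {z. -h \<le> Re z \<and> Re z \<le> s/2 \<and> \<theta> - h \<le> Im z \<and> Im z \<le> \<theta> + h}"
  proof (rule closure_minimal)
    show "W \<subseteq> {z. -h \<le> Re z \<and> Re z \<le> s/2 \<and> \<theta> - h \<le> Im z \<and> Im z \<le> \<theta> + h}"
      using WB Ws by (force simp: B_def)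
    show "closed {z. -h \<le> Re z \<and> Re z \<le> s/2 \<and> \<theta> - h \<le> Im z \<and> Im z \<le> \<theta> + h}"
      by (intro closed_Collect_conj closed_Collect_le continuous_intros)
  qed
  have bW: "bounded W"
  proof (rule bounded_subset)
    show "bounded (cbox (Complex (-h) (\<theta>-h)) (Complex 0 (\<theta>+h)))" by simp
    show "W \<subseteq> cbox (Complex (-h) (\<theta>-h)) (Complex 0 (\<theta>+h))"
      using WB by (auto simp: B_def in_cbox_complex_iff)
  qed
  have frW: "frontier W \<subseteq> path_image l \<union> (- B)"
  proof -
    have "frontier W \<inter> (B - path_image l) = {}"
      using frontier_of_connected_component_subset[of "B - path_image l" \<zeta>] opBl
      unfolding W_def frontier_def using interior_open[OF opBl] by blast
    then show ?thesis by blast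
  qed
  define L where "L = - ln \<epsilon>"
  have L: "L \<ge> 0" using \<epsilon> by (simp add: L_def)
  \<comment> \<open>\<open>\<epsilon> * exp L = 1\<close> balances the bound on \<open>l\<close>,
    and on the remaining sides the exponential has norm at most 1. At \<open>\<zeta>\<close> the
    exponent is \<open>L\<close> times the square of \<open>(h - x0) / h\<close>, the power in the
    conclusion.\<close>
  define k where "k z = F z * exp (of_real (L / h\<^sup>2) * (z - c)\<^sup>2)" for z
  have h: "h > 0" using x0 by simp
  have nk: "norm (k z) = norm (F z) * exp (L * (((Re z + h)\<^sup>2 - (Im z - \<theta>)\<^sup>2) / h\<^sup>2))" for z
  proof -
    have "Re ((z - c)\<^sup>2) = (Re z + h)\<^sup>2 - (Im z - \<theta>)\<^sup>2"
      by (simp add: c_def power2_eq_square)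
    then show ?thesis by (simp add: k_def norm_mult)
  qed
  have clneg: "closure W \<subseteq> {z. Re z < 0}" using clW s0 by force
  have "norm (k \<zeta>) \<le> 1"
  proof (rule maximum_modulus_frontier[of k W])
    have "k holomorphic_on {z. Re z < 0}"
      unfolding k_def by (intro holomorphic_intros F)
    then show "k holomorphic_on interior W" "continuous_on (closure W) k"
      using clneg opW closure_subset[of W]
      by (metis holomorphic_on_subset interior_open order_trans, metis holomorphic_on_imp_continuous_on holomorphic_on_subset)
    show "\<zeta> \<in> W" using \<zeta> by (simp add: W_def)
    fix z assume z: "z \<in> frontier W"
    then have zc: "z \<in> closure W" by (simp add: frontier_def)
    with clW s0 have zb: "-h \<le> Re z" "Re z < 0" "\<bar>Im z - \<theta>\<bar> \<le> h" by force+
    define v where "v = ((Re z + h)\<^sup>2 - (Im z - \<theta>)\<^sup>2) / h\<^sup>2"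
    have "(Re z + h)\<^sup>2 \<le> h\<^sup>2" using zb by (intro power_mono) auto
    then have v1: "v \<le> 1" using h
      unfolding v_def by (simp add: divide_le_eq) (smt (verit) zero_le_power2)
    have nF: "norm (F z) \<le> 1" using F zb by simp
    consider "z \<in> path_image l" | "z \<notin> B" using frW z by blast
    then show "norm (k z) \<le> 1"
    proof cases
      case 1
      have "norm (F z) * exp (L * v) \<le> \<epsilon> * exp L"
        using le[OF 1] v1 L \<epsilon> by (intro mult_mono) (auto simp: mult_left_le)
      also have "\<dots> = 1" using \<epsilon> by (simp add: L_def exp_minus)
      finally show ?thesis by (simp add: nk v_def)
    next
      case 2
      then have or: "Re z = -h \<or> \<bar>Im z - \<theta>\<bar> = h" using zb by (auto simp: B_def)
      have "(Re z + h)\<^sup>2 \<le> (Im z - \<theta>)\<^sup>2"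
        using or
      proof
        assume "\<bar>Im z - \<theta>\<bar> = h"
        then have "(Im z - \<theta>)\<^sup>2 = h\<^sup>2" by (metis power2_abs)
        then show ?thesis using \<open>(Re z + h)\<^sup>2 \<le> h\<^sup>2\<close> by simp
      qed simp
      then have "v \<le> 0" unfolding v_def by (simp add: divide_le_0_iff)
      then have "exp (L * v) \<le> 1" using L by (simp add: mult_nonneg_nonpos)
      then show ?thesis using nF by (simp add: nk v_def mult_le_one)
    qed
  qed (rule bW)
  then have "norm (F \<zeta>) * exp (L * ((h - x0)/h)\<^sup>2) \<le> 1"
    by (simp add: nk \<zeta>_def power_divide)
  then have "norm (F \<zeta>) \<le> exp (- (L * ((h - x0)/h)\<^sup>2))"
    by (simp add: exp_minus field_simps)
  also have "\<dots> = \<epsilon> powr (((h - x0)/h)\<^sup>2)"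
    using \<epsilon> by (simp add: powr_def L_def mult.commute)
  finally show ?thesis by (simp add: \<zeta>_def)
qed


text \<open>The derivative of the exponential has modulus at most 1 on the convex set of nonpositive
  real parts; so distances in the disc are at most those in the logarithmic coordinate.\<close>

lemma norm_exp_diff_le:
  fixes u v :: complex
  assumes "Re u \<le> 0" "Re v \<le> 0"
  shows "norm (exp u - exp v) \<le> norm (u - v)"
proof -
  have "norm (exp u - exp v) \<le> 1 * norm (u - v)"
  proof (rule field_differentiable_bound[where S="{z. Re z \<le> 0}"])
    show "convex {z. Re z \<le> 0}" by (rule convex_halfspace_Re_le)
    show "(exp has_field_derivative exp z) (at z within {z. Re z \<le> 0})" for z
      by (rule DERIV_exp[THEN has_field_derivative_at_within])
  qed (use assms in auto)
  then show ?thesis by simp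
qed

text \<open>
  In the coordinate \<^term>\<open>Ln z\<close> a connected set of large diameter close to the circle contains a path that
  crosses a rectangle of fixed width; \<^term>\<open>f\<close> is then tiny at the centre of that rectangle, whose
  distance \<^term>\<open>x0\<close> to the boundary was chosen so that the corresponding circle carries no zero of \<^term>\<open>f\<close>.
\<close>

lemma koebe_arcs:
  fixes f :: "complex \<Rightarrow> complex"
  assumes holf: "f holomorphic_on ball 0 1" and bnd: "\<And>z. z \<in> ball 0 1 \<Longrightarrow> norm (f z) \<le> M"
    and nc: "\<not> f constant_on ball 0 1" and \<delta>: "\<delta> > 0"
  obtains \<epsilon> \<rho> where "\<epsilon> > 0" "0 < \<rho>" "\<rho> < 1"
    "\<And>C z w. path_connected C \<Longrightarrow> (\<And>x. x \<in> C \<Longrightarrow> \<rho> < norm x \<and> norm x < 1 \<and> norm (f x) < \<epsilon>)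
        \<Longrightarrow> z \<in> C \<Longrightarrow> w \<in> C \<Longrightarrow> dist z w \<le> \<delta>"
proof -
  obtain z0 where "z0 \<in> ball 0 1" "f z0 \<noteq> 0"
    using nc unfolding constant_on_def by blast
  then have M: "M > 0" using bnd[of z0] by (smt (verit) zero_less_norm_iff)
  \<comment> \<open>The choice \<open>\<delta> / 4\<close> leaves room: a logarithmic displacement
    above \<open>4 * h\<close> whose real part is at most \<open>h\<close> has imaginary part at
    least \<open>2 * h\<close>, the height of the rectangle.\<close>
  define h where "h = \<delta> / 4"
  have h: "h > 0" using \<delta> by (simp add: h_def)
  define K where "K = cball (0::complex) (exp (-h/2))"
  have eh: "exp (-h/2) < 1" using h by simp
  \<comment> \<open>Only finitely many circles around 0 inside \<open>K\<close> carry zeros, so the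
    interval from \<open>h / 2\<close> to \<open>h\<close> contains an \<open>x0\<close> whose
    circle carries none. The minimum \<open>\<mu>\<close> on that circle is positive and serves at
    whatever height the rectangle is centred.\<close>
  have "finite {z \<in> K. f z = 0}"
  proof (rule holomorphic_compact_finite_zeros[of f "ball 0 1"])
    show "K \<subseteq> ball 0 1" using order_le_less_trans[OF _ eh] by (auto simp: K_def)
  qed (use holf nc in \<open>auto simp: K_def\<close>)
  then have "finite ((\<lambda>z. - ln (norm z)) ` {z \<in> K. f z = 0})" by simp
  moreover have "infinite {h/2<..<h}" using h by simp
  ultimately obtain x0 where x0: "x0 \<in> {h/2<..<h}" "x0 \<notin> (\<lambda>z. - ln (norm z)) ` {z \<in> K. f z = 0}"
    by (meson finite_subset subsetI)
  have x0p: "x0 > 0" "x0 < h" using x0 h by auto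
  define \<rho> where "\<rho> = exp (-x0)"
  have \<rho>: "0 < \<rho>" "\<rho> < 1" using x0p by (auto simp: \<rho>_def)
  have f0: "f z \<noteq> 0" if "z \<in> sphere 0 \<rho>" for z
  proof
    assume "f z = 0"
    moreover have "z \<in> K" using that x0 by (auto simp: K_def \<rho>_def)
    moreover have "x0 = - ln (norm z)" using that by (auto simp: \<rho>_def)
    ultimately show False using x0 by blast
  qed
  have "compact ((\<lambda>z. norm (f z) / M) ` sphere 0 \<rho>)"
    using \<rho> M by (intro compact_continuous_image continuous_intros
        continuous_on_subset[OF holomorphic_on_imp_continuous_on[OF holf]]) auto
  moreover have "(\<lambda>z. norm (f z) / M) ` sphere 0 \<rho> \<noteq> {}" using \<rho> by auto
  ultimately obtain \<mu> where \<mu>: "\<mu> \<in> (\<lambda>z. norm (f z) / M) ` sphere 0 \<rho>"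
      "\<And>t. t \<in> (\<lambda>z. norm (f z) / M) ` sphere 0 \<rho> \<Longrightarrow> \<mu> \<le> t"
    by (meson compact_attains_inf)
  have \<mu>0: "\<mu> > 0" using \<mu>(1) f0 M by auto
  define \<kappa> where "\<kappa> = ((h - x0)/h)\<^sup>2"
  have \<kappa>: "\<kappa> > 0" using x0p h by (simp add: \<kappa>_def)
  \<comment> \<open>\<open>e\<close> is so small that the two constants bound
    \<open>e powr \<kappa>\<close> falls below the minimum \<open>\<mu>\<close>; this will be the
    contradiction.\<close>
  define e where "e = min 1 ((\<mu>/2) powr (1/\<kappa>))"
  have e: "0 < e" "e \<le> 1" using \<mu>0 by (auto simp: e_def)
  have "e powr \<kappa> \<le> ((\<mu>/2) powr (1/\<kappa>)) powr \<kappa>"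
    using e \<kappa> by (intro powr_mono2) (auto simp: e_def)
  also have "\<dots> = \<mu>/2" using \<kappa> \<mu>0 by (simp add: powr_powr)
  finally have ek: "e powr \<kappa> < \<mu>" using \<mu>0 by simp
  have main: "dist z w \<le> \<delta>"
    if C: "path_connected C" "\<And>x. x \<in> C \<Longrightarrow> \<rho> < norm x \<and> norm x < 1 \<and> norm (f x) < e * M"
      and z: "z \<in> C" and w: "w \<in> C" for C z w
  proof (rule ccontr)
    assume far: "\<not> dist z w \<le> \<delta>"
    obtain \<gamma> where \<gamma>: "path \<gamma>" "path_image \<gamma> \<subseteq> C" "pathstart \<gamma> = z" "pathfinish \<gamma> = w"
      using C(1) z w unfolding path_connected_def by blast
    have "\<gamma> t \<noteq> 0" if "t \<in> {0..1}" for t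
      using that \<gamma>(2) C(2)[of "\<gamma> t"] \<rho> by (force simp: path_image_def)
    then obtain l where l: "continuous_on {0..1} l" "\<And>t. t \<in> {0..1} \<Longrightarrow> \<gamma> t = exp (l t)"
      using continuous_logarithm_on_contractible[of "{0..1}" \<gamma>] \<gamma>(1)
      by (metis convex_imp_contractible convex_real_interval(5) path_def)
    have pl: "path l" using l(1) by (simp add: path_def)
    have lC: "exp x \<in> C" if "x \<in> path_image l" for x
      using that l(2) \<gamma>(2) by (force simp: path_image_def)
    have lRe: "- x0 < Re x \<and> Re x < 0" if "x \<in> path_image l" for x
      using C(2)[OF lC[OF that]] by (simp add: \<rho>_def)
    define F where "F x = f (exp x) / M" for x
    have holF: "F holomorphic_on {x. Re x < 0}"
    proof -
      have "(\<lambda>x. f (exp x)) holomorphic_on {x. Re x < 0}"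
        by (rule holomorphic_on_compose_gen[OF holomorphic_on_exp holf, unfolded o_def]) auto
      then show ?thesis unfolding F_def using M by (intro holomorphic_intros) auto
    qed
    have F1: "norm (F x) \<le> 1" if "Re x < 0" for x
      using bnd[of "exp x"] that M by (simp add: F_def norm_divide)
    have Fl: "norm (F x) \<le> e" if "x \<in> path_image l" for x
      using C(2)[OF lC[OF that]] M by (simp add: F_def norm_divide divide_le_eq)
    define u v where "u = pathstart l" "v = pathfinish l"
    note uv = this
    have zw: "z = exp u" "w = exp v"
      using \<gamma>(3,4) l(2) by (auto simp: uv pathstart_def pathfinish_def)
    have uvl: "u \<in> path_image l" "v \<in> path_image l" by (auto simp: uv)
    have "4 * h < norm (u - v)"
      using far norm_exp_diff_le[of u v] lRe[OF uvl(1)] lRe[OF uvl(2)] by (simp add: zw dist_norm h_def)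
    also have "\<dots> \<le> \<bar>Re u - Re v\<bar> + \<bar>Im u - Im v\<bar>"
      using cmod_le[of "u - v"] by simp
    also have "\<bar>Re u - Re v\<bar> \<le> h"
      using lRe[OF uvl(1)] lRe[OF uvl(2)] x0p by linarith
    finally have uvI: "\<bar>Im u - Im v\<bar> \<ge> 2*h" using h by simp
    \<comment> \<open>The logarithm may run upwards or downwards. The claim is made for an arbitrary
      path with the same image, so that the second case is settled by reversing
      \<open>l\<close>.\<close>
    have contra: False
      if k: "path k" "path_image k = path_image l" "Im (pathstart k) + 2*h \<le> Im (pathfinish k)" for k
    proof -
      define \<theta> where "\<theta> = Im (pathstart k) + h"
      have "norm (F (Complex (-x0) \<theta>)) \<le> e powr (((h - x0) / h)\<^sup>2)"
        by (rule two_constants_rectangle[OF holF F1 x0p k(1) _ _ _ e])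
          (use k lRe Fl in \<open>auto simp: \<theta>_def\<close>)
      also have "\<dots> < \<mu>" using ek by (simp add: \<kappa>_def)
      also have "\<mu> \<le> norm (F (Complex (-x0) \<theta>))"
        by (rule \<mu>(2)) (use M in \<open>auto simp: F_def norm_divide \<rho>_def intro!: image_eqI[where x="exp (Complex (-x0) \<theta>)"]\<close>)
      finally show False by simp
    qed
    show False
    proof (cases "Im u \<le> Im v")
      case True
      then show False using contra[of l] pl uvI by (simp add: uv)
    next
      case False
      then show False using contra[of "reversepath l"] pl uvI by (simp add: uv)
    qed
  qed
  show thesis
    by (rule that[of "e * M" \<rho>]) (use e M \<rho> main in auto)
qed

section \<open>Lindelof's theorem\<close>

text \<open>A closed ball is convex and so contains the inside of its subsets; the inside of a
  closed set is open and therefore misses the bounding circle.\<close>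

lemma inside_subset_ball:
  fixes S :: "complex set"
  assumes "S \<subseteq> cball a r" "closed S"
  shows "inside S \<subseteq> ball a r"
proof -
  have "inside S \<subseteq> cball a r"
    using inside_mono[OF assms(1)] inside_convex[of "cball a r"] by auto
  then have "interior (inside S) \<subseteq> interior (cball a r)" by (rule interior_mono)
  then show ?thesis
    using open_inside[OF assms(2)] by (simp add: interior_open)
qed

text \<open>The inside and the outside of the curve, with \<open>q\<close> removed, are connected
  and miss the frontier of \<open>G\<close>, so \<open>G\<close> contains each of them or is
  disjoint from it. Boundedness excludes the outside, and a nonempty open \<open>G\<close> cannot
  consist of points of the curve and \<open>q\<close> alone. The exceptional point \<open>q\<close>
  is there for the limit value at the fixed point of a parabolic deck transformation.\<close>

lemma Jordan_inside_subset_of_frontier_subset: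
  fixes c :: "real \<Rightarrow> complex"
  assumes c: "simple_path c" "pathfinish c = pathstart c"
    and G: "open G" "G \<noteq> {}" "bounded G" and fr: "frontier G \<subseteq> insert q (path_image c)"
  shows "inside (path_image c) - {q} \<subseteq> G"
proof -
  define S where "S = path_image c"
  note J = Jordan_inside_outside[OF c, folded S_def]
  have sub: "X \<subseteq> G" if "connected X" "X \<inter> G \<noteq> {}" "X \<inter> insert q S = {}" for X
    using connected_Int_frontier[of X G] that fr by (force simp: S_def)
  have out: "(outside S - {q}) \<inter> G = {}"
  proof (rule ccontr)
    assume "(outside S - {q}) \<inter> G \<noteq> {}"
    moreover have "connected (outside S - {q})"
      by (rule connected_open_delete) (use J in auto)
    moreover have "(outside S - {q}) \<inter> insert q S = {}"
      using outside_no_overlap[of S] by blast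
    ultimately have "outside S - {q} \<subseteq> G"
      using sub by blast
    then have "bounded (outside S)"
      using G(3) by (metis bounded_insert bounded_subset insert_Diff_single)
    then show False using J by blast
  qed
  have "G \<inter> S = {}"
  proof (rule ccontr)
    assume "G \<inter> S \<noteq> {}"
    then have "G \<inter> closure (outside S) \<noteq> {}" using J by (auto simp: frontier_def)
    then have ne: "G \<inter> outside S \<noteq> {}" using G(1) by (simp add: open_Int_closure_eq_empty)
    have "G \<inter> outside S \<subseteq> {q}" using out by auto
    then show False using ne G(1) J by (metis finite.emptyI finite.insertI finite_imp_not_open open_Int finite_subset)
  qed
  moreover have "S \<union> inside S \<union> outside S = UNIV"
    using inside_Un_outside[of S] by blast
  ultimately have "G \<subseteq> inside S \<union> {q}" using out by blast
  moreover have "\<not> G \<subseteq> {q}"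
    using G by (metis finite.emptyI finite.insertI finite_imp_not_open finite_subset)
  ultimately have "(inside S - {q}) \<inter> G \<noteq> {}" by blast
  moreover have "connected (inside S - {q})"
    by (rule connected_open_delete) (use J in auto)
  moreover have "(inside S - {q}) \<inter> insert q S = {}"
    using inside_no_overlap[of S] by blast
  ultimately have "inside S - {q} \<subseteq> G"
    using sub by blast
  then show ?thesis by (simp add: S_def)
qed

text \<open>Half angle formula: twice the squared real part of \<open>csqrt w\<close> is
  \<open>norm w + Re w\<close>, which lies between \<open>norm w\<close> and
  \<open>2 * norm w\<close>.\<close>

lemma Re_csqrt_bounds:
  assumes "Re w \<ge> 0"
  shows "sqrt (norm w) \<le> sqrt 2 * Re (csqrt w)" "sqrt 2 * Re (csqrt w) \<le> sqrt (2 * norm w)"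
proof -
  have "sqrt 2 * Re (csqrt w) = sqrt (norm w + Re w)"
    by (simp add: real_sqrt_mult[symmetric])
  then show "sqrt (norm w) \<le> sqrt 2 * Re (csqrt w)" "sqrt 2 * Re (csqrt w) \<le> sqrt (2 * norm w)"
    using assms complex_Re_le_cmod[of w] by (simp_all del: csqrt.simps)
qed

lemma Re_one_minus_pos:
  assumes "norm \<beta> = 1" "norm z < 1"
  shows "Re (1 - z / \<beta>) > 0"
  using complex_Re_le_cmod[of "z / \<beta>"] assms by (simp add: norm_divide)

lemma norm_one_minus_div:
  assumes "norm \<beta> = (1::real)"
  shows "norm (1 - z / \<beta>) = dist z (\<beta>::complex)"
proof -
  have "\<beta> \<noteq> 0" using assms by auto
  then have "1 - z / \<beta> = (\<beta> - z) / \<beta>" by (simp add: divide_simps)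
  then show ?thesis using assms by (simp add: norm_divide dist_norm norm_minus_commute)
qed

text \<open>
  Since \<^term>\<open>1 - z / \<beta>\<close> lies in the right half plane, the real part of its square root is a barrier: it is
  comparable to \<^term>\<open>sqrt (dist z \<beta>)\<close>. The factor with exponent \<^term>\<open>\<tau>\<close> removes the boundary point \<^term>\<open>\<beta>\<close>,
  where nothing is known, and disappears as \<^term>\<open>\<tau>\<close> tends to 0.
\<close>

lemma lindelof_estimate:
  fixes h :: "complex \<Rightarrow> complex"
  assumes W: "open W" "W \<subseteq> ball 0 1" "W \<subseteq> ball \<beta> \<delta>" and clW: "closure W \<subseteq> insert \<beta> (ball 0 1)"
    and \<beta>: "norm \<beta> = 1" and \<delta>: "\<delta> > 0" and \<epsilon>: "0 < \<epsilon>" "\<epsilon> \<le> 1"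
    and holh: "h holomorphic_on ball 0 1" and h1: "\<And>z. z \<in> ball 0 1 \<Longrightarrow> norm (h z) \<le> 1"
    and fr: "\<And>z. z \<in> frontier W \<Longrightarrow> z \<noteq> \<beta> \<Longrightarrow> dist z \<beta> = \<delta> \<or> norm (h z) \<le> \<epsilon>"
    and x: "x \<in> W" "dist x \<beta> \<le> \<delta> / 8"
  shows "norm (h x) \<le> sqrt \<epsilon>"
proof -
  define L where "L = - ln \<epsilon>"
  have L: "L \<ge> 0" using \<epsilon> by (simp add: L_def)
  define u where "u z = 1 - z / \<beta>" for z
  have \<beta>0: "\<beta> \<noteq> 0" using \<beta> by auto
  have nu: "norm (u z) = dist z \<beta>" for z
    unfolding u_def by (rule norm_one_minus_div[OF \<beta>])
  have Reu: "Re (u z) > 0" if "z \<in> ball 0 1" for z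
    unfolding u_def using Re_one_minus_pos[OF \<beta>] that by simp
  have u0: "u z / \<delta> \<notin> \<real>\<^sub>\<le>\<^sub>0" "u z / 2 \<notin> \<real>\<^sub>\<le>\<^sub>0" "u z \<noteq> 0" if "z \<in> ball 0 1" for z
    using Reu[OF that] \<delta> by (auto simp: complex_nonpos_Reals_iff divide_le_0_iff)
  define v where "v z = sqrt 2 * Re (csqrt (u z / \<delta>))" for z
  have v: "sqrt (dist z \<beta> / \<delta>) \<le> v z" "v z \<le> sqrt (2 * (dist z \<beta> / \<delta>))" if "z \<in> ball 0 1" for z
    using Re_csqrt_bounds[of "u z / \<delta>"] Reu[OF that] \<delta> unfolding v_def by (simp_all add: norm_divide nu)
  have bound: "norm (h x) * exp (L * (1 - v x)) * (dist x \<beta> / 2) powr \<tau> \<le> 1" if \<tau>: "\<tau> > 0" for \<tau>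
  proof -
    \<comment> \<open>The first exponential has norm at most 1 where
      \<open>dist z \<beta> = \<delta>\<close>, because \<open>v z\<close> is at least 1 there, and
      at most \<open>1 / \<epsilon>\<close> everywhere. The base \<open>u z / 2\<close> of the
      second has norm at most 1 because the disc has diameter 2.\<close>
    define k0 where "k0 z = h z * exp (of_real L * (1 - of_real (sqrt 2) * csqrt (u z / \<delta>))) * exp (of_real \<tau> * Ln (u z / 2))" for z
    define k where "k z = (if z = \<beta> then 0 else k0 z)" for z
    have \<beta>b: "\<beta> \<notin> ball 0 1" using \<beta> by simp
    have nk0: "norm (k0 z) = norm (h z) * exp (L * (1 - v z)) * (dist z \<beta> / 2) powr \<tau>" if "z \<in> ball 0 1" for z
    proof -
      have "norm (exp (of_real \<tau> * Ln (u z / 2))) = (dist z \<beta> / 2) powr \<tau>"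
        using u0[OF that] nu[of z] by (simp add: powr_def norm_divide flip: nu)
      then show ?thesis by (simp add: k0_def v_def norm_mult)
    qed
    have holk0: "k0 holomorphic_on ball 0 1"
      unfolding k0_def
      by (intro holomorphic_intros holh holomorphic_on_csqrt' holomorphic_on_Ln' u0)
        (auto simp: u_def \<beta>0 intro!: holomorphic_intros)
    have holk: "k holomorphic_on ball 0 1"
      by (rule holomorphic_transform[OF holk0]) (use \<beta>b in \<open>auto simp: k_def\<close>)
    have contk: "continuous_on (closure W) k"
      unfolding continuous_on_eq_continuous_within
    proof
      fix z assume z: "z \<in> closure W"
      show "continuous (at z within closure W) k"
      proof (cases "z = \<beta>")
        case False
        then have "z \<in> ball 0 1" using z clW by auto
        then show ?thesis
          using holk by (metis continuous_at_imp_continuous_at_within continuous_on_eq_continuous_at holomorphic_on_imp_continuous_on open_ball)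
      next
        case True
        have "((\<lambda>z. exp L * (dist z \<beta> / 2) powr \<tau>) \<longlongrightarrow> exp L * (dist \<beta> \<beta> / 2) powr \<tau>) (at \<beta> within closure W)"
          using \<tau> by (intro tendsto_intros tendsto_powr') auto
        then have *: "((\<lambda>z. exp L * (dist z \<beta> / 2) powr \<tau>) \<longlongrightarrow> 0) (at \<beta> within closure W)"
          by simp
        have "(k \<longlongrightarrow> 0) (at \<beta> within closure W)"
        proof (rule Lim_null_comparison[OF _ *])
          show "\<forall>\<^sub>F z in at \<beta> within closure W. norm (k z) \<le> exp L * (dist z \<beta> / 2) powr \<tau>"
            unfolding eventually_at_filter
          proof (intro always_eventually allI impI)
            fix z assume "z \<noteq> \<beta>" "z \<in> closure W"
            then have z1: "z \<in> ball 0 1" using clW by auto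
            have "0 \<le> v z" using v(1)[OF z1] \<delta> by (meson order_trans real_sqrt_ge_zero zero_le_dist divide_nonneg_pos)
            then have "L * (1 - v z) \<le> L" using L by (simp add: mult_left_le)
            then have "norm (h z) * exp (L * (1 - v z)) \<le> 1 * exp L"
              using h1[OF z1] by (intro mult_mono) auto
            then show "norm (k z) \<le> exp L * (dist z \<beta> / 2) powr \<tau>"
              using \<open>z \<noteq> \<beta>\<close> by (simp add: k_def nk0[OF z1] mult_right_mono)
          qed
        qed
        then show ?thesis using True by (simp add: continuous_within k_def)
      qed
    qed
    have "norm (k x) \<le> 1"
    proof (rule maximum_modulus_frontier[of k W])
      show "k holomorphic_on interior W"
        using holk W by (meson holomorphic_on_subset interior_subset order_trans)
      show "bounded W" using W(2) bounded_ball bounded_subset by blast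
      fix z assume z: "z \<in> frontier W"
      show "norm (k z) \<le> 1"
      proof (cases "z = \<beta>")
        case False
        then have z1: "z \<in> ball 0 1" using clW z by (auto simp: frontier_def)
        have d: "dist z \<beta> / 2 \<le> 1"
          using norm_triangle_ineq4[of z \<beta>] z1 \<beta> by (simp add: dist_norm)
        have p: "(dist z \<beta> / 2) powr \<tau> \<le> 1"
          using d \<tau> by (intro powr_le1) auto
        have "norm (h z) * exp (L * (1 - v z)) \<le> 1"
          using fr[OF z False]
        proof
          assume "dist z \<beta> = \<delta>"
          then have "v z \<ge> 1" using v(1)[OF z1] \<delta> by simp
          then have "L * (1 - v z) \<le> 0" using L by (simp add: mult_nonneg_nonpos)
          then show ?thesis using h1[OF z1] by (simp add: mult_le_one)
        next
          assume *: "norm (h z) \<le> \<epsilon>"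
          have "0 \<le> v z" using v(1)[OF z1] \<delta> by (meson order_trans real_sqrt_ge_zero zero_le_dist divide_nonneg_pos)
          then have "L * (1 - v z) \<le> L" using L by (simp add: mult_left_le)
          then have "norm (h z) * exp (L * (1 - v z)) \<le> \<epsilon> * exp L"
            using * \<epsilon> by (intro mult_mono) auto
          also have "\<dots> = 1" using \<epsilon> by (simp add: L_def exp_minus)
          finally show ?thesis .
        qed
        then show ?thesis using p False by (simp add: k_def nk0[OF z1] mult_le_one)
      qed (simp add: k_def)
    qed (use x contk in auto)
    moreover have "x \<in> ball 0 1" "x \<noteq> \<beta>" using x W \<beta>b by auto
    ultimately show ?thesis by (simp add: k_def nk0)
  qed
  have x1: "x \<in> ball 0 1" "x \<noteq> \<beta>" using x W \<beta> by auto
  define A where "A = norm (h x) * exp (L * (1 - v x))"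
  have "A \<le> 1"
  proof (rule tendsto_upperbound)
    have "((\<lambda>\<tau>. A * (dist x \<beta> / 2) powr \<tau>) \<longlongrightarrow> A * (dist x \<beta> / 2) powr 0) (at_right 0)"
      using x1 by (intro tendsto_intros) auto
    then show "((\<lambda>\<tau>. A * (dist x \<beta> / 2) powr \<tau>) \<longlongrightarrow> A) (at_right 0)"
      using x1 by simp
    show "\<forall>\<^sub>F \<tau> in at_right 0. A * (dist x \<beta> / 2) powr \<tau> \<le> 1"
      unfolding A_def by (rule eventually_at_right_less[THEN eventually_mono]) (rule bound)
  qed simp
  \<comment> \<open>This is the purpose of the bound \<open>\<delta> / 8\<close>:
    \<open>sqrt (2 / 8) = 1 / 2\<close> makes the factor \<open>exp (L * (1 - v x))\<close> at least
    \<open>exp (L / 2)\<close>, that is \<open>1 / sqrt \<epsilon>\<close>.\<close>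
  have "v x \<le> 1/2"
  proof -
    have "v x \<le> sqrt (2 * (dist x \<beta> / \<delta>))" using v(2)[OF x1(1)] .
    also have "\<dots> \<le> sqrt (1/4)"
      using x(2) \<delta> by (intro real_sqrt_le_mono) (simp add: field_simps)
    also have "\<dots> = 1/2" by (simp add: real_sqrt_divide)
    finally show ?thesis .
  qed
  then have "L * (1/2) \<le> L * (1 - v x)" using L by (intro mult_left_mono) auto
  then have "norm (h x) * exp (L / 2) \<le> A" unfolding A_def by (intro mult_left_mono) auto
  then have "norm (h x) * exp (L / 2) \<le> 1" using \<open>A \<le> 1\<close> by simp
  moreover have "exp (L / 2) = 1 / sqrt \<epsilon>"
    using \<epsilon> by (simp add: L_def exp_minus ln_sqrt[symmetric] field_simps flip: ln_div) 
  ultimately show ?thesis using \<epsilon> by (simp add: field_simps)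
qed

text \<open>The part of the enclosed region in a small disc around \<open>\<beta>\<close> has its
  frontier on the loop, where \<open>h\<close> is small, or at distance \<open>\<delta>\<close> from
  \<open>\<beta>\<close>; this is the boundary hypothesis of \<open>lindelof_estimate\<close>, and
  its bound \<open>sqrt \<epsilon>\<close> tends to 0 with \<open>\<epsilon>\<close>.\<close>

lemma lindelof_inside:
  fixes h :: "complex \<Rightarrow> complex"
  assumes c: "simple_path c" "pathfinish c = pathstart c"
    and cb: "path_image c \<subseteq> insert \<beta> (ball 0 1)" and \<beta>: "norm \<beta> = 1"
    and holh: "h holomorphic_on ball 0 1" and hM: "\<And>z. z \<in> ball 0 1 \<Longrightarrow> norm (h z) \<le> M"
    and lim: "(h \<longlongrightarrow> 0) (at \<beta> within path_image c)"
  shows "(h \<longlongrightarrow> 0) (at \<beta> within inside (path_image c))"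
proof -
  define S where "S = path_image c"
  note J = Jordan_inside_outside[OF c, folded S_def]
  have M: "M \<ge> 0" using hM[of 0] norm_ge_zero[of "h 0"] by (simp del: norm_ge_zero)
  define N where "N = M + 1"
  have N: "N > 0" "M \<le> N" using M by (auto simp: N_def)
  have "S \<subseteq> cball 0 1" using cb \<beta> by (auto simp: S_def subset_iff)
  then have inb: "inside S \<subseteq> ball 0 1"
    using c by (intro inside_subset_ball) (auto simp: S_def closed_path_image simple_path_imp_path)
  show ?thesis
    unfolding S_def[symmetric] Lim_within
  proof (intro allI impI)
    fix e :: real assume e: "e > 0"
    define \<epsilon> where "\<epsilon> = min 1 ((e / (2 * N))\<^sup>2)"
    have \<epsilon>: "0 < \<epsilon>" "\<epsilon> \<le> 1" using e N by (auto simp: \<epsilon>_def)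
    have "sqrt \<epsilon> \<le> sqrt ((e / (2 * N))\<^sup>2)" by (intro real_sqrt_le_mono) (simp add: \<epsilon>_def)
    also have "\<dots> = e / (2 * N)" using e N by simp
    finally have se: "sqrt \<epsilon> * N < e" using e N by (simp add: field_simps)
    obtain \<delta>0 where \<delta>0: "\<delta>0 > 0" "\<And>x. x \<in> S \<Longrightarrow> 0 < dist x \<beta> \<Longrightarrow> dist x \<beta> < \<delta>0 \<Longrightarrow> dist (h x) 0 < \<epsilon> * N"
      using lim[folded S_def, unfolded Lim_within, rule_format, of "\<epsilon> * N"] \<epsilon> N by auto
    define \<delta> where "\<delta> = \<delta>0 / 2"
    have \<delta>: "\<delta> > 0" "\<delta> < \<delta>0" using \<delta>0 by (auto simp: \<delta>_def)
    define W where "W = inside S \<inter> ball \<beta> \<delta>"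
    have clin: "closure (inside S) = inside S \<union> S"
      using J closure_Un_frontier[of "inside S"] by metis
    have cl1: "closure W \<subseteq> inside S \<union> S" unfolding W_def clin[symmetric] by (simp add: closure_mono)
    have "norm (h x) < e" if x: "x \<in> inside S" "dist x \<beta> < \<delta> / 8" for x
    proof -
      have "norm (h x / N) \<le> sqrt \<epsilon>"
      proof (rule lindelof_estimate[where W = W and \<beta> = \<beta> and \<delta> = \<delta> and h = "\<lambda>x. h x / N"])
        show "open W" using J by (simp add: W_def open_Int)
        show "W \<subseteq> ball 0 1" using inb by (auto simp: W_def)
        show "closure W \<subseteq> insert \<beta> (ball 0 1)"
          using cl1 inb cb by (auto simp: S_def)
        show "(\<lambda>x. h x / N) holomorphic_on ball 0 1"
          using N by (intro holomorphic_intros holh) auto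
        show "norm (h z / N) \<le> 1" if "z \<in> ball 0 1" for z
          using hM[OF that] N by (simp add: norm_divide)
        show "x \<in> W" using x \<delta> by (auto simp: W_def dist_commute)
        fix z assume z: "z \<in> frontier W" "z \<noteq> \<beta>"
        show "dist z \<beta> = \<delta> \<or> norm (h z / N) \<le> \<epsilon>"
        proof (cases "dist z \<beta> = \<delta>")
          case False
          have "z \<in> closure W" using z by (simp add: frontier_def)
          then have "z \<in> closure (ball \<beta> \<delta>)" by (metis W_def closure_mono inf_le2 subsetD)
          then have d: "dist z \<beta> < \<delta>" using False \<delta> by (simp add: dist_commute)
          have "z \<notin> W" using z \<open>open W\<close> by (simp add: frontier_def interior_open)
          then have "z \<notin> inside S" using d by (auto simp: W_def dist_commute)
          then have "z \<in> S" using cl1 \<open>z \<in> closure W\<close> by blast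
          then have "norm (h z) < \<epsilon> * N" using \<delta>0(2)[of z] z d \<delta> by simp
          then show ?thesis using N by (simp add: norm_divide divide_le_eq)
        qed simp
      qed (use \<beta> \<delta> \<epsilon> x in \<open>auto simp: W_def\<close>)
      then have "norm (h x) \<le> sqrt \<epsilon> * N" using N by (simp add: norm_divide divide_le_eq)
      then show ?thesis using se by simp
    qed
    then show "\<exists>d>0. \<forall>x\<in>inside S. 0 < dist x \<beta> \<and> dist x \<beta> < d \<longrightarrow> dist (h x) 0 < e"
      using \<delta> by (intro exI[of _ "\<delta>/8"]) auto
  qed
qed

section \<open>Images of regions enclosed by loops, and limits along path images\<close>

text \<open>The image of the enclosed region is open and bounded. A frontier point of it is a limit
  of values along a sequence that may be taken convergent, and the limit is on the loop since
  otherwise the frontier point would be an attained value. So only cluster values along the loop,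
  controlled by \<open>clu\<close>, have to lie on the curve or at \<open>q\<close>.\<close>

lemma Jordan_inside_subset_image_inside:
  fixes f :: "complex \<Rightarrow> complex"
  assumes g: "simple_path g" "pathfinish g = pathstart g"
    and c: "simple_path c" "pathfinish c = pathstart c" "path_image c \<subseteq> cball 0 1"
    and f: "f holomorphic_on ball 0 1" "\<not> f constant_on ball 0 1" "bounded (f ` ball 0 1)"
    and clu: "\<And>u z y. \<lbrakk>\<And>n::nat. u n \<in> inside (path_image c); u \<longlonglongrightarrow> z; z \<in> path_image c;
        (\<lambda>n. f (u n)) \<longlonglongrightarrow> y; y \<notin> f ` inside (path_image c)\<rbrakk> \<Longrightarrow> y \<in> insert q (path_image g)"
  shows "inside (path_image g) - {q} \<subseteq> f ` inside (path_image c)"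
proof (rule Jordan_inside_subset_of_frontier_subset[OF g])
  define V where "V = inside (path_image c)"
  note J = Jordan_inside_outside[OF c(1,2), folded V_def]
  have V1: "V \<subseteq> ball 0 1"
    unfolding V_def using c by (intro inside_subset_ball) (auto simp: closed_path_image simple_path_imp_path)
  have clV: "closure V = V \<union> path_image c"
    using J closure_Un_frontier[of V] by metis
  have contf: "continuous_on (ball 0 1) f" using f holomorphic_on_imp_continuous_on by blast
  show op: "open (f ` inside (path_image c))"
    using open_mapping_thm[OF f(1) open_ball connected_ball _ V1] J f(2) by (simp add: V_def)
  show "f ` inside (path_image c) \<noteq> {}" using J by (simp add: V_def)
  show "bounded (f ` inside (path_image c))" using f(3) V1 by (metis V_def bounded_subset image_mono)
  show "frontier (f ` inside (path_image c)) \<subseteq> insert q (path_image g)"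
  proof
    fix y assume "y \<in> frontier (f ` inside (path_image c))"
    then have y: "y \<in> closure (f ` V)" "y \<notin> f ` V"
      using op by (auto simp: frontier_def V_def interior_open)
    then obtain w where w: "\<And>n::nat. w n \<in> f ` V" "w \<longlonglongrightarrow> y"
      unfolding closure_sequential by blast
    have "\<forall>n. \<exists>x\<in>V. w n = f x" using w(1) by auto
    then obtain u where u: "\<And>n. u n \<in> V" "\<And>n. w n = f (u n)" by metis
    have "compact (closure V)" using J by (simp add: compact_closure)
    moreover have "\<forall>n. u n \<in> closure V" using u closure_subset by blast
    ultimately obtain z r where z: "z \<in> closure V" "strict_mono (r::nat\<Rightarrow>nat)" "(u \<circ> r) \<longlonglongrightarrow> z"
      unfolding compact_def by metis
    have lim: "(\<lambda>n. f ((u \<circ> r) n)) \<longlonglongrightarrow> y"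
      using LIMSEQ_subseq_LIMSEQ[OF w(2) z(2)] u(2) by (simp add: o_def)
    show "y \<in> insert q (path_image g)"
    proof (cases "z \<in> V")
      case True
      then have "isCont f z" using V1 contf by (meson continuous_on_eq_continuous_at open_ball subsetD)
      then have "(\<lambda>n. f ((u \<circ> r) n)) \<longlonglongrightarrow> f z" using z(3) isCont_tendsto_compose by blast
      then have "y = f z" using lim LIMSEQ_unique by blast
      then show ?thesis using y True by blast
    next
      case False
      then have "z \<in> path_image c" using z clV by blast
      then show ?thesis using clu[of "u \<circ> r" z y] u z lim y by (simp add: V_def)
    qed
  qed
qed

text \<open>Points of the path near its end have parameter near 1, because the rest of the path is
  compact and misses the end; so a limit in the parameter is a limit in the plane.\<close>

lemma tendsto_at_path_image_finish:
  fixes f :: "complex \<Rightarrow> complex"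
  assumes c: "path c" "\<And>t. 0 \<le> t \<Longrightarrow> t < 1 \<Longrightarrow> c t \<noteq> c 1"
    and lim: "((\<lambda>t. f (c t)) \<longlongrightarrow> q) (at_left 1)"
  shows "(f \<longlongrightarrow> q) (at (c 1) within path_image c)"
  unfolding Lim_within
proof (intro allI impI)
  fix e :: real assume e: "e > 0"
  from lim e have "\<forall>\<^sub>F t in at_left 1. dist (f (c t)) q < e" by (rule tendstoD)
  then obtain b where b: "b < 1" "\<And>t. t > b \<Longrightarrow> t < 1 \<Longrightarrow> dist (f (c t)) q < e"
    unfolding eventually_at_left_field by blast
  define K where "K = c ` {0..max 0 b}"
  have "compact K" unfolding K_def using c(1) b(1)
    by (intro compact_continuous_image) (auto simp: path_def intro!: continuous_on_subset[of "{0..1}" c])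
  moreover have "c 1 \<notin> K" using c(2) b(1) unfolding K_def by force
  ultimately obtain d where d: "d > 0" "\<And>x. x \<in> K \<Longrightarrow> d \<le> dist (c 1) x"
    using separate_point_closed compact_imp_closed by metis
  show "\<exists>d>0. \<forall>x\<in>path_image c. 0 < dist x (c 1) \<and> dist x (c 1) < d \<longrightarrow> dist (f x) q < e"
  proof (intro exI[of _ d] conjI ballI impI d(1))
    fix x assume x: "x \<in> path_image c" "0 < dist x (c 1) \<and> dist x (c 1) < d"
    then obtain t where t: "t \<in> {0..1}" "x = c t" by (auto simp: path_image_def)
    have "t \<noteq> 1" using t x by auto
    moreover have "x \<notin> K" using d(2)[of x] x by (auto simp: dist_commute)
    ultimately show "dist (f x) q < e"
      using t b(2)[of t] by (force simp: K_def)
  qed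
qed

text \<open>Both halves of the loop, run from the middle, are paths that reach the base point only
  at their end.\<close>

lemma tendsto_at_loop_base:
  fixes f :: "complex \<Rightarrow> complex"
  assumes c: "simple_path c" "c 0 = c 1"
    and lim: "((\<lambda>t. f (c t)) \<longlongrightarrow> q) (at_left 1)" "((\<lambda>t. f (c t)) \<longlongrightarrow> q) (at_right 0)"
  shows "(f \<longlongrightarrow> q) (at (c 1) within path_image c)"
proof -
  define c1 c2 where "c1 = subpath (1/2) 1 c" "c2 = subpath (1/2) 0 c"
  note defs = this
  have pc: "path c" using c by (simp add: simple_path_imp_path)
  have inj: "c t \<noteq> c 1" if "0 < t" "t < 1" for t
    using c(1) that unfolding simple_path_def loop_free_def by fastforce
  have p: "path c1" "path c2" unfolding defs using pc by auto
  have e: "c1 1 = c 1" "c2 1 = c 1" using c(2) by (auto simp: defs subpath_def)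
  have "(f \<longlongrightarrow> q) (at (c1 1) within path_image c1)"
  proof (rule tendsto_at_path_image_finish[OF p(1)])
    show "c1 t \<noteq> c1 1" if "0 \<le> t" "t < 1" for t
      using inj[of "t/2+1/2"] that unfolding e by (simp add: defs subpath_def algebra_simps)
    have "filterlim (\<lambda>t::real. t/2+1/2) (at_left 1) (at_left 1)"
      unfolding filterlim_at
      by (auto intro!: tendsto_eq_intros simp: eventually_at_left_field intro: exI[of _ 0])
    then show "((\<lambda>t. f (c1 t)) \<longlongrightarrow> q) (at_left 1)"
      using filterlim_compose[OF lim(1)] by (simp add: defs subpath_def algebra_simps)
  qed
  moreover have "(f \<longlongrightarrow> q) (at (c2 1) within path_image c2)"
  proof (rule tendsto_at_path_image_finish[OF p(2)])
    show "c2 t \<noteq> c2 1" if "0 \<le> t" "t < 1" for t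
      using inj[of "1/2-t/2"] that unfolding e by (simp add: defs subpath_def algebra_simps)
    have "filterlim (\<lambda>t::real. 1/2 - t/2) (at_right 0) (at_left 1)"
      unfolding filterlim_at
      by (auto intro!: tendsto_eq_intros simp: eventually_at_left_field intro: exI[of _ 0])
    then show "((\<lambda>t. f (c2 t)) \<longlongrightarrow> q) (at_left 1)"
      using filterlim_compose[OF lim(2)] by (simp add: defs subpath_def algebra_simps)
  qed
  ultimately have "(f \<longlongrightarrow> q) (at (c 1) within path_image c1 \<union> path_image c2)"
    unfolding e by (simp add: Lim_Un)
  moreover have "path_image c1 \<union> path_image c2 = path_image c"
  proof -
    have "path_image c1 = c ` {1/2..1}" "path_image c2 = c ` {0..1/2}"
      by (auto simp: defs path_image_subpath)
    moreover have "{0..1::real} = {1/2..1} \<union> {0..1/2}" by auto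
    ultimately show ?thesis unfolding path_image_def by (metis image_Un)
  qed
  ultimately show ?thesis by simp
qed

text \<open>
  The radius and the arc bound a region in which, by Lindelof's theorem, \<^term>\<open>\<phi>\<close> is close to \<^term>\<open>p\<close> or to \<^term>\<open>q\<close>
  near \<^term>\<open>\<alpha>\<close>. If these values differ, the part where it is close to \<^term>\<open>p\<close> is relatively clopen in one of
  the half discs cut out by the radius, so that it reaches boundary points other than \<^term>\<open>\<alpha>\<close>.
\<close>

lemma radial_limit_eq_limit_along_arc:
  fixes \<phi> :: "complex \<Rightarrow> complex"
  assumes hol: "\<phi> holomorphic_on ball 0 1" and bnd: "bounded (\<phi> ` ball 0 1)"
    and \<alpha>: "norm \<alpha> = 1" and r1: "0 \<le> r1" "r1 < 1"
    and rad: "((\<lambda>r::real. \<phi> (of_real r * \<alpha>)) \<longlongrightarrow> p) (at_left 1)"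
    and c: "arc c" "pathstart c = of_real r1 * \<alpha>" "pathfinish c = \<alpha>" "path_image c \<subseteq> insert \<alpha> (ball 0 1)"
    and disj: "\<And>r. r1 < r \<Longrightarrow> r < 1 \<Longrightarrow> of_real r * \<alpha> \<notin> path_image c"
    and lim: "((\<lambda>t. \<phi> (c t)) \<longlongrightarrow> q) (at_left 1)"
  shows "p = q"
proof (rule ccontr)
  assume "p \<noteq> q"
  define \<eta> where "\<eta> = dist p q / 3"
  have \<eta>: "\<eta> > 0" using \<open>p \<noteq> q\<close> by (simp add: \<eta>_def)
  have \<alpha>0: "\<alpha> \<noteq> 0" using \<alpha> by auto
  define b where "b = of_real r1 * \<alpha>"
  define d where "d = linepath b \<alpha>"
  have b\<alpha>: "b \<noteq> \<alpha>" using r1 \<alpha>0 by (auto simp: b_def)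
  have dt: "d t = of_real (r1 + t * (1 - r1)) * \<alpha>" for t
    by (simp add: d_def b_def linepath_def scaleR_conv_of_real algebra_simps)
  have arcd: "arc d" by (simp add: d_def b\<alpha> arc_linepath)
  have imd: "path_image d \<subseteq> {of_real r * \<alpha> | r. r1 \<le> r \<and> r \<le> 1}"
  proof
    fix x assume "x \<in> path_image d"
    then obtain t where t: "t \<in> {0..1}" "x = d t" by (auto simp: path_image_def)
    then have "r1 \<le> r1 + t * (1 - r1)" using r1 by auto
    moreover have "r1 + t * (1 - r1) \<le> 1"
      using t r1 mult_right_mono[of t 1 "1 - r1"] by (simp add: algebra_simps)
    ultimately show "x \<in> {of_real r * \<alpha> | r. r1 \<le> r \<and> r \<le> 1}" using t dt by blast
  qed
  \<comment> \<open>The arc and the segment meet only at their common ends, since by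
    \<open>disj\<close> no point of the radius strictly between \<open>b\<close> and
    \<open>\<alpha>\<close> is on the arc.\<close>
  define J where "J = c +++ reversepath d"
  have imJ: "path_image J = path_image c \<union> path_image d"
    using c by (simp add: J_def path_image_join d_def closed_segment_commute)
  have J: "simple_path J" "pathfinish J = pathstart J"
  proof -
    show "simple_path J" unfolding J_def
    proof (rule simple_path_join_loop)
      show "arc c" "arc (reversepath d)" using c arcd by (auto intro: arc_reversepath)
      show "path_image c \<inter> path_image (reversepath d) \<subseteq> {pathstart c, pathstart (reversepath d)}"
      proof
        fix x assume "x \<in> path_image c \<inter> path_image (reversepath d)"
        then obtain r where "x \<in> path_image c" "x = of_real r * \<alpha>" "r1 \<le> r" "r \<le> 1"
          using imd by auto
        then have "r = r1 \<or> r = 1" using disj[of r] by force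
        then show "x \<in> {pathstart c, pathstart (reversepath d)}"
          using \<open>x = of_real r * \<alpha>\<close> c by (auto simp: d_def)
      qed
    qed (use c in \<open>auto simp: d_def b_def\<close>)
    show "pathfinish J = pathstart J" using c by (simp add: J_def d_def b_def)
  qed
  have dJ: "path_image d \<subseteq> insert \<alpha> (ball 0 1)"
  proof
    fix x assume "x \<in> path_image d"
    then obtain r where r: "x = of_real r * \<alpha>" "r1 \<le> r" "r \<le> 1" using imd by auto
    then show "x \<in> insert \<alpha> (ball 0 1)" using r1 \<alpha> by (cases "r = 1") (auto simp: norm_mult)
  qed
  define V where "V = inside (path_image J)"
  note JJ = Jordan_inside_outside[OF J, folded V_def]
  have J1: "path_image J \<subseteq> insert \<alpha> (ball 0 1)" using imJ dJ c by auto
  have V1: "V \<subseteq> ball 0 1"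
    unfolding V_def using J J1 \<alpha> by (intro inside_subset_ball)
      (auto simp: closed_path_image simple_path_imp_path subset_iff)
  have clV: "closure V = V \<union> path_image J"
    using JJ closure_Un_frontier[of V] by metis
  obtain M where M: "\<And>z. z \<in> ball 0 1 \<Longrightarrow> norm (\<phi> z) \<le> M"
    using bnd unfolding bounded_iff by blast
  have contphi: "continuous_on (ball 0 1) \<phi>" using hol holomorphic_on_imp_continuous_on by blast
  have limc: "(\<phi> \<longlongrightarrow> q) (at \<alpha> within path_image c)"
  proof -
    have "(\<phi> \<longlongrightarrow> q) (at (c 1) within path_image c)"
    proof (rule tendsto_at_path_image_finish)
      show "path c" using c by (simp add: arc_imp_path)
      show "c t \<noteq> c 1" if "0 \<le> t" "t < 1" for t
        using c(1) that unfolding arc_def inj_on_def by force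
    qed (rule lim)
    then show ?thesis using c(3) by (simp add: pathfinish_def)
  qed
  have limd: "(\<phi> \<longlongrightarrow> p) (at \<alpha> within path_image d)"
  proof -
    have "(\<phi> \<longlongrightarrow> p) (at (d 1) within path_image d)"
    proof (rule tendsto_at_path_image_finish)
      show "path d" by (simp add: d_def)
      show "d t \<noteq> d 1" if "0 \<le> t" "t < 1" for t
        using arcd that unfolding arc_def inj_on_def by force
      have "filterlim (\<lambda>t::real. r1 + t * (1 - r1)) (at_left 1) (at_left 1)"
        unfolding filterlim_at
      proof
        show "((\<lambda>t. r1 + t * (1 - r1)) \<longlongrightarrow> 1) (at_left 1)" by (auto intro!: tendsto_eq_intros)
        have "r1 + t * (1 - r1) < 1" if "t < 1" for t
        proof -
          have "t * (1 - r1) < 1 * (1 - r1)" using that r1 by (intro mult_strict_right_mono) auto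
          then show ?thesis by simp
        qed
        then show "\<forall>\<^sub>F x in at_left 1. r1 + x * (1 - r1) \<in> {..<1} \<and> r1 + x * (1 - r1) \<noteq> 1"
          by (auto simp: eventually_at_left_field intro!: exI[of _ 0]) (metis less_irrefl)
      qed
      from filterlim_compose[OF rad this] show "((\<lambda>t. \<phi> (d t)) \<longlongrightarrow> p) (at_left 1)"
        by (simp add: dt)
    qed
    then show ?thesis by (simp add: d_def linepath_def)
  qed
  \<comment> \<open>\<open>\<phi>\<close> has different limits along the two sides of the region at
    \<open>\<alpha>\<close>; the product tends to 0 along both.\<close>
  define h where "h z = (\<phi> z - p) * (\<phi> z - q)" for z
  have "(h \<longlongrightarrow> 0) (at \<alpha> within path_image J)"
    unfolding imJ Lim_within_Un
  proof
    show "(h \<longlongrightarrow> 0) (at \<alpha> within path_image c)"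
      unfolding h_def using limc by (auto intro!: tendsto_eq_intros)
    show "(h \<longlongrightarrow> 0) (at \<alpha> within path_image d)"
      unfolding h_def using limd by (auto intro!: tendsto_eq_intros)
  qed
  then have "(h \<longlongrightarrow> 0) (at \<alpha> within V)"
    unfolding V_def
  proof (rule lindelof_inside[OF J J1 \<alpha>, rotated 2])
    show "h holomorphic_on ball 0 1" unfolding h_def by (intro holomorphic_intros hol)
    show "norm (h z) \<le> (M + norm p) * (M + norm q)" if "z \<in> ball 0 1" for z
      unfolding h_def norm_mult using M[OF that] norm_triangle_ineq4[of "\<phi> z" p] norm_triangle_ineq4[of "\<phi> z" q]
      by (intro mult_mono) (auto intro: order_trans order_trans[OF norm_ge_zero])
  qed
  then obtain \<rho>1 where \<rho>1: "\<rho>1 > 0" "\<And>x. x \<in> V \<Longrightarrow> 0 < dist x \<alpha> \<Longrightarrow> dist x \<alpha> < \<rho>1 \<Longrightarrow> norm (h x) < \<eta> * \<eta>"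
    unfolding Lim_within using mult_pos_pos[OF \<eta> \<eta>] by (metis norm_conv_dist)
  obtain \<rho>2 where \<rho>2: "\<rho>2 > 0" "\<And>x. x \<in> path_image c \<Longrightarrow> 0 < dist x \<alpha> \<Longrightarrow> dist x \<alpha> < \<rho>2 \<Longrightarrow> dist (\<phi> x) q < \<eta>"
    using limc \<eta> unfolding Lim_within by metis
  obtain \<rho>3 where \<rho>3: "\<rho>3 > 0" "\<And>x. x \<in> path_image d \<Longrightarrow> 0 < dist x \<alpha> \<Longrightarrow> dist x \<alpha> < \<rho>3 \<Longrightarrow> dist (\<phi> x) p < \<eta>"
    using limd \<eta> unfolding Lim_within by metis
  define \<rho> where "\<rho> = min (min \<rho>1 \<rho>2) \<rho>3"
  have \<rho>: "\<rho> > 0" "\<rho> \<le> \<rho>1" "\<rho> \<le> \<rho>2" "\<rho> \<le> \<rho>3" using \<rho>1 \<rho>2 \<rho>3 by (auto simp: \<rho>_def)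
  have notboth: "\<not> (dist w p < \<eta> \<and> dist w q < \<eta>)" for w
    using dist_triangle2[of p q w] \<eta> unfolding \<eta>_def dist_commute[of w] by linarith
  have \<alpha>b: "\<alpha> \<notin> ball 0 1" using \<alpha> by simp
  have inV: "dist (\<phi> z) p < \<eta> \<or> dist (\<phi> z) q < \<eta>" if "z \<in> V" "dist z \<alpha> < \<rho>" for z
  proof (rule ccontr)
    assume "\<not> ?thesis"
    then have "\<eta> * \<eta> \<le> norm (h z)" using \<eta> by (auto simp: h_def norm_mult dist_norm intro: mult_mono)
    moreover have "z \<noteq> \<alpha>" using that V1 \<alpha>b by auto
    ultimately show False using \<rho>1(2)[of z] that \<rho> by auto
  qed
  \<comment> \<open>In the lens \<open>U\<close> the points of the region with value near
    \<open>p\<close> form \<open>Vp\<close>. Everything beyond the region is thrown into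
    \<open>Vq\<close>, so that crossing \<open>c\<close>, where values are near \<open>q\<close>,
    does not leave \<open>Vq\<close>. Only points of the diameter through \<open>\<alpha>\<close>
    may stay uncovered.\<close>
  define U where "U = ball 0 1 \<inter> ball \<alpha> \<rho>"
  define Vp where "Vp = {z \<in> U. z \<in> V \<and> dist (\<phi> z) p < \<eta>}"
  define Vq where "Vq = {z \<in> U. z \<notin> closure V \<or> dist (\<phi> z) q < \<eta>}"
  have opball: "open {z \<in> ball 0 1. dist (\<phi> z) w < \<eta>}" for w
  proof -
    have "open (ball 0 1 \<inter> \<phi> -` ball w \<eta>)"
      by (intro continuous_open_preimage contphi) auto
    moreover have "ball 0 1 \<inter> \<phi> -` ball w \<eta> = {z \<in> ball 0 1. dist (\<phi> z) w < \<eta>}"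
      by (auto simp: dist_commute)
    ultimately show ?thesis by simp
  qed
  have "Vp = ball \<alpha> \<rho> \<inter> V \<inter> {z \<in> ball 0 1. dist (\<phi> z) p < \<eta>}" by (auto simp: Vp_def U_def)
  then have opVp: "open Vp" using JJ opball[of p] by (simp add: open_Int)
  have "Vq = (ball 0 1 \<inter> ball \<alpha> \<rho> \<inter> - closure V) \<union> (ball \<alpha> \<rho> \<inter> {z \<in> ball 0 1. dist (\<phi> z) q < \<eta>})"
    by (auto simp: Vq_def U_def)
  then have opVq: "open Vq" using opball[of q] by (simp only:) (intro open_Int open_Un open_Compl open_ball closed_closure)
  have "Vp \<inter> Vq = {}" using notboth closure_subset by (auto simp: Vp_def Vq_def)
  have Im0: "Im (of_real r * \<alpha> / \<alpha>) = 0" for r using \<alpha>0 by simp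
  have cover: "z \<in> Vp \<union> Vq" if "z \<in> U" "Im (z / \<alpha>) \<noteq> 0" for z
  proof (cases "z \<in> closure V")
    case True
    have zd: "dist z \<alpha> < \<rho>" using that by (simp add: U_def dist_commute)
    show ?thesis
    proof (cases "z \<in> V")
      case True
      then show ?thesis using inV[OF True zd] that by (auto simp: Vp_def Vq_def)
    next
      case False
      then have "z \<in> path_image c \<union> path_image d" using True clV imJ by blast
      moreover have "z \<notin> path_image d" using imd that Im0 by auto
      ultimately have "z \<in> path_image c" by blast
      moreover have "z \<noteq> \<alpha>" using that \<alpha>b by (auto simp: U_def)
      ultimately show ?thesis using \<rho>2(2)[of z] zd \<rho> that by (auto simp: Vq_def)
    qed
  qed (use that in \<open>auto simp: Vq_def\<close>)
  \<comment> \<open>Points of the radius near \<open>\<alpha>\<close> have values near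
    \<open>p\<close> and lie in the closure of \<open>V\<close>, so such values also occur in
    \<open>V\<close> itself; openness moves the point off the diameter.\<close>
  obtain z1 where z1: "z1 \<in> Vp" "Im (z1 / \<alpha>) \<noteq> 0"
  proof -
    define t where "t = max (1 - \<rho>/2) ((1 + r1)/2)"
    have t: "r1 < t" "t < 1" "1 - t < \<rho>" "0 \<le> t" using \<rho> r1 unfolding t_def by (auto simp: less_max_iff_disj le_max_iff_disj)
    define x where "x = of_real t * \<alpha>"
    have xd: "x \<in> path_image d"
    proof -
      have "x = d ((t - r1)/(1 - r1))" using t r1 by (simp add: dt x_def)
      moreover have "(t - r1)/(1 - r1) \<in> {0..1}" using t r1 by (simp add: divide_simps)
      ultimately show ?thesis unfolding path_image_def by blast
    qed
    have "dist x \<alpha> = norm (of_real (t - 1) * \<alpha>)" by (simp add: x_def dist_norm algebra_simps)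
    then have xa: "dist x \<alpha> = 1 - t" using t \<alpha> by (simp add: norm_mult del: of_real_diff)
    have x1: "x \<in> ball 0 1" using t \<alpha> by (simp add: x_def norm_mult)
    have "dist (\<phi> x) p < \<eta>" using \<rho>3(2)[OF xd] xa t \<rho> by simp
    then have xO: "x \<in> ball \<alpha> \<rho> \<inter> {z \<in> ball 0 1. dist (\<phi> z) p < \<eta>}" (is "x \<in> ?O")
      using x1 xa t by (simp add: dist_commute)
    have "x \<in> closure V" using xd clV imJ by blast
    then have "?O \<inter> closure V \<noteq> {}" using xO by blast
    then have ne: "?O \<inter> V \<noteq> {}"
      using opball[of p] by (simp add: open_Int_closure_eq_empty open_Int)
    have "open (?O \<inter> V)" using opball[of p] JJ by (simp add: open_Int)
    moreover obtain y where y0: "y \<in> ?O \<inter> V" using ne by blast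
    ultimately obtain e where y: "y \<in> ?O \<inter> V" "e > 0" "ball y e \<subseteq> ?O \<inter> V"
      by (meson openE)
    define y' where "y' = (if Im (y / \<alpha>) \<noteq> 0 then y else y + of_real (e/2) * \<i> * \<alpha>)"
    have "dist y y' < e" using y(2) \<alpha> by (auto simp: y'_def dist_norm norm_mult)
    then have "y' \<in> ?O \<inter> V" using y(3) by (meson mem_ball subsetD)
    moreover have "Im (y' / \<alpha>) \<noteq> 0" using y(2) \<alpha>0 by (auto simp: y'_def add_divide_distrib)
    ultimately show thesis using that[of y'] by (auto simp: Vp_def U_def)
  qed
  define s where "s = sgn (Im (z1 / \<alpha>))"
  have s: "s = 1 \<or> s = -1" using z1(2) by (auto simp: s_def sgn_if)
  \<comment> \<open>The half of the lens on the side of \<open>z1\<close>. Convex, covered by the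
    disjoint open sets \<open>Vp\<close> and \<open>Vq\<close> and containing \<open>z1\<close>, it
    lies in \<open>Vp\<close> and hence in \<open>V\<close>.\<close>
  define H where "H = U \<inter> {z. s * Im (z / \<alpha>) > 0}"
  have convH: "convex H"
  proof -
    have "linear (\<lambda>z. s * Im (z / \<alpha>))"
      by (rule linearI) (auto simp: add_divide_distrib distrib_left scaleR_conv_of_real simp flip: times_divide_eq_right)
    then have "convex ((\<lambda>z. s * Im (z / \<alpha>)) -` {0<..})" by (intro convex_linear_vimage) auto
    then have "convex {z. s * Im (z / \<alpha>) > 0}" by (simp add: vimage_def)
    then show ?thesis unfolding H_def U_def by (intro convex_Int convex_ball)
  qed
  have z1H: "z1 \<in> H"
    using z1 by (auto simp: H_def s_def Vp_def sgn_if)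
  have Hsub: "H \<subseteq> Vp \<union> Vq" using cover by (force simp: H_def)
  have "Vq \<inter> H = {}"
    using connectedD[OF convex_connected[OF convH] opVp opVq _ Hsub] \<open>Vp \<inter> Vq = {}\<close> z1 z1H by blast
  then have HV: "H \<subseteq> V" using Hsub by (auto simp: Vp_def)
  define \<theta> where "\<theta> = min 1 (\<rho>/2)"
  have \<theta>: "0 < \<theta>" "\<theta> \<le> 1" "\<theta> < \<rho>" using \<rho> by (auto simp: \<theta>_def)
  \<comment> \<open>A point of the unit circle adjacent to \<open>H\<close> and different from
    \<open>\<alpha>\<close>. It lies in the closure of \<open>V\<close>, which meets the circle at
    most in \<open>\<alpha>\<close>.\<close>
  define z where "z = \<alpha> * exp (\<i> * of_real (s * \<theta>))"
  have nz: "norm z = 1" using \<alpha> by (simp add: z_def norm_mult)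
  have za: "dist z \<alpha> \<le> \<theta>"
  proof -
    have "dist z \<alpha> = norm (\<alpha> * (exp (\<i> * of_real (s * \<theta>)) - exp 0))"
      by (simp add: z_def dist_norm algebra_simps)
    also have "\<dots> \<le> norm (\<i> * of_real (s * \<theta>))"
      using norm_exp_diff_le[of "\<i> * of_real (s * \<theta>)" 0] \<alpha> by (simp add: norm_mult)
    also have "\<dots> = \<theta>" using s \<theta> by (auto simp: norm_mult)
    finally show ?thesis .
  qed
  have Imz: "s * Im (z / \<alpha>) = sin \<theta>" using s \<alpha>0 by (auto simp: z_def Im_exp)
  have sin: "sin \<theta> > 0" using \<theta> pi_gt3 by (intro sin_gt_zero) auto
  have "z \<in> closure H"
    unfolding closure_approachable
  proof (intro allI impI)
    fix e :: real assume e: "e > 0"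
    define k where "k = min (1/2) (min (e/2) ((\<rho> - \<theta>)/2))"
    have k: "0 < k" "k < 1" "k < e" "k < \<rho> - \<theta>" using e \<theta> by (auto simp: k_def min_def)
    define y where "y = of_real (1 - k) * z"
    have "dist y z = norm (of_real (- k) * z)" by (simp add: y_def dist_norm algebra_simps)
    then have yz: "dist y z = k" using k nz by (simp add: norm_mult)
    have "norm y = \<bar>1 - k\<bar>" unfolding y_def norm_mult norm_of_real nz by simp
    then have "norm y < 1" using k by simp
    moreover have "dist \<alpha> y < \<rho>" using dist_triangle[of \<alpha> y z] za yz k by (simp add: dist_commute)
    moreover have "s * Im (y / \<alpha>) = (1 - k) * (s * Im (z / \<alpha>))"
    proof -
      have "y / \<alpha> = of_real (1 - k) * (z / \<alpha>)" by (simp add: y_def)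
      then have "Im (y / \<alpha>) = (1 - k) * Im (z / \<alpha>)" by (metis Im_complex_of_real Re_complex_of_real mult_zero_left add_0_right times_complex.sel(2))
      then show ?thesis by simp
    qed
    then have "s * Im (y / \<alpha>) > 0" using Imz sin k by simp
    ultimately have "y \<in> H" by (simp add: H_def U_def)
    then show "\<exists>y\<in>H. dist y z < e" using yz k by auto
  qed
  then have "z \<in> closure V" using closure_mono[OF HV] by blast
  then have "z \<in> V \<union> path_image J" using clV by simp
  then have "z = \<alpha>" using nz V1 J1 by auto
  then show False using Imz sin s \<alpha>0 by auto
qed

section \<open>Lifting a closed curve to the disc\<close>

text \<open>The line as universal cover of the curve. All lifts are parametrised over intervals of
  this line, so that open arcs and the full curve are treated alike and the deck transformation
  becomes the shift by 1.\<close>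

lemma simple_closed_curve_periodic_param:
  fixes g :: "real \<Rightarrow> complex"
  assumes "simple_path g" "pathfinish g = pathstart g"
  obtains e :: "real \<Rightarrow> complex" where "continuous_on UNIV e" "range e = path_image g"
    "\<And>s t. e s = e t \<longleftrightarrow> s - t \<in> \<int>"
proof -
  have "path_image g homeomorphic sphere (0::complex) 1"
    using homeomorphic_simple_path_image_circle[OF assms] by simp
  then obtain f k where hom: "homeomorphism (path_image g) (sphere (0::complex) 1) f k"
    unfolding homeomorphic_def by blast
  define u where "u t = exp (\<i> * of_real (2 * pi * t))" for t :: real
  have nu: "u t \<in> sphere 0 1" for t by (simp add: u_def)
  have us: "range u = sphere 0 1"
  proof
    show "sphere 0 1 \<subseteq> range u"
    proof
      fix z :: complex assume "z \<in> sphere 0 1"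
      then have "z = exp (\<i> * of_real (Arg2pi z))"
        using Arg2pi_eq[of z] by simp
      then have "z = u (Arg2pi z / (2*pi))" by (simp add: u_def)
      then show "z \<in> range u" by blast
    qed
  qed (use nu in auto)
  have u_eq: "u s = u t \<longleftrightarrow> s - t \<in> \<int>" for s t
  proof -
    have "u s = u t \<longleftrightarrow> (\<exists>n::int. 2 * pi * s = 2 * pi * t + 2 * (of_int n * pi))"
      unfolding u_def exp_eq by (auto simp: complex_eq_iff)
    also have "\<dots> \<longleftrightarrow> (\<exists>n::int. s - t = of_int n)"
    proof -
      have "2 * pi * s = 2 * pi * t + 2 * (of_int n * pi) \<longleftrightarrow> s - t = of_int n" for n :: int
      proof -
        have "2 * pi * s = 2 * pi * t + 2 * (of_int n * pi) \<longleftrightarrow> (2 * pi) * s = (2*pi) * (t + of_int n)"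
          by (simp add: algebra_simps)
        also have "\<dots> \<longleftrightarrow> s = t + of_int n" by (subst mult_cancel_left) simp
        finally show ?thesis by auto
      qed
      then show ?thesis by simp
    qed
    also have "\<dots> \<longleftrightarrow> s - t \<in> \<int>" by (auto elim: Ints_cases)
    finally show ?thesis .
  qed
  show thesis
  proof (rule that[of "k \<circ> u"])
    have "continuous_on UNIV u" unfolding u_def by (intro continuous_intros)
    then show "continuous_on UNIV (k \<circ> u)"
      using hom us by (intro continuous_on_compose) (auto simp: homeomorphism_def)
    show "range (k \<circ> u) = path_image g"
      using hom us by (metis homeomorphism_def image_comp)
    have "k (u s) = k (u t) \<longleftrightarrow> u s = u t" for s t
      using hom nu unfolding homeomorphism_def by metis
    then show "(k \<circ> u) s = (k \<circ> u) t \<longleftrightarrow> s - t \<in> \<int>" for s t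
      by (simp add: u_eq)
  qed
qed

text \<open>\<open>e\<close> is open onto its range: one period without a neighbourhood of
  \<open>t\<close> has a compact image that misses \<open>e t\<close>, and every parameter can be
  moved into the period centred at \<open>t\<close>.\<close>

lemma periodic_param_open:
  fixes e :: "real \<Rightarrow> complex"
  assumes e: "continuous_on UNIV e" "\<And>s t. e s = e t \<longleftrightarrow> s - t \<in> \<int>" and \<eta>: "\<eta> > 0"
  obtains d where "d > 0" "\<And>x. x \<in> range e \<Longrightarrow> dist x (e t) < d \<Longrightarrow> \<exists>t'. \<bar>t' - t\<bar> < \<eta> \<and> e t' = x"
proof -
  define m where "m = min \<eta> (1/2)"
  have m: "0 < m" "m \<le> \<eta>" "m \<le> 1/2" using \<eta> by (auto simp: m_def)
  define K where "K = e ` ({t-1/2..t-m} \<union> {t+m..t+1/2})"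
  have "compact K" unfolding K_def using e(1)
    by (intro compact_continuous_image compact_Un) (auto intro: continuous_on_subset)
  have "e t \<notin> K"
  proof
    assume "e t \<in> K"
    then obtain s where s: "s \<in> {t-1/2..t-m} \<union> {t+m..t+1/2}" "e s = e t" unfolding K_def by (metis imageE)
    then have "s - t \<in> \<int>" using e by blast
    then obtain n where n: "s - t = of_int n" by (auto elim: Ints_cases)
    have "\<bar>s - t\<bar> < 1" "s \<noteq> t" using s(1) m by auto
    moreover have "n = 0" using n \<open>\<bar>s - t\<bar> < 1\<close> by linarith
    ultimately show False using n by simp
  qed
  then obtain d where d: "d > 0" "\<And>x. x \<in> K \<Longrightarrow> d \<le> dist (e t) x"
    using separate_point_closed compact_imp_closed[OF \<open>compact K\<close>] by metis
  show thesis
  proof (rule that[OF d(1)])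
    fix x assume x: "x \<in> range e" "dist x (e t) < d"
    then obtain s where s: "x = e s" by blast
    define s' where "s' = s - of_int (round (s - t))"
    have "s - s' \<in> \<int>" by (simp add: s'_def)
    then have es: "e s' = x" using s e(2) by metis
    have "\<bar>s' - t\<bar> \<le> 1/2" using of_int_round_abs_le[of "s - t"] by (simp add: s'_def abs_minus_commute algebra_simps)
    moreover have "x \<notin> K" using d(2)[of x] x by (auto simp: dist_commute)
    ultimately have "\<bar>s' - t\<bar> < m"
      unfolding K_def using es by (smt (verit) Un_iff atLeastAtMost_iff image_eqI)
    then show "\<exists>t'. \<bar>t' - t\<bar> < \<eta> \<and> e t' = x" using es m by force
  qed
qed

section \<open>Coverings by the disc and components over the curve\<close>

locale disc_covering =
  fixes \<Omega> :: "complex set" and \<phi> :: "complex \<Rightarrow> complex"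
  assumes bounded_domain: "bounded \<Omega>" and open_domain: "open \<Omega>"
    and hol: "\<phi> holomorphic_on ball 0 1" and cov: "covering_space (ball 0 1) \<phi> \<Omega>"
begin

lemma cont: "continuous_on (ball 0 1) \<phi>"
  using hol by (rule holomorphic_on_imp_continuous_on)

lemma image: "\<phi> ` ball 0 1 = \<Omega>"
  using cov by (rule covering_space_imp_surjective)

lemma in_domain: "z \<in> ball 0 1 \<Longrightarrow> \<phi> z \<in> \<Omega>"
  using image by blast

lemma locally_injective:
  assumes "z \<in> ball 0 1"
  obtains N where "open N" "z \<in> N" "N \<subseteq> ball 0 1" "inj_on \<phi> N"
proof -
  obtain T u q where T: "z \<in> T" "openin (top_of_set (ball 0 1)) T" "homeomorphism T u \<phi> q"
    using covering_space_local_homeomorphism[OF cov assms] by metis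
  show thesis
  proof (rule that[of T])
    show "open T" "T \<subseteq> ball 0 1" using T(2) by (auto simp: openin_open_eq)
    show "inj_on \<phi> T" using T(3) by (metis homeomorphism_apply1 inj_onI)
  qed (rule T)
qed

lemma nonconstant: "\<not> \<phi> constant_on ball 0 1"
proof
  assume c: "\<phi> constant_on ball 0 1"
  obtain N where N: "open N" "0 \<in> N" "N \<subseteq> ball 0 1" "inj_on \<phi> N"
    using locally_injective[of 0] by auto
  have "N \<subseteq> {0}" using c N unfolding constant_on_def inj_on_def by (metis insertI1 subset_iff)
  then show False using N by (metis finite.emptyI finite.insertI finite_imp_not_open finite_subset empty_iff)
qed

lemma lift:
  fixes f :: "'a::real_normed_vector \<Rightarrow> complex"
  assumes "convex U" "z \<in> U" "a \<in> ball 0 1" "continuous_on U f" "\<And>x. x \<in> U \<Longrightarrow> f x \<in> \<Omega>" "f z = \<phi> a"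
  obtains g where "continuous_on U g" "\<And>x. x \<in> U \<Longrightarrow> g x \<in> ball 0 1" "g z = a" "\<And>x. x \<in> U \<Longrightarrow> \<phi> (g x) = f x"
proof -
  obtain g where "continuous_on U g" "g \<in> U \<rightarrow> ball 0 1" "g z = a" "\<And>x. x \<in> U \<Longrightarrow> \<phi> (g x) = f x"
  proof (rule covering_space_lift_strong[OF cov assms(3,2) _ _ assms(4) _ assms(6)])
    show "simply_connected U" using assms(1) by (rule convex_imp_simply_connected)
    show "locally path_connected U" using assms(1) by (rule convex_imp_locally_path_connected)
  qed (use assms(5) in auto)
  then show thesis using that by blast
qed

lemma lift_unique:
  fixes g1 g2 :: "'a::topological_space \<Rightarrow> complex"
  assumes "connected U" "a \<in> U" "g1 a = g2 a" "continuous_on U g1" "\<And>x. x \<in> U \<Longrightarrow> g1 x \<in> ball 0 1"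
    "continuous_on U g2" "\<And>x. x \<in> U \<Longrightarrow> g2 x \<in> ball 0 1" "\<And>x. x \<in> U \<Longrightarrow> \<phi> (g1 x) = \<phi> (g2 x)" "x \<in> U"
  shows "g1 x = g2 x"
proof (rule covering_space_lift_unique[where ?g1.0 = g1 and ?g2.0 = g2 and a = a and T = U and f = "\<lambda>x. \<phi> (g1 x)", OF cov])
  show "continuous_on U (\<lambda>x. \<phi> (g1 x))"
    using assms by (intro continuous_on_compose2[OF cont assms(4)]) auto
qed (use assms in_domain in auto)

text \<open>If \<open>p\<close> were in \<open>\<Omega>\<close>, the image path completed by
  \<open>p\<close> would lift over the closed interval; by uniqueness the lift extends
  \<open>s\<close>, so \<open>s\<close> would end inside the disc. Applied to the radius, this shows
  that \<open>p\<close> is an omitted value.\<close>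

lemma lift_image_end_notin_domain:
  fixes s :: "real \<Rightarrow> complex"
  assumes s: "continuous_on {a..<b} s" "a < b" "\<And>t. a \<le> t \<Longrightarrow> t < b \<Longrightarrow> s t \<in> ball 0 1"
    and lim: "((\<lambda>t. \<phi> (s t)) \<longlongrightarrow> p) (at_left b)" and s1: "(s \<longlongrightarrow> \<beta>) (at_left b)" "norm \<beta> = 1"
  shows "p \<notin> \<Omega>"
proof
  assume p: "p \<in> \<Omega>"
  define P where "P t = (if t < b then \<phi> (s t) else p)" for t
  have contP: "continuous_on {a..b} P"
    unfolding continuous_on_eq_continuous_within
  proof
    fix t assume t: "t \<in> {a..b}"
    show "continuous (at t within {a..b}) P"
    proof (cases "t < b")
      case True
      have "continuous_on {a..<b} (\<lambda>t. \<phi> (s t))"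
        using s by (intro continuous_on_compose2[OF cont s(1)]) auto
      then have "continuous_on {a..<b} P" by (rule continuous_on_eq) (auto simp: P_def)
      then have "continuous (at t within {a..<b}) P" using t True by (simp add: continuous_on_eq_continuous_within)
      moreover have "at t within {a..<b} = at t within {a..b}"
        by (rule at_within_nhd[of t "{..<b}"]) (use True in auto)
      ultimately show ?thesis by simp
    next
      case False
      then have tb: "t = b" using t by simp
      have "(P \<longlongrightarrow> p) (at_left b)"
        by (rule Lim_transform_eventually[OF lim]) (auto simp: P_def eventually_at_left_field intro!: exI[of _ a] s)
      moreover have "at b within {a..b} = at_left b" using s(2) by (rule at_within_Icc_at_left)
      ultimately show ?thesis using tb by (simp add: continuous_within P_def)
    qed
  qed
  have ab: "a \<in> {a..b}" "b \<in> {a..b}" using s(2) by auto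
  obtain h where h: "continuous_on {a..b} h" "\<And>x. x \<in> {a..b} \<Longrightarrow> h x \<in> ball 0 1" "h a = s a"
     "\<And>x. x \<in> {a..b} \<Longrightarrow> \<phi> (h x) = P x"
  proof (rule lift[OF _ ab(1) _ contP])
    show "P x \<in> \<Omega>" if "x \<in> {a..b}" for x using that p s in_domain by (auto simp: P_def)
  qed (use s in \<open>auto simp: P_def\<close>)
  have hs: "h t = s t" if "t \<in> {a..<b}" for t
  proof (rule lift_unique[where U = "{a..<b}" and a = a])
    show "continuous_on {a..<b} h" using h(1) by (rule continuous_on_subset) auto
  qed (use that h s in \<open>auto simp: P_def\<close>)
  have "(h \<longlongrightarrow> h b) (at_left b)"
    using h(1) ab at_within_Icc_at_left[OF s(2)] by (metis continuous_on_def)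
  then have "(s \<longlongrightarrow> h b) (at_left b)"
    by (rule Lim_transform_eventually)
      (use hs s(2) in \<open>auto simp: eventually_at_left_field intro!: exI[of _ a]\<close>)
  then have "h b = \<beta>" using s1(1) tendsto_unique trivial_limit_at_left_real by blast
  then show False using h(2)[OF ab(2)] s1(2) by simp
qed

end

locale disc_covering_curve = disc_covering +
  fixes g :: "real \<Rightarrow> complex" and p :: complex and e :: "real \<Rightarrow> complex"
  assumes g: "simple_path g" "pathfinish g = pathstart g"
    and p_inside: "p \<in> inside (path_image g)" and p_notin: "p \<notin> \<Omega>"
    and e_cont: "continuous_on UNIV e" and e_range: "range e = path_image g"
    and e_eq: "\<And>s t. e s = e t \<longleftrightarrow> s - t \<in> \<int>"
begin

text \<open>For \<open>e t\<close> in \<open>\<Omega>\<close>, the stretch of parameters around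
  \<open>t\<close> over which the curve stays in \<open>\<Omega>\<close> and can be lifted: a
  bounded interval if the curve leaves \<open>\<Omega>\<close>, the whole line otherwise.\<close>

definition param_component :: "real \<Rightarrow> real set" where
  "param_component t = connected_component_set (e -` \<Omega>) t"

lemma open_preimage: "open (e -` \<Omega>)"
  using e_cont open_domain by (simp add: open_vimage)

lemma param_component_props:
  assumes "e t \<in> \<Omega>"
  shows "t \<in> param_component t" "open (param_component t)" "connected (param_component t)"
    "convex (param_component t)" "param_component t \<subseteq> e -` \<Omega>"
proof -
  show *: "connected (param_component t)" by (simp add: param_component_def)
  then show "convex (param_component t)"
    by (simp flip: is_interval_convex_1 add: is_interval_connected_1)
qed (use assms open_preimage in \<open>auto simp: param_component_def intro: open_connected_component
      dest: connected_component_subset[THEN subsetD, OF CollectI]\<close>)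

lemma e_periodic [simp]: "e (t + of_int n) = e t"
  by (simp add: e_eq)

text \<open>\<open>\<phi>\<close> is injective near \<open>s t\<close>, and a nearby point over the
  curve has image \<open>e t'\<close> with \<open>t'\<close> near \<open>t\<close>; injectivity
  identifies this point with \<open>s t'\<close>.\<close>

lemma lift_image_relatively_open:
  assumes I: "open I" and s: "continuous_on I s" "\<And>t. t \<in> I \<Longrightarrow> s t \<in> ball 0 1" "\<And>t. t \<in> I \<Longrightarrow> \<phi> (s t) = e t"
  shows "openin (top_of_set (ball 0 1 \<inter> \<phi> -` path_image g)) (s ` I)"
  unfolding openin_contains_ball
proof (intro conjI ballI)
  show "s ` I \<subseteq> ball 0 1 \<inter> \<phi> -` path_image g" using s e_range by auto
  fix z assume "z \<in> s ` I"
  then obtain t where t: "t \<in> I" "z = s t" by blast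
  obtain N where N: "open N" "z \<in> N" "N \<subseteq> ball 0 1" "inj_on \<phi> N"
    using locally_injective[of z] s t by auto
  have "open (I \<inter> s -` N)" using continuous_open_preimage[OF s(1) I N(1)] .
  moreover have "t \<in> I \<inter> s -` N" using t N by auto
  ultimately obtain \<eta> where \<eta>: "\<eta> > 0" "ball t \<eta> \<subseteq> I \<inter> s -` N" by (meson openE)
  obtain d where d: "d > 0" "\<And>x. x \<in> range e \<Longrightarrow> dist x (e t) < d \<Longrightarrow> \<exists>t'. \<bar>t' - t\<bar> < \<eta> \<and> e t' = x"
    using periodic_param_open[OF e_cont e_eq \<eta>(1)] by metis
  have "open (N \<inter> \<phi> -` ball (e t) d)"
    using continuous_open_preimage[OF continuous_on_subset[OF cont N(3)] N(1)] by blast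
  moreover have "z \<in> N \<inter> \<phi> -` ball (e t) d" using N t s d by auto
  ultimately obtain r where r: "r > 0" "ball z r \<subseteq> N \<inter> \<phi> -` ball (e t) d" by (meson openE)
  have "x \<in> s ` I" if x: "x \<in> ball z r" "x \<in> ball 0 1 \<inter> \<phi> -` path_image g" for x
  proof -
    have xN: "x \<in> N" "dist (\<phi> x) (e t) < d" using r(2) x(1) by (auto simp: dist_commute subset_iff)
    then obtain t' where t': "\<bar>t' - t\<bar> < \<eta>" "e t' = \<phi> x"
      using d(2)[of "\<phi> x"] x e_range by auto
    then have "t' \<in> I \<inter> s -` N" using \<eta>(2) by (auto simp: dist_real_def abs_minus_commute subset_iff)
    then have "t' \<in> I" "s t' \<in> N" by auto
    then have "x = s t'" using N(4) xN t' s by (metis inj_onD)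
    then show ?thesis using \<open>t' \<in> I\<close> by blast
  qed
  then show "\<exists>r>0. ball z r \<inter> (ball 0 1 \<inter> \<phi> -` path_image g) \<subseteq> s ` I"
    using r(1) by (intro exI[of _ r]) auto
qed

lemma lift_param:
  assumes "z \<in> ball 0 1" "\<phi> z = e t"
  obtains s where "continuous_on (param_component t) s" "\<And>x. x \<in> param_component t \<Longrightarrow> s x \<in> ball 0 1"
    "s t = z" "\<And>x. x \<in> param_component t \<Longrightarrow> \<phi> (s x) = e x"
proof -
  have et: "e t \<in> \<Omega>" using assms in_domain by metis
  note P = param_component_props[OF et]
  show thesis
    by (rule lift[OF P(4,1) assms(1), of e]) (use P e_cont assms that in \<open>auto intro: continuous_on_subset\<close>)
qed

text \<open>Translation by an integer does not change \<open>e\<close>, so it carries the component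
  of \<open>t'\<close> into that of \<open>t\<close>; uniqueness of lifts then compares
  \<open>s'\<close> with the translate of \<open>s\<close>.\<close>

lemma lift_shift:
  assumes s: "continuous_on (param_component t) s" "\<And>x. x \<in> param_component t \<Longrightarrow> s x \<in> ball 0 1"
      "\<And>x. x \<in> param_component t \<Longrightarrow> \<phi> (s x) = e x"
    and s': "continuous_on (param_component t') s'" "\<And>x. x \<in> param_component t' \<Longrightarrow> s' x \<in> ball 0 1"
      "\<And>x. x \<in> param_component t' \<Longrightarrow> \<phi> (s' x) = e x"
    and eq: "x \<in> param_component t" "x + of_int n \<in> param_component t'" "s x = s' (x + of_int n)"
    and y: "y \<in> param_component t'"
  shows "y - of_int n \<in> param_component t" "s' y = s (y - of_int n)"
proof -
  have et': "e t' \<in> \<Omega>" using y unfolding param_component_def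
    by (metis connected_component_in mem_Collect_eq vimageE)
  note P' = param_component_props[OF et']
  have sub: "(\<lambda>y. y - of_int n) ` param_component t' \<subseteq> param_component t"
  proof -
    have "param_component t = connected_component_set (e -` \<Omega>) x"
      using eq(1) unfolding param_component_def by (metis connected_component_eq)
    moreover have "(\<lambda>y. y - of_int n) ` param_component t' \<subseteq> connected_component_set (e -` \<Omega>) x"
    proof (rule connected_component_maximal)
      show "x \<in> (\<lambda>y. y - of_int n) ` param_component t'" using eq(2) by force
      show "connected ((\<lambda>y. y - of_int n) ` param_component t')"
        using P' by (intro connected_continuous_image continuous_intros) auto
      have "e (y - of_int n) = e y" for y using e_periodic[of "y - of_int n" n] by simp
      then show "(\<lambda>y. y - of_int n) ` param_component t' \<subseteq> e -` \<Omega>" using P' by auto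
    qed
    ultimately show ?thesis by simp
  qed
  then show "y - of_int n \<in> param_component t" using y by blast
  show "s' y = s (y - of_int n)"
  proof (rule lift_unique[where U = "param_component t'" and a = "x + of_int n" and ?g1.0 = s' and ?g2.0 = "\<lambda>y. s (y - of_int n)"])
    show "continuous_on (param_component t') (\<lambda>y. s (y - of_int n))"
      by (rule continuous_on_compose2[OF s(1) _ sub]) (intro continuous_intros)
    show "\<phi> (s' y) = \<phi> (s (y - of_int n))" if "y \<in> param_component t'" for y
    proof -
      have "e (y - of_int n) = e y" using e_periodic[of "y - of_int n" n] by simp
      then show ?thesis using s'(3)[OF that] s(3)[of "y - of_int n"] sub that by auto
    qed
  qed (use P' s s' eq y sub in auto)
qed

text \<open>Images of lifts are connected and relatively open in the preimage, and by
  \<open>lift_shift\<close> a point whose lift meets another lift already belongs to that one. So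
  the complement of such an image is a union of further open images, and the image is a
  component.\<close>

lemma component_eq_lift_image:
  assumes z: "z \<in> ball 0 1" "\<phi> z = e t"
    and s: "continuous_on (param_component t) s" "\<And>x. x \<in> param_component t \<Longrightarrow> s x \<in> ball 0 1"
      "s t = z" "\<And>x. x \<in> param_component t \<Longrightarrow> \<phi> (s x) = e x"
  shows "connected_component_set (ball 0 1 \<inter> \<phi> -` path_image g) z = s ` param_component t"
proof -
  define A where "A = ball 0 1 \<inter> \<phi> -` path_image g"
  have et: "e t \<in> \<Omega>" using z in_domain by metis
  note P = param_component_props[OF et]
  have zA: "z \<in> A" using z e_range by (auto simp: A_def)
  have sA: "s ` param_component t \<subseteq> A" using s e_range by (auto simp: A_def)
  have "s ` param_component t \<subseteq> connected_component_set A z"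
    by (rule connected_component_maximal) (use P s sA in \<open>auto intro!: connected_continuous_image\<close>)
  moreover have "connected_component_set A z \<subseteq> s ` param_component t"
  proof -
    have op: "openin (top_of_set A) (s ` param_component t)"
      unfolding A_def by (rule lift_image_relatively_open[OF P(2) s(1)]) (use s in auto)
    have "openin (top_of_set A) (A - s ` param_component t)"
    proof (subst openin_subopen, intro ballI)
      fix w assume w: "w \<in> A - s ` param_component t"
      then obtain t' where t': "\<phi> w = e t'" using e_range by (auto simp: A_def)
      have wb: "w \<in> ball 0 1" using w by (auto simp: A_def)
      obtain s' where s': "continuous_on (param_component t') s'" "\<And>x. x \<in> param_component t' \<Longrightarrow> s' x \<in> ball 0 1"
          "s' t' = w" "\<And>x. x \<in> param_component t' \<Longrightarrow> \<phi> (s' x) = e x"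
        using lift_param[OF wb t'] by metis
      have et': "e t' \<in> \<Omega>" using t' wb in_domain by metis
      note P' = param_component_props[OF et']
      have "s' ` param_component t' \<inter> s ` param_component t = {}"
      proof (rule ccontr)
        assume "s' ` param_component t' \<inter> s ` param_component t \<noteq> {}"
        then obtain x y where xy: "x \<in> param_component t" "y \<in> param_component t'" "s x = s' y" by (auto; metis)
        then have "e x = e y" using s s' by metis
        then have "y - x \<in> \<int>" using e_eq by (metis)
        then obtain n where n: "y = x + of_int n" by (auto elim!: Ints_cases simp: algebra_simps)
        have "t' \<in> param_component t'" using P' by blast
        then have "s' t' = s (t' - of_int n)" "t' - of_int n \<in> param_component t"
          using lift_shift[OF s(1,2,4) s'(1,2,4) xy(1)] xy n by blast+
        then show False using w s'(3) by auto
      qed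
      moreover have "openin (top_of_set A) (s' ` param_component t')"
        unfolding A_def by (rule lift_image_relatively_open[OF P'(2) s'(1)]) (use s' in auto)
      moreover have "w \<in> s' ` param_component t'" using P' s' by blast
      ultimately show "\<exists>T. openin (top_of_set A) T \<and> w \<in> T \<and> T \<subseteq> A - s ` param_component t"
        using openin_imp_subset by (intro exI[of _ "s' ` param_component t'"]) blast
    qed
    then obtain T' where T': "open T'" "A - s ` param_component t = A \<inter> T'" by (meson openin_open)
    obtain T where T: "open T" "s ` param_component t = A \<inter> T" using op by (meson openin_open)
    have sub: "connected_component_set A z \<subseteq> A" by (rule connected_component_subset)
    have "connected_component_set A z \<inter> s ` param_component t \<noteq> {}"
      using zA P(1) s(3) connected_component_refl[of z A] by blast
    then show ?thesis
      using connectedD[OF connected_connected_component[of A z] T(1) T'(1)] T(2) T'(2) sub by blast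
  qed
  ultimately show ?thesis by (simp add: A_def)
qed

end

section \<open>Closing up a lifted curve at its ends\<close>

text \<open>Serves both outcomes: distinct limits give an arc, equal ones a simple loop. The limits
  lie off the image, in the applications on the unit circle, and this makes the completed path
  injective apart from its ends.\<close>

lemma path_completion:
  fixes s :: "real \<Rightarrow> complex"
  assumes s: "continuous_on {0<..<1} s" "inj_on s {0<..<1}"
    and lim: "(s \<longlongrightarrow> \<beta>0) (at_right 0)" "(s \<longlongrightarrow> \<beta>1) (at_left 1)"
    and out: "\<beta>0 \<notin> s ` {0<..<1}" "\<beta>1 \<notin> s ` {0<..<1}"
  obtains \<gamma> where "path \<gamma>" "\<gamma> 0 = \<beta>0" "\<gamma> 1 = \<beta>1" "\<And>t. 0 < t \<Longrightarrow> t < 1 \<Longrightarrow> \<gamma> t = s t"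
    "path_image \<gamma> = insert \<beta>0 (insert \<beta>1 (s ` {0<..<1}))"
    "path_image \<gamma> = closure (s ` {0<..<1})" "\<beta>0 \<noteq> \<beta>1 \<Longrightarrow> arc \<gamma>" "\<beta>0 = \<beta>1 \<Longrightarrow> simple_path \<gamma>"
proof -
  define \<gamma> where "\<gamma> t = (if t \<le> 0 then \<beta>0 else if t \<ge> 1 then \<beta>1 else s t)" for t
  have g: "\<gamma> 0 = \<beta>0" "\<gamma> 1 = \<beta>1" "\<And>t. 0 < t \<Longrightarrow> t < 1 \<Longrightarrow> \<gamma> t = s t"
    by (auto simp: \<gamma>_def)
  have "continuous_on {0..1} \<gamma>"
    unfolding continuous_on_def
  proof
    fix t :: real assume t: "t \<in> {0..1}"
    consider "t = 0" | "t = 1" | "0 < t" "t < 1" using t by fastforce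
    then show "(\<gamma> \<longlongrightarrow> \<gamma> t) (at t within {0..1})"
    proof cases
      case 1
      have "(\<gamma> \<longlongrightarrow> \<beta>0) (at_right 0)"
        by (rule Lim_transform_eventually[OF lim(1)]) (auto simp: g eventually_at_right_field intro!: exI[of _ 1])
      then show ?thesis using 1 g by (simp add: at_within_Icc_at_right)
    next
      case 2
      have "(\<gamma> \<longlongrightarrow> \<beta>1) (at_left 1)"
        by (rule Lim_transform_eventually[OF lim(2)]) (auto simp: g eventually_at_left_field intro!: exI[of _ 0])
      then show ?thesis using 2 g by (simp add: at_within_Icc_at_left)
    next
      case 3
      have "continuous_on {0<..<1} \<gamma>" using s(1) by (rule continuous_on_eq) (auto simp: g)
      then have "isCont \<gamma> t" using 3 by (simp add: continuous_on_eq_continuous_at)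
      then show ?thesis by (meson isCont_def tendsto_within_subset subset_UNIV)
    qed
  qed
  then have path: "path \<gamma>" by (simp add: path_def)
  have "{0..1::real} = insert 0 (insert 1 {0<..<1})" by auto
  then have im: "path_image \<gamma> = insert \<beta>0 (insert \<beta>1 (s ` {0<..<1}))"
    unfolding path_image_def by (auto simp: g image_iff)
  have "path_image \<gamma> = closure (s ` {0<..<1})"
  proof
    have "closed (path_image \<gamma>)" using path by (rule closed_path_image)
    then show "closure (s ` {0<..<1}) \<subseteq> path_image \<gamma>" using im by (intro closure_minimal) auto
    have "\<gamma> ` closure {0<..<1} \<subseteq> closure (\<gamma> ` {0<..<1})"
    proof (rule image_closure_subset[OF _ closed_closure closure_subset])
      show "continuous_on (closure {0<..<1}) \<gamma>" using path by (simp add: path_def)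
    qed
    moreover have "\<gamma> ` {0<..<1} = s ` {0<..<1}" by (auto simp: g image_iff)
    ultimately show "path_image \<gamma> \<subseteq> closure (s ` {0<..<1})" by (simp add: path_image_def)
  qed
  have key: "x = y \<or> (x = 0 \<and> y = 1) \<or> (x = 1 \<and> y = 0)"
    if "x \<in> {0..1}" "y \<in> {0..1}" "\<gamma> x = \<gamma> y" for x y
  proof -
    have cas: "x = 0 \<or> x = 1 \<or> (0 < x \<and> x < 1)" "y = 0 \<or> y = 1 \<or> (0 < y \<and> y < 1)" using that by fastforce+
    have "s x \<noteq> \<beta>0" "s x \<noteq> \<beta>1" if "0 < x" "x < 1" for x using out that by force+
    then show ?thesis using cas that g inj_onD[OF s(2)]
      by (metis greaterThanLessThan_iff)
  qed
  have "arc \<gamma>" if "\<beta>0 \<noteq> \<beta>1"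
    unfolding arc_def inj_on_def using path key g that by metis
  moreover have "simple_path \<gamma>"
    unfolding simple_path_def loop_free_def using path key by blast
  ultimately show thesis
    using that[OF path g im \<open>path_image \<gamma> = closure (s ` {0<..<1})\<close>] by blast
qed

context disc_covering
begin

lemma norm_bound:
  obtains M where "\<And>z. z \<in> ball 0 1 \<Longrightarrow> norm (\<phi> z) \<le> M"
  using bounded_domain image unfolding bounded_iff by (metis imageI)

text \<open>The image of the closed disc of radius \<open>\<rho>\<close> is compact and misses
  \<open>q\<close>.\<close>

lemma near_omitted_value_imp_norm_gt:
  assumes "q \<notin> \<Omega>" "\<rho> < 1"
  obtains d where "d > 0" "\<And>z. z \<in> ball 0 1 \<Longrightarrow> dist (\<phi> z) q < d \<Longrightarrow> \<rho> < norm z"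
proof -
  define K where "K = \<phi> ` cball 0 \<rho>"
  have sub: "cball 0 \<rho> \<subseteq> ball (0::complex) 1" using assms by auto
  have "compact K" unfolding K_def
    by (intro compact_continuous_image continuous_on_subset[OF cont sub]) auto
  moreover have "q \<notin> K" using sub assms in_domain unfolding K_def by blast
  ultimately obtain d where d: "d > 0" "\<And>x. x \<in> K \<Longrightarrow> d \<le> dist q x"
    using separate_point_closed compact_imp_closed by metis
  show thesis
  proof (rule that[OF d(1)])
    show "\<rho> < norm z" if "z \<in> ball 0 1" "dist (\<phi> z) q < d" for z
      using d(2)[of "\<phi> z"] that unfolding K_def by (force simp: dist_commute)
  qed
qed

text \<open>Koebe's lemma for \<open>\<phi> - q\<close>, freed of its condition on norms: an omitted
  value is approached only near the circle.\<close>

lemma small_image_imp_small_set: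
  assumes q: "q \<notin> \<Omega>" and \<delta>: "\<delta> > 0"
  obtains \<epsilon> where "\<epsilon> > 0"
    "\<And>C z w. path_connected C \<Longrightarrow> C \<subseteq> ball 0 1 \<Longrightarrow> (\<And>x. x \<in> C \<Longrightarrow> dist (\<phi> x) q < \<epsilon>)
        \<Longrightarrow> z \<in> C \<Longrightarrow> w \<in> C \<Longrightarrow> dist z w \<le> \<delta>"
proof -
  obtain M where M: "\<And>z. z \<in> ball 0 1 \<Longrightarrow> norm (\<phi> z) \<le> M" using norm_bound by blast
  have "(\<lambda>z. \<phi> z - q) holomorphic_on ball 0 1" by (intro holomorphic_intros hol)
  moreover have "norm (\<phi> z - q) \<le> M + norm q" if "z \<in> ball 0 1" for z
    using M[OF that] norm_triangle_ineq4[of "\<phi> z" q] by simp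
  moreover have "\<not> (\<lambda>z. \<phi> z - q) constant_on ball 0 1"
    using nonconstant unfolding constant_on_def by (metis diff_add_cancel)
  ultimately obtain \<epsilon> \<rho> where k: "\<epsilon> > 0" "0 < \<rho>" "\<rho> < 1"
    "\<And>C z w. path_connected C \<Longrightarrow> (\<And>x. x \<in> C \<Longrightarrow> \<rho> < norm x \<and> norm x < 1 \<and> norm (\<phi> x - q) < \<epsilon>)
        \<Longrightarrow> z \<in> C \<Longrightarrow> w \<in> C \<Longrightarrow> dist z w \<le> \<delta>"
    using koebe_arcs[of "\<lambda>z. \<phi> z - q" "M + norm q" \<delta>] \<delta> by metis
  obtain d where d: "d > 0" "\<And>z. z \<in> ball 0 1 \<Longrightarrow> dist (\<phi> z) q < d \<Longrightarrow> \<rho> < norm z"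
    using near_omitted_value_imp_norm_gt[OF q k(3)] by metis
  show thesis
  proof (rule that[of "min d \<epsilon>"])
    show "min d \<epsilon> > 0" using d k by simp
    fix C z w assume C: "path_connected C" "C \<subseteq> ball 0 1" "\<And>x. x \<in> C \<Longrightarrow> dist (\<phi> x) q < min d \<epsilon>" "z \<in> C" "w \<in> C"
    show "dist z w \<le> \<delta>"
    proof (rule k(4)[OF C(1) _ C(4,5)])
      show "\<rho> < norm x \<and> norm x < 1 \<and> norm (\<phi> x - q) < \<epsilon>" if "x \<in> C" for x
        using C(3)[OF that] C(2) that d(2)[of x] by (auto simp: dist_norm subset_iff)
    qed
  qed
qed

text \<open>Koebe's lemma bounds the oscillation of \<open>s\<close> near \<open>b\<close>, so
  \<open>s\<close> is Cauchy there; the limit is on the circle because values near the omitted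
  \<open>q\<close> force norms near 1.\<close>

lemma lift_end_converges:
  fixes s :: "real \<Rightarrow> complex"
  assumes s: "continuous_on {c<..<b} s" "c < b" "\<And>t. c < t \<Longrightarrow> t < b \<Longrightarrow> s t \<in> ball 0 1"
    and lim: "((\<lambda>t. \<phi> (s t)) \<longlongrightarrow> q) (at_left b)" and q: "q \<notin> \<Omega>"
  obtains \<beta> where "norm \<beta> = 1" "(s \<longlongrightarrow> \<beta>) (at_left b)"
proof -
  have osc: "\<exists>b'<b. c \<le> b' \<and> (\<forall>t t'. b' < t \<and> t < b \<and> b' < t' \<and> t' < b \<longrightarrow> dist (s t) (s t') \<le> \<delta>)" if \<delta>: "\<delta> > 0" for \<delta>
  proof -
    obtain \<epsilon> where \<epsilon>: "\<epsilon> > 0"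
      "\<And>C z w. path_connected C \<Longrightarrow> C \<subseteq> ball 0 1 \<Longrightarrow> (\<And>x. x \<in> C \<Longrightarrow> dist (\<phi> x) q < \<epsilon>)
        \<Longrightarrow> z \<in> C \<Longrightarrow> w \<in> C \<Longrightarrow> dist z w \<le> \<delta>"
      using small_image_imp_small_set[OF q \<delta>] by metis
    from tendstoD[OF lim \<epsilon>(1)] obtain b0 where b0: "b0 < b" "\<And>t. b0 < t \<Longrightarrow> t < b \<Longrightarrow> dist (\<phi> (s t)) q < \<epsilon>"
      unfolding eventually_at_left_field by blast
    define b' where "b' = max b0 c"
    have b': "b' < b" "b0 \<le> b'" "c \<le> b'" using b0 s by (auto simp: b'_def)
    have "dist (s t) (s t') \<le> \<delta>" if "b' < t \<and> t < b \<and> b' < t' \<and> t' < b" for t t'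
    proof (rule \<epsilon>(2)[of "s ` {b'<..<b}"])
      show "path_connected (s ` {b'<..<b})"
        using s(1) b' by (intro path_connected_continuous_image) (auto intro: continuous_on_subset convex_imp_path_connected)
    qed (use that b' b0 s in auto)
    then show ?thesis using b' by blast
  qed
  \<comment> \<open>The 2 in the denominator keeps every \<open>t n\<close>, including
    \<open>t 0\<close>, strictly above \<open>c\<close>.\<close>
  define t where "t n = b - (b - c) / (real n + 2)" for n
  have t: "c < t n" "t n < b" for n
  proof -
    have "(b - c) / (real n + 2) < b - c" using s(2) by (simp add: divide_less_eq)
    then show "c < t n" "t n < b" using s(2) by (auto simp: t_def)
  qed
  have tlim: "t \<longlonglongrightarrow> b"
  proof -
    have "(\<lambda>n. b - (b - c) / (real n + 2)) \<longlonglongrightarrow> b - 0"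
      by (intro tendsto_intros tendsto_divide_0[OF tendsto_const] filterlim_at_top_imp_at_infinity)
        (simp add: filterlim_tendsto_add_at_top filterlim_real_sequentially filterlim_at_top_add_at_top add.commute[of _ 2] tendsto_const filterlim_tendsto_add_at_top[OF tendsto_const])
    then show ?thesis by (simp add: t_def[abs_def])
  qed
  have "compact (cball (0::complex) 1)" by simp
  moreover have "\<forall>n. s (t n) \<in> cball 0 1" using s(3)[OF t] by (auto simp: less_imp_le)
  ultimately obtain \<beta> r where r: "strict_mono (r::nat\<Rightarrow>nat)" "((s \<circ> t) \<circ> r) \<longlonglongrightarrow> \<beta>"
    unfolding compact_def by (metis comp_apply)
  have trlim: "(\<lambda>n. t (r n)) \<longlonglongrightarrow> b" using LIMSEQ_subseq_LIMSEQ[OF tlim r(1)] by (simp add: o_def)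
  have slim: "(s \<longlongrightarrow> \<beta>) (at_left b)"
  proof (rule tendstoI)
    fix \<delta> :: real assume "\<delta> > 0"
    then obtain b' where b': "b' < b" "\<And>t t'. b' < t \<and> t < b \<and> b' < t' \<and> t' < b \<Longrightarrow> dist (s t) (s t') \<le> \<delta>/2"
      using osc[of "\<delta>/2"] by auto
    have "dist (s u) \<beta> < \<delta>" if u: "b' < u" "u < b" for u
    proof -
      have "dist (s u) \<beta> \<le> \<delta>/2"
      proof (rule tendsto_upperbound)
        show "(\<lambda>n. dist (s u) (s (t (r n)))) \<longlonglongrightarrow> dist (s u) \<beta>"
          using r(2) by (intro tendsto_intros) (simp add: o_def)
        have "\<forall>\<^sub>F n in sequentially. b' < t (r n)" using trlim b'(1) by (rule order_tendstoD)
        then show "\<forall>\<^sub>F n in sequentially. dist (s u) (s (t (r n))) \<le> \<delta>/2"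
          by eventually_elim (use b'(2) u t in blast)
      qed simp
      then show ?thesis using \<open>\<delta> > 0\<close> by simp
    qed
    then show "\<forall>\<^sub>F u in at_left b. dist (s u) \<beta> < \<delta>"
      unfolding eventually_at_left_field using b'(1) by blast
  qed
  have evs: "\<forall>\<^sub>F u in at_left b. s u \<in> ball 0 1"
    unfolding eventually_at_left_field using s(2,3) by blast
  have nlim: "((\<lambda>u. norm (s u)) \<longlongrightarrow> norm \<beta>) (at_left b)" using slim by (rule tendsto_norm)
  have "norm \<beta> \<le> 1"
    by (rule tendsto_upperbound[OF nlim]) (use evs in \<open>auto elim: eventually_mono\<close>)
  moreover have "\<rho> \<le> norm \<beta>" if "\<rho> < 1" for \<rho>
  proof (rule tendsto_lowerbound[OF nlim])
    obtain d where d: "d > 0" "\<And>z. z \<in> ball 0 1 \<Longrightarrow> dist (\<phi> z) q < d \<Longrightarrow> \<rho> < norm z"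
      using near_omitted_value_imp_norm_gt[OF q \<open>\<rho> < 1\<close>] by metis
    from tendstoD[OF lim d(1)] evs show "\<forall>\<^sub>F u in at_left b. \<rho> \<le> norm (s u)"
      by eventually_elim (use d(2) in \<open>auto intro: less_imp_le\<close>)
  qed simp
  then have "1 \<le> norm \<beta>" by (rule dense_le)
  ultimately show thesis using slim that by simp
qed

lemma lift_start_converges:
  fixes s :: "real \<Rightarrow> complex"
  assumes s: "continuous_on {a<..<c} s" "a < c" "\<And>t. a < t \<Longrightarrow> t < c \<Longrightarrow> s t \<in> ball 0 1"
    and lim: "((\<lambda>t. \<phi> (s t)) \<longlongrightarrow> q) (at_right a)" and q: "q \<notin> \<Omega>"
  obtains \<beta> where "norm \<beta> = 1" "(s \<longlongrightarrow> \<beta>) (at_right a)"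
proof -
  obtain \<beta> where \<beta>: "norm \<beta> = 1" "((\<lambda>t. s (-t)) \<longlongrightarrow> \<beta>) (at_left (-a))"
  proof (rule lift_end_converges[of "-c" "-a" "\<lambda>t. s (-t)" q])
    show "continuous_on {-c<..<-a} (\<lambda>t. s (-t))"
      by (rule continuous_on_compose2[OF s(1)]) (auto intro!: continuous_intros)
    show "((\<lambda>t. \<phi> (s (-t))) \<longlongrightarrow> q) (at_left (-a))"
      using lim by (simp add: filterlim_at_left_to_right)
  qed (use s q in auto)
  then have "(s \<longlongrightarrow> \<beta>) (at_right a)" by (simp add: filterlim_at_left_to_right)
  then show thesis using \<beta> that by blast
qed

lemma cluster_value_interior:
  assumes "z \<in> ball 0 1" "u \<longlonglongrightarrow> z" "(\<lambda>n. \<phi> (u n)) \<longlonglongrightarrow> y"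
  shows "y = \<phi> z"
proof -
  have "isCont \<phi> z" using assms cont by (simp add: continuous_on_eq_continuous_at)
  then have "(\<lambda>n. \<phi> (u n)) \<longlonglongrightarrow> \<phi> z" using assms(2) isCont_tendsto_compose by blast
  then show ?thesis using assms(3) LIMSEQ_unique by blast
qed

lemma image_inside_subset_domain:
  assumes c: "simple_path c" "path_image c \<subseteq> cball 0 1"
  shows "\<phi> ` inside (path_image c) \<subseteq> \<Omega>"
  using inside_subset_ball[OF c(2)] c(1) in_domain
  by (meson closed_path_image image_subset_iff simple_path_imp_path subsetD)

end

section \<open>Injectivity of lifts, and components over a curve that leaves the domain\<close>

context disc_covering_curve
begin

lemma param_component_UNIV:
  assumes "path_image g \<subseteq> \<Omega>"
  shows "param_component t = UNIV"
proof -
  have "e -` \<Omega> = UNIV" using assms e_range by auto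
  then show ?thesis by (simp add: param_component_def connected_component_UNIV)
qed

lemma param_component_interval:
  assumes et: "e t \<in> \<Omega>" and n: "\<not> path_image g \<subseteq> \<Omega>"
  obtains a b where "a < t" "t < b" "param_component t = {a<..<b}" "e a \<notin> \<Omega>" "e b \<notin> \<Omega>"
proof -
  \<comment> \<open>By periodicity one exit parameter \<open>u\<close> yields exits on both sides of
    \<open>t\<close>; the nearest ones bound the component.\<close>
  obtain u where u: "e u \<notin> \<Omega>" using n e_range by (metis image_subset_iff)
  define B where "B = {x. e x \<notin> \<Omega>} \<inter> {t..}"
  define A where "A = {x. e x \<notin> \<Omega>} \<inter> {..t}"
  have "{x. e x \<notin> \<Omega>} = - (e -` \<Omega>)" by auto
  then have cl: "closed {x. e x \<notin> \<Omega>}" using open_preimage by (simp only: closed_Compl)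
  have "u + of_int \<lceil>t - u\<rceil> \<in> B" using u le_of_int_ceiling[of "t - u"] unfolding B_def Int_iff mem_Collect_eq e_periodic atLeast_iff by linarith
  moreover have "closed B" "bdd_below B" using cl by (auto simp: B_def)
  ultimately have b: "Inf B \<in> B" by (intro closed_contains_Inf) auto
  have "u + of_int \<lfloor>t - u\<rfloor> \<in> A" using u of_int_floor_le[of "t - u"] unfolding A_def Int_iff mem_Collect_eq e_periodic atMost_iff by linarith
  moreover have "closed A" "bdd_above A" using cl by (auto simp: A_def)
  ultimately have a: "Sup A \<in> A" by (intro closed_contains_Sup) auto
  define x y where "x = Sup A" "y = Inf B"
  have xy: "x \<le> t" "t \<le> y" "e x \<notin> \<Omega>" "e y \<notin> \<Omega>" using a b by (auto simp: x_y_def A_def B_def)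
  then have xy': "x < t" "t < y" using et by (auto simp: less_le)
  note P = param_component_props[OF et]
  have "{x<..<y} \<subseteq> e -` \<Omega>"
  proof
    fix w assume w: "w \<in> {x<..<y}"
    show "w \<in> e -` \<Omega>"
    proof (rule ccontr)
      assume "w \<notin> e -` \<Omega>"
      then have "w \<in> A \<or> w \<in> B" by (auto simp: A_def B_def)
      then show False
        using w cInf_lower[of w B] cSup_upper[of w A] \<open>bdd_below B\<close> \<open>bdd_above A\<close> by (auto simp: x_y_def)
    qed
  qed
  then have "{x<..<y} \<subseteq> param_component t"
    unfolding param_component_def using xy' by (intro connected_component_maximal) auto
  moreover have "param_component t \<subseteq> {x<..<y}"
  proof
    fix w assume w: "w \<in> param_component t"
    have seg: "closed_segment t w \<subseteq> param_component t"
      using P w by (meson closed_segment_subset)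
    have "x \<notin> param_component t" "y \<notin> param_component t" using xy P by auto
    then have "x \<notin> closed_segment t w" "y \<notin> closed_segment t w" using seg by auto
    then show "w \<in> {x<..<y}"
      using xy' by (auto simp: closed_segment_eq_real_ivl split: if_splits)
  qed
  ultimately show thesis using that[of x y] xy xy' by blast
qed

text \<open>Such a loop would make every point inside the curve, apart from one point on the curve
  itself, a value of \<open>\<phi>\<close>; but \<open>p\<close> is inside and omitted. The point
  \<open>e 0\<close> merely fills the place of the exceptional point.\<close>

lemma no_bounding_loop:
  assumes c: "simple_path c" "pathfinish c = pathstart c" "path_image c \<subseteq> cball 0 1"
    and clu: "\<And>u z y. \<lbrakk>\<And>n::nat. u n \<in> inside (path_image c); u \<longlonglongrightarrow> z; z \<in> path_image c;
        (\<lambda>n. \<phi> (u n)) \<longlonglongrightarrow> y\<rbrakk> \<Longrightarrow> y \<in> path_image g"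
  shows False
proof -
  have q: "e 0 \<in> path_image g" using e_range by blast
  have "inside (path_image g) - {e 0} \<subseteq> \<phi> ` inside (path_image c)"
  proof (rule Jordan_inside_subset_image_inside[OF g c hol nonconstant])
    show "bounded (\<phi> ` ball 0 1)" by (simp add: image bounded_domain)
  qed (use clu in blast)
  moreover have "p \<noteq> e 0" using q p_inside inside_no_overlap by blast
  ultimately have "p \<in> \<Omega>" using p_inside image_inside_subset_domain[OF c(1,3)] by blast
  then show False using p_notin by simp
qed

text \<open>A lift that takes a value twice is periodic with an integer period. Over the least
  period it is a simple loop in the open disc, where cluster values are values of
  \<open>\<phi>\<close> on the loop and so lie on the curve; \<open>no_bounding_loop\<close>
  excludes this.\<close>

lemma lift_injective:
  assumes et: "e t \<in> \<Omega>"
    and s: "continuous_on (param_component t) s" "\<And>x. x \<in> param_component t \<Longrightarrow> s x \<in> ball 0 1"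
      "\<And>x. x \<in> param_component t \<Longrightarrow> \<phi> (s x) = e x"
  shows "inj_on s (param_component t)"
proof (rule ccontr)
  assume "\<not> inj_on s (param_component t)"
  then obtain x0 y0 where xy0: "x0 \<in> param_component t" "y0 \<in> param_component t" "s x0 = s y0" "x0 \<noteq> y0"
    unfolding inj_on_def by blast
  obtain x y where xy: "x \<in> param_component t" "y \<in> param_component t" "s x = s y" "x < y"
    using xy0 by (metis linorder_neqE_linordered_idom)
  note P = param_component_props[OF et]
  have "e y = e x" using xy s by metis
  then have "y - x \<in> \<int>" using e_eq by blast
  then obtain n where n: "y = x + of_int n" by (auto elim!: Ints_cases simp: algebra_simps)
  then have n1: "n \<ge> 1" using xy(4) by linarith
  \<comment> \<open>The two parameters differ by an integer that is at least 1, so the component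
    contains a full period.\<close>
  have full: "path_image g \<subseteq> \<Omega>"
  proof
    fix v assume "v \<in> path_image g"
    then obtain w where w: "v = e w" using e_range by blast
    define w' where "w' = w - of_int \<lfloor>w - x\<rfloor>"
    have "e w' = e w" unfolding w'_def e_eq by simp
    moreover have "x \<le> w'" "w' \<le> x + 1"
      using floor_correct[of "w - x"] unfolding w'_def by linarith+
    then have "w' \<in> closed_segment x y" using n n1 xy(4) by (auto simp: closed_segment_eq_real_ivl intro: order_trans)
    then have "w' \<in> param_component t" using closed_segment_subset[OF xy(1,2) P(4)] by blast
    ultimately show "v \<in> \<Omega>" using P(5) w by auto
  qed
  have U: "param_component t = UNIV" by (rule param_component_UNIV[OF full])
  define Q where "Q m \<longleftrightarrow> (\<exists>x. 0 < m \<and> s x = s (x + of_nat m))" for m :: nat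
  have "Q (nat n)" unfolding Q_def using n n1 xy by (intro exI[of _ x]) auto
  \<comment> \<open>Minimality makes the loop \<open>c\<close> simple: a coincidence inside the
    period would give a smaller one.\<close>
  define m where "m = (LEAST m. Q m)"
  have Qm: "Q m" and Qmin: "\<And>k. k < m \<Longrightarrow> \<not> Q k"
    unfolding m_def using LeastI[of Q, OF \<open>Q (nat n)\<close>] not_less_Least by blast+
  obtain x1 where m: "0 < m" "s x1 = s (x1 + of_nat m)" using Qm by (auto simp: Q_def)
  have per: "s y = s (y - of_nat m)" for y
    using lift_shift(2)[OF s s, of x1 "int m" y] m(2) unfolding U of_int_of_nat_eq by blast
  define c where "c \<tau> = s (of_nat m * \<tau>)" for \<tau> :: real
  have contc: "continuous_on A c" for A
  proof -
    have "continuous_on UNIV s" using s(1) unfolding U .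
    then show ?thesis unfolding c_def by (rule continuous_on_compose2) (intro continuous_intros, simp)
  qed
  have cm: "c 1 = c 0" using per[of "of_nat m"] by (simp add: c_def)
  have key: "x = y \<or> x = 0 \<and> y = 1 \<or> x = 1 \<and> y = 0" if "x \<in> {0..1}" "y \<in> {0..1}" "c x = c y" "x \<le> y" for x y
  proof (rule ccontr)
    assume no: "\<not> ?thesis"
    then have lt: "x < y" "0 < x \<or> y < 1" using that by auto
    have "e (m * y) = e (m * x)" using that s U unfolding c_def by (metis UNIV_I)
    then have "m * y - m * x \<in> \<int>" using e_eq by blast
    then obtain k where k: "m * y = m * x + of_int k" by (auto elim!: Ints_cases simp: algebra_simps)
    have "m * x < m * y" using lt m by simp
    then have k1: "k > 0" using k by simp
    have "y - x < 1" using that lt by auto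
    then have "real m * (y - x) < real m * 1" using m by (intro mult_strict_left_mono) auto
    then have "of_int k < (of_nat m :: real)" using k by (simp add: algebra_simps)
    then have "nat k < m" using k1 by linarith
    moreover have "Q (nat k)" unfolding Q_def using k k1 that by (intro exI[of _ "m * x"]) (auto simp: c_def)
    ultimately show False using Qmin by blast
  qed
  have sp: "simple_path c"
    unfolding simple_path_def loop_free_def path_def
  proof (intro conjI ballI impI contc)
    fix x y :: real assume *: "x \<in> {0..1}" "y \<in> {0..1}" "c x = c y"
    show "x = y \<or> x = 0 \<and> y = 1 \<or> x = 1 \<and> y = 0"
      using key[OF *] key[of y x] * by (cases "x \<le> y") auto
  qed
  have imb: "path_image c \<subseteq> ball 0 1" using s U by (auto simp: path_image_def c_def)
  show False
  proof (rule no_bounding_loop[OF sp])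
    show "pathfinish c = pathstart c" using cm by (simp add: pathstart_def pathfinish_def)
    show "path_image c \<subseteq> cball 0 1" using imb ball_subset_cball by blast
    fix u z y assume *: "u \<longlonglongrightarrow> z" "z \<in> path_image c" "(\<lambda>n. \<phi> (u n)) \<longlonglongrightarrow> y"
    then have "y = \<phi> z" using imb cluster_value_interior by blast
    then show "y \<in> path_image g" using * s U e_range by (auto simp: path_image_def c_def)
  qed
qed

text \<open>Only the part of the arc after its outermost point \<open>of_real r1 * \<alpha>\<close>
  on the radius is kept; together with the radius it has the shape that
  \<open>radial_limit_eq_limit_along_arc\<close> requires.\<close>

lemma arc_end_value_eq_radial_limit:
  assumes \<alpha>: "norm \<alpha> = 1" and rad: "((\<lambda>r::real. \<phi> (of_real r * \<alpha>)) \<longlongrightarrow> p) (at_left 1)"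
    and \<gamma>: "arc \<gamma>" "\<gamma> 1 = \<alpha>" "\<gamma> ` {0<..<1} \<subseteq> ball 0 1"
    and r1: "0 \<le> r1" "r1 < 1" "of_real r1 * \<alpha> \<in> \<gamma> ` {0<..<1}"
      "\<And>r. r1 < r \<Longrightarrow> r < 1 \<Longrightarrow> of_real r * \<alpha> \<notin> \<gamma> ` {0<..<1}"
    and lim: "((\<lambda>t. \<phi> (\<gamma> t)) \<longlongrightarrow> q) (at_left 1)"
  shows "q = p"
proof -
  obtain t1 where t1: "0 < t1" "t1 < 1" "\<gamma> t1 = of_real r1 * \<alpha>" using r1(3) by force
  define c where "c = subpath t1 1 \<gamma>"
  have cim: "path_image c = \<gamma> ` {t1..1}" using t1 by (simp add: c_def path_image_subpath)
  have sub: "\<gamma> ` {t1..1} \<subseteq> insert \<alpha> (\<gamma> ` {0<..<1})"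
  proof
    fix x assume "x \<in> \<gamma> ` {t1..1}"
    then obtain t where "t \<in> {t1..1}" "x = \<gamma> t" by blast
    then show "x \<in> insert \<alpha> (\<gamma> ` {0<..<1})" using t1 \<gamma>(2) by (cases "t = 1") auto
  qed
  have "p = q"
  proof (rule radial_limit_eq_limit_along_arc[OF hol _ \<alpha> r1(1,2) rad])
    show "bounded (\<phi> ` ball 0 1)" by (simp add: image bounded_domain)
    show "arc c" unfolding c_def using \<gamma>(1) t1 by (intro arc_subpath_arc) auto
    show "pathstart c = of_real r1 * \<alpha>" "pathfinish c = \<alpha>" using t1 \<gamma>(2) by (auto simp: c_def)
    show "path_image c \<subseteq> insert \<alpha> (ball 0 1)" using cim sub \<gamma>(3) by auto
    show "of_real r * \<alpha> \<notin> path_image c" if "r1 < r" "r < 1" for r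
    proof -
      have "of_real r * \<alpha> \<noteq> \<alpha>" using that \<alpha> by auto
      then show ?thesis using r1(4)[OF that] sub cim by blast
    qed
    have "filterlim (\<lambda>t. (1 - t1) * t + t1) (at_left 1) (at_left 1)"
      unfolding filterlim_at
    proof
      show "((\<lambda>t. (1 - t1) * t + t1) \<longlongrightarrow> 1) (at_left 1)" by (auto intro!: tendsto_eq_intros)
      have "(1 - t1) * t + t1 < 1" if "t < 1" for t
        using mult_strict_left_mono[OF that, of "1 - t1"] t1 by (simp add: algebra_simps)
      then show "\<forall>\<^sub>F t in at_left 1. (1 - t1) * t + t1 \<in> {..<1} \<and> (1 - t1) * t + t1 \<noteq> 1"
        unfolding eventually_at_left_field by (intro exI[of _ 0]) (auto simp: less_le)
    qed
    from filterlim_compose[OF lim this] show "((\<lambda>t. \<phi> (c t)) \<longlongrightarrow> q) (at_left 1)"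
      by (simp add: c_def subpath_def)
  qed
  then show ?thesis by simp
qed

lemma crossing_curve_arc:
  assumes n: "\<not> path_image g \<subseteq> \<Omega>" and \<alpha>: "norm \<alpha> = 1"
    and rad: "((\<lambda>r::real. \<phi> (of_real r * \<alpha>)) \<longlongrightarrow> p) (at_left 1)"
    and C: "C \<in> components (ball 0 1 \<inter> \<phi> -` path_image g)"
    and r1: "0 \<le> r1" "r1 < 1" "of_real r1 * \<alpha> \<in> C" "\<And>r. r1 < r \<Longrightarrow> r < 1 \<Longrightarrow> of_real r * \<alpha> \<notin> C"
  shows "path_connected C \<and> (\<exists>\<gamma>. arc \<gamma> \<and> path_image \<gamma> = closure C) \<and> \<alpha> \<notin> closure C"
proof -
  define z where "z = of_real r1 * \<alpha>"
  have Cz: "C = connected_component_set (ball 0 1 \<inter> \<phi> -` path_image g) z"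
    using C r1(3) unfolding components_def z_def using connected_component_eq by blast
  have zb: "z \<in> ball 0 1" "\<phi> z \<in> path_image g" using in_components_subset[OF C] r1(3) by (auto simp: z_def)
  then obtain t where t: "\<phi> z = e t" using e_range by auto
  have et: "e t \<in> \<Omega>" using t in_domain[OF zb(1)] by simp
  obtain s where s: "continuous_on (param_component t) s" "\<And>x. x \<in> param_component t \<Longrightarrow> s x \<in> ball 0 1"
    "s t = z" "\<And>x. x \<in> param_component t \<Longrightarrow> \<phi> (s x) = e x"
    using lift_param[OF zb(1) t] by metis
  have Cs: "C = s ` param_component t"
    unfolding Cz by (rule component_eq_lift_image[OF zb(1) t s])
  have inj: "inj_on s (param_component t)" by (rule lift_injective[OF et s(1,2,4)])
  obtain a b where ab: "a < t" "t < b" "param_component t = {a<..<b}" "e a \<notin> \<Omega>" "e b \<notin> \<Omega>"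
    using param_component_interval[OF et n] .
  have econt: "(e \<longlongrightarrow> e x) (at x within X)" for x X
    using e_cont by (meson UNIV_I continuous_on_def tendsto_within_subset subset_UNIV)
  \<comment> \<open>At its ends the lift approaches the values \<open>e a\<close> and
    \<open>e b\<close> outside \<open>\<Omega>\<close>, which is what makes both ends
    converge.\<close>
  have evl: "((\<lambda>t. \<phi> (s t)) \<longlongrightarrow> e b) (at_left b)"
    by (rule Lim_transform_eventually[OF econt]) (use ab s in \<open>auto simp: eventually_at_left_field intro!: exI[of _ a]\<close>)
  have evr: "((\<lambda>t. \<phi> (s t)) \<longlongrightarrow> e a) (at_right a)"
    by (rule Lim_transform_eventually[OF econt]) (use ab s in \<open>auto simp: eventually_at_right_field intro!: exI[of _ b]\<close>)
  have lt: "a < b" using ab by simp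
  obtain \<beta>1 where \<beta>1: "norm \<beta>1 = 1" "(s \<longlongrightarrow> \<beta>1) (at_left b)"
    using lift_end_converges[of a b s "e b"] s ab lt evl by auto
  obtain \<beta>0 where \<beta>0: "norm \<beta>0 = 1" "(s \<longlongrightarrow> \<beta>0) (at_right a)"
    using lift_start_converges[of a b s "e a"] s ab lt evr by auto
  define h where "h t = a + (b - a) * t" for t
  have him: "h ` {0<..<1} = {a<..<b}"
  proof -
    have "y \<in> h ` {0<..<1}" if "y \<in> {a<..<b}" for y
      using that lt by (intro image_eqI[of _ _ "(y - a) / (b - a)"]) (auto simp: h_def divide_simps)
    moreover have "h x \<in> {a<..<b}" if "x \<in> {0<..<1}" for x
    proof -
      have "(b - a) * x < (b - a) * 1" using that lt by (intro mult_strict_left_mono) auto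
      moreover have "0 < (b - a) * x" using that lt by simp
      ultimately show ?thesis by (simp add: h_def algebra_simps)
    qed
    ultimately show ?thesis by blast
  qed
  define S where "S t = s (h t)" for t
  have imS: "S ` {0<..<1} = C" unfolding S_def Cs ab(3) him[symmetric] by (simp add: image_image)
  have injh: "inj h" using lt by (auto simp: inj_on_def h_def)
  have hl: "filterlim h (at_left b) (at_left 1)"
    unfolding filterlim_at
  proof
    show "(h \<longlongrightarrow> b) (at_left 1)" unfolding h_def by (auto intro!: tendsto_eq_intros)
    have "h t < b" if "t < 1" for t using mult_strict_left_mono[OF that, of "b - a"] lt by (simp add: h_def algebra_simps)
    then show "\<forall>\<^sub>F t in at_left 1. h t \<in> {..<b} \<and> h t \<noteq> b"
      unfolding eventually_at_left_field by (intro exI[of _ 0]) (auto simp: less_le)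
  qed
  have hr: "filterlim h (at_right a) (at_right 0)"
    unfolding filterlim_at
  proof
    show "(h \<longlongrightarrow> a) (at_right 0)" unfolding h_def by (auto intro!: tendsto_eq_intros)
    have "h t > a" if "t > 0" for t using that lt by (simp add: h_def)
    then show "\<forall>\<^sub>F t in at_right 0. h t \<in> {a<..} \<and> h t \<noteq> a"
      unfolding eventually_at_right_field by (intro exI[of _ 1]) (auto simp: less_le)
  qed
  have Cb: "C \<subseteq> ball 0 1" using in_components_subset[OF C] by auto
  obtain \<gamma> where \<gamma>: "path \<gamma>" "\<gamma> 0 = \<beta>0" "\<gamma> 1 = \<beta>1" "\<And>t. 0 < t \<Longrightarrow> t < 1 \<Longrightarrow> \<gamma> t = S t"
    "path_image \<gamma> = insert \<beta>0 (insert \<beta>1 (S ` {0<..<1}))"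
    "path_image \<gamma> = closure (S ` {0<..<1})" "\<beta>0 \<noteq> \<beta>1 \<Longrightarrow> arc \<gamma>" "\<beta>0 = \<beta>1 \<Longrightarrow> simple_path \<gamma>"
  proof (rule path_completion[of S \<beta>0 \<beta>1])
    have conth: "continuous_on {0<..<1} h" unfolding h_def by (intro continuous_intros)
    have conts: "continuous_on {a<..<b} s" using s(1) unfolding ab(3) .
    show "continuous_on {0<..<1} S" unfolding S_def
      by (rule continuous_on_compose2[OF conts conth]) (simp add: him)
    have "inj_on s (h ` {0<..<1})" using inj ab(3) him by simp
    then have "inj_on (s \<circ> h) {0<..<1}" using injh by (intro comp_inj_on) (auto intro: inj_on_subset)
    then show "inj_on S {0<..<1}" by (simp add: S_def[abs_def] comp_def)
    show "(S \<longlongrightarrow> \<beta>0) (at_right 0)" unfolding S_def[abs_def] by (rule filterlim_compose[OF \<beta>0(2) hr])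
    show "(S \<longlongrightarrow> \<beta>1) (at_left 1)" unfolding S_def[abs_def] by (rule filterlim_compose[OF \<beta>1(2) hl])
    show "\<beta>0 \<notin> S ` {0<..<1}" "\<beta>1 \<notin> S ` {0<..<1}" using imS Cb \<beta>0 \<beta>1 by auto
  qed (rule that)
  have Sl: "((\<lambda>t. \<phi> (\<gamma> t)) \<longlongrightarrow> e b) (at_left 1)"
  proof (rule Lim_transform_eventually)
    show "((\<lambda>t. \<phi> (S t)) \<longlongrightarrow> e b) (at_left 1)" unfolding S_def by (rule filterlim_compose[OF evl hl])
    show "\<forall>\<^sub>F t in at_left 1. \<phi> (S t) = \<phi> (\<gamma> t)"
      unfolding eventually_at_left_field by (intro exI[of _ 0]) (auto simp: \<gamma>)
  qed
  have Sr: "((\<lambda>t. \<phi> (\<gamma> t)) \<longlongrightarrow> e a) (at_right 0)"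
  proof (rule Lim_transform_eventually)
    show "((\<lambda>t. \<phi> (S t)) \<longlongrightarrow> e a) (at_right 0)" unfolding S_def by (rule filterlim_compose[OF evr hr])
    show "\<forall>\<^sub>F t in at_right 0. \<phi> (S t) = \<phi> (\<gamma> t)"
      unfolding eventually_at_right_field by (intro exI[of _ 1]) (auto simp: \<gamma>)
  qed
  have eg: "e x \<in> path_image g" for x using e_range by blast
  have imC: "path_image \<gamma> = insert \<beta>0 (insert \<beta>1 C)" using \<gamma>(5) imS by simp
  have ne: "\<beta>0 \<noteq> \<beta>1"
  proof
    assume eq: "\<beta>0 = \<beta>1"
    have sp: "simple_path \<gamma>" "pathfinish \<gamma> = pathstart \<gamma>"
      using \<gamma> eq by (auto simp: pathstart_def pathfinish_def)
    \<comment> \<open>The values \<open>e a\<close> and \<open>e b\<close> at the two ends may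
      differ. The product tends to 0 along both, so every cluster value at the common end point is
      one of the two and lies on the curve.\<close>
    define k where "k z = (\<phi> z - e a) * (\<phi> z - e b)" for z
    obtain M where M: "\<And>z. z \<in> ball 0 1 \<Longrightarrow> norm (\<phi> z) \<le> M" using norm_bound by blast
    have lim: "(k \<longlongrightarrow> 0) (at \<beta>1 within inside (path_image \<gamma>))"
    proof (rule lindelof_inside[OF sp])
      show "path_image \<gamma> \<subseteq> insert \<beta>1 (ball 0 1)" using imC eq Cb by auto
      show "k holomorphic_on ball 0 1" unfolding k_def by (intro holomorphic_intros hol)
      show "norm (k z) \<le> (M + norm (e a)) * (M + norm (e b))" if "z \<in> ball 0 1" for z
        unfolding k_def norm_mult using M[OF that] norm_triangle_ineq4[of "\<phi> z" "e a"] norm_triangle_ineq4[of "\<phi> z" "e b"]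
        by (intro mult_mono) (auto intro: order_trans order_trans[OF norm_ge_zero])
      have "(k \<longlongrightarrow> 0) (at (\<gamma> 1) within path_image \<gamma>)"
      proof (rule tendsto_at_loop_base[OF sp(1)])
        show "\<gamma> 0 = \<gamma> 1" using \<gamma> eq by simp
        show "((\<lambda>t. k (\<gamma> t)) \<longlongrightarrow> 0) (at_left 1)" unfolding k_def using Sl by (auto intro!: tendsto_eq_intros)
        show "((\<lambda>t. k (\<gamma> t)) \<longlongrightarrow> 0) (at_right 0)" unfolding k_def using Sr by (auto intro!: tendsto_eq_intros)
      qed
      then show "(k \<longlongrightarrow> 0) (at \<beta>1 within path_image \<gamma>)" using \<gamma>(3) by simp
    qed (rule \<beta>1)
    show False
    proof (rule no_bounding_loop[OF sp])
      show "path_image \<gamma> \<subseteq> cball 0 1" using imC Cb \<beta>0 \<beta>1 by (auto simp: less_imp_le subset_iff)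
      fix u z y assume u: "\<And>n::nat. u n \<in> inside (path_image \<gamma>)" "u \<longlonglongrightarrow> z" "z \<in> path_image \<gamma>" "(\<lambda>n. \<phi> (u n)) \<longlonglongrightarrow> y"
      show "y \<in> path_image g"
      proof (cases "z = \<beta>1")
        case False
        then have "z \<in> C" using u imC eq by auto
        then have "y = \<phi> z" using Cb cluster_value_interior[of z u y] u by auto
        then show ?thesis using \<open>z \<in> C\<close> in_components_subset[OF C] by auto
      next
        case True
        have "filterlim u (at \<beta>1 within inside (path_image \<gamma>)) sequentially"
          unfolding filterlim_at
        proof (intro conjI always_eventually allI)
          show "u \<longlonglongrightarrow> \<beta>1" using u(2) True by simp
          show "u n \<in> inside (path_image \<gamma>)" for n by (rule u(1))
          show "u n \<noteq> \<beta>1" for n using u(1)[of n] inside_no_overlap[of "path_image \<gamma>"] imC by blast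
        qed
        from filterlim_compose[OF lim this] have "(\<lambda>n. k (u n)) \<longlonglongrightarrow> 0" .
        moreover have "(\<lambda>n. k (u n)) \<longlonglongrightarrow> (y - e a) * (y - e b)"
          unfolding k_def using u(4) by (intro tendsto_intros)
        ultimately have "(y - e a) * (y - e b) = 0" using LIMSEQ_unique by blast
        then show ?thesis using eg by auto
      qed
    qed
  qed
  have arc: "arc \<gamma>" using \<gamma> ne by blast
  have gim: "\<gamma> ` {0<..<1} = C" using imS by (metis (mono_tags) \<gamma>(4) greaterThanLessThan_iff image_cong)
  have neqp: "e x \<noteq> p" for x using eg[of x] p_inside inside_no_overlap by blast
  have "\<beta>1 \<noteq> \<alpha>"
  proof
    assume "\<beta>1 = \<alpha>"
    then have "e b = p"
      using arc_end_value_eq_radial_limit[OF \<alpha> rad arc _ _ r1(1,2) _ _ Sl] \<gamma>(3) gim Cb r1(3,4) by simp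
    then show False using neqp by blast
  qed
  moreover have "\<beta>0 \<noteq> \<alpha>"
  proof
    assume eq: "\<beta>0 = \<alpha>"
    \<comment> \<open>The criterion speaks of the end at parameter 1, so the arc is
      reversed.\<close>
    define \<gamma>' where "\<gamma>' = reversepath \<gamma>"
    have gim': "\<gamma>' ` {0<..<1} = C"
    proof -
      have "(\<lambda>x::real. 1 - x) ` {0<..<1} = {0<..<1}" by (auto simp: image_iff intro!: bexI[of _ "1 - _"])
      then show ?thesis unfolding gim[symmetric] \<gamma>'_def reversepath_def by (metis image_image)
    qed
    have fl: "filterlim (\<lambda>t::real. 1 - t) (at_right 0) (at_left 1)"
      unfolding filterlim_at
      by (auto intro!: tendsto_eq_intros simp: eventually_at_left_field intro: exI[of _ 0])
    have lim': "((\<lambda>t. \<phi> (\<gamma>' t)) \<longlongrightarrow> e a) (at_left 1)"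
      using filterlim_compose[OF Sr fl] by (simp add: \<gamma>'_def reversepath_def)
    have "e a = p"
    proof (rule arc_end_value_eq_radial_limit[OF \<alpha> rad _ _ _ r1(1,2) _ _ lim'])
      show "arc \<gamma>'" using arc by (simp add: \<gamma>'_def arc_reversepath)
      show "\<gamma>' 1 = \<alpha>" using \<gamma>(2) eq by (simp add: \<gamma>'_def reversepath_def)
    qed (use gim' Cb r1 in auto)
    then show False using neqp by blast
  qed
  moreover have "\<alpha> \<notin> C" using Cb \<alpha> by auto
  ultimately have "\<alpha> \<notin> closure C" using imC \<gamma>(6) imS by auto
  moreover have "path_connected C"
    unfolding Cs ab(3) using s(1) ab(3) by (intro path_connected_continuous_image) (auto intro: convex_imp_path_connected)
  ultimately show ?thesis using arc \<gamma>(6) imS by auto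
qed

end

section \<open>Fixed point free automorphisms of the disc\<close>

text \<open>The automorphisms of the disc, for \<open>norm c = 1\<close> and
  \<open>norm w < 1\<close>. The explicit fraction also makes sense on the closed disc, where the
  fixed points of deck transformations lie.\<close>

definition disc_moebius :: "complex \<Rightarrow> complex \<Rightarrow> complex \<Rightarrow> complex" where
  "disc_moebius c w z = c * (z - w) / (1 - cnj w * z)"

lemma one_minus_cnj_mult_nonzero:
  assumes "norm w < 1" "norm z \<le> 1"
  shows "1 - cnj w * z \<noteq> 0"
proof -
  have "norm (cnj w * z) \<le> norm w * 1" unfolding norm_mult using assms by (intro mult_mono) auto
  then show ?thesis using assms by auto
qed

text \<open>After composition with a Moebius map that takes 0 to \<open>T' 0\<close>, the map and
  its inverse both fix 0; Schwarz's lemma for the two gives equality of norms, so the map is a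
  rotation.\<close>

lemma disc_automorphism_eq_moebius:
  assumes T: "T holomorphic_on ball 0 1" "\<And>z. z \<in> ball 0 1 \<Longrightarrow> T z \<in> ball 0 1"
    and T': "T' holomorphic_on ball 0 1" "\<And>z. z \<in> ball 0 1 \<Longrightarrow> T' z \<in> ball 0 1"
    and inv: "\<And>z. z \<in> ball 0 1 \<Longrightarrow> T' (T z) = z" "\<And>z. z \<in> ball 0 1 \<Longrightarrow> T (T' z) = z"
  obtains c w where "norm c = 1" "norm w < 1" "\<And>z. z \<in> ball 0 1 \<Longrightarrow> T z = disc_moebius c w z"
proof -
  define w where "w = T' 0"
  have w: "norm w < 1" using T'(2)[of 0] by (simp add: w_def)
  define m where "m = Moebius_function 0 (-w)"
  define m' where "m' = Moebius_function 0 w"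
  have mm: "m z \<in> ball 0 1" "m' z \<in> ball 0 1" "m (m' z) = z" "m' (m z) = z" if "z \<in> ball 0 1" for z
    using that w Moebius_function_norm_lt_1[of "-w" z 0] Moebius_function_norm_lt_1[of w z 0]
      Moebius_function_compose[of "-w" w z] Moebius_function_compose[of w "-w" z]
    by (auto simp: m_def m'_def)
  have hm: "m holomorphic_on ball 0 1" "m' holomorphic_on ball 0 1"
    using w by (auto simp: m_def m'_def intro: Moebius_function_holomorphic)
  have m0: "m 0 = w" "m' w = 0" by (auto simp: m_def m'_def Moebius_function_simple)
  define F where "F = T \<circ> m"
  define F' where "F' = m' \<circ> T'"
  have F: "F holomorphic_on ball 0 1" "F 0 = 0" "\<And>z. norm z < 1 \<Longrightarrow> norm (F z) < 1"
  proof -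
    show "F holomorphic_on ball 0 1" unfolding F_def
      by (rule holomorphic_on_compose_gen[OF hm(1) T(1)]) (use mm in blast)
    show "F 0 = 0" using m0 inv(2)[of 0] by (simp add: F_def w_def)
    show "norm (F z) < 1" if "norm z < 1" for z using T(2)[of "m z"] mm(1)[of z] that by (simp add: F_def)
  qed
  have F': "F' holomorphic_on ball 0 1" "F' 0 = 0" "\<And>z. norm z < 1 \<Longrightarrow> norm (F' z) < 1"
  proof -
    show "F' holomorphic_on ball 0 1" unfolding F'_def
      by (rule holomorphic_on_compose_gen[OF T'(1) hm(2)]) (use T' in blast)
    show "F' 0 = 0" using m0 by (simp add: F'_def w_def)
    show "norm (F' z) < 1" if "norm z < 1" for z using T'(2)[of z] mm(2)[of "T' z"] that by (simp add: F'_def)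
  qed
  have F'F: "F' (F z) = z" if "norm z < 1" for z
    using that mm[of z] inv(1)[of "m z"] by (simp add: F_def F'_def)
  \<comment> \<open>The equality case of Schwarz's lemma asks for one nonzero point; 1/2 is an
    arbitrary choice.\<close>
  have "norm (F (1/2)) = norm (1/2 :: complex)"
  proof (rule antisym)
    show "norm (F (1/2)) \<le> norm (1/2 :: complex)" by (rule Schwarz_Lemma(1)[OF F]) auto
    have "norm (F' (F (1/2))) \<le> norm (F (1/2))" by (rule Schwarz_Lemma(1)[OF F']) (use F(3)[of "1/2"] in auto)
    then show "norm (1/2 :: complex) \<le> norm (F (1/2))" using F'F[of "1/2"] by simp
  qed
  then have "\<exists>z. norm z < 1 \<and> z \<noteq> 0 \<and> norm (F z) = norm z" by (intro exI[of _ "1/2"]) auto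
  then obtain c where c: "\<And>z. norm z < 1 \<Longrightarrow> F z = c * z" "norm c = 1"
    using Schwarz_Lemma(3)[OF F, of 0] by auto
  have "T z = disc_moebius c w z" if "z \<in> ball 0 1" for z
  proof -
    have "T z = F (m' z)" using mm(3)[OF that] by (simp add: F_def)
    also have "\<dots> = c * m' z" using c(1)[of "m' z"] mm(2)[OF that] by simp
    finally show ?thesis by (simp add: m'_def Moebius_function_simple disc_moebius_def)
  qed
  then show thesis using that c w by blast
qed

lemma disc_moebius_norm_le:
  assumes "norm c = 1" "norm w < 1" "norm z \<le> 1"
  shows "norm (disc_moebius c w z) \<le> 1"
proof -
  have nz: "1 - cnj w * z \<noteq> 0" using one_minus_cnj_mult_nonzero assms by blast
  have "(norm (1 - cnj w * z))\<^sup>2 - (norm (z - w))\<^sup>2 = (1 - (norm w)\<^sup>2) * (1 - (norm z)\<^sup>2)"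
    unfolding cmod_power2 by (simp add: power2_eq_square) (simp add: algebra_simps)
  moreover have "\<dots> \<ge> 0" using assms by (intro mult_nonneg_nonneg) (auto simp: power_le_one)
  ultimately have "(norm (z - w))\<^sup>2 \<le> (norm (1 - cnj w * z))\<^sup>2" by linarith
  then have "norm (z - w) \<le> norm (1 - cnj w * z)" by (rule power2_le_imp_le) simp
  then show ?thesis using nz assms(1) by (simp add: disc_moebius_def norm_divide norm_mult divide_le_eq)
qed

lemma continuous_on_disc_moebius:
  assumes "norm w < 1"
  shows "continuous_on (cball 0 1) (disc_moebius c w)"
  unfolding disc_moebius_def
  by (intro continuous_intros) (use one_minus_cnj_mult_nonzero assms in auto)

text \<open>Brouwer's theorem gives a fixed point in the closed disc, and none lies in the open
  one.\<close>

lemma disc_moebius_boundary_fixpoint: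
  assumes c: "norm c = 1" "norm w < 1" and nf: "\<And>z. z \<in> ball 0 1 \<Longrightarrow> disc_moebius c w z \<noteq> z"
  obtains \<beta> where "norm \<beta> = 1" "disc_moebius c w \<beta> = \<beta>"
proof -
  obtain \<beta> where \<beta>: "\<beta> \<in> cball 0 1" "disc_moebius c w \<beta> = \<beta>"
    using brouwer_ball[of 1 "0::complex" "disc_moebius c w"] continuous_on_disc_moebius[OF c(2)]
      disc_moebius_norm_le[OF c] by (metis mem_cball_0 zero_less_one Pi_I)
  then have "\<beta> \<notin> ball 0 1" using nf by blast
  then show thesis using \<beta> that by (simp add: antisym)
qed

text \<open>Mutually inverse Cayley transforms between the disc and the right half plane, with \<^term>\<open>\<beta>\<close> going to infinity.\<close>

definition cay :: "complex \<Rightarrow> complex \<Rightarrow> complex" where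
  "cay \<beta> z = (\<beta> + z) / (\<beta> - z)"

definition cayinv :: "complex \<Rightarrow> complex \<Rightarrow> complex" where
  "cayinv \<beta> y = \<beta> * (y - 1) / (y + 1)"

lemma norm_less_iff_Re_pos: "norm (y - 1) < norm (y + 1) \<longleftrightarrow> Re y > 0"
proof -
  have "norm (y - 1) < norm (y + 1) \<longleftrightarrow> (norm (y - 1))\<^sup>2 < (norm (y + 1))\<^sup>2"
    by (metis norm_ge_zero power2_less_imp_less power_strict_mono zero_less_numeral)
  also have "\<dots> \<longleftrightarrow> Re y > 0" unfolding cmod_power2 by (auto simp: power2_eq_square algebra_simps)
  finally show ?thesis .
qed

lemma cayinv_cay:
  assumes "norm \<beta> = 1" "z \<noteq> \<beta>"
  shows "cayinv \<beta> (cay \<beta> z) = z"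
proof -
  have n: "\<beta> - z \<noteq> 0" "\<beta> \<noteq> 0" using assms by auto
  have "cay \<beta> z - 1 = 2 * z / (\<beta> - z)" "cay \<beta> z + 1 = 2 * \<beta> / (\<beta> - z)"
    using n by (auto simp: cay_def field_simps)
  then show ?thesis using n by (simp add: cayinv_def)
qed

lemma cay_cayinv:
  assumes "norm \<beta> = 1" "y \<noteq> -1"
  shows "cay \<beta> (cayinv \<beta> y) = y"
proof -
  have n: "y + 1 \<noteq> 0" "\<beta> \<noteq> 0" using assms by (auto simp: add_eq_0_iff2)
  have "\<beta> + cayinv \<beta> y = 2 * \<beta> * y / (y + 1)" "\<beta> - cayinv \<beta> y = 2 * \<beta> / (y + 1)"
    using n by (auto simp: cayinv_def field_simps)
  then show ?thesis using n by (simp add: cay_def)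
qed

lemma cayinv_in_ball_iff:
  assumes "norm \<beta> = 1" "y \<noteq> -1"
  shows "cayinv \<beta> y \<in> ball 0 1 \<longleftrightarrow> Re y > 0"
proof -
  have "norm (y + 1) > 0" using assms by (simp add: add_eq_0_iff2)
  then show ?thesis
    using assms norm_less_iff_Re_pos[of y] by (simp add: cayinv_def norm_divide norm_mult)
qed

lemma Re_cay_pos:
  assumes "norm \<beta> = 1" "z \<in> ball 0 1"
  shows "Re (cay \<beta> z) > 0"
proof -
  have z: "z \<noteq> \<beta>" using assms by auto
  have "cay \<beta> z \<noteq> -1"
  proof
    assume "cay \<beta> z = -1"
    then have "\<beta> + z = - (\<beta> - z)" using z by (simp add: cay_def divide_eq_minus_1_iff)
    then show False using assms by auto
  qed
  then show ?thesis using cayinv_in_ball_iff[OF assms(1)] cayinv_cay[OF assms(1) z] assms(2) by metis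
qed

lemma cayinv_holomorphic: "cayinv \<beta> holomorphic_on {y. Re y > 0}"
  unfolding cayinv_def by (intro holomorphic_intros) (auto simp: add_eq_0_iff2)

lemma cayinv_ball: "norm \<beta> = 1 \<Longrightarrow> Re y > 0 \<Longrightarrow> cayinv \<beta> y \<in> ball 0 1"
  using cayinv_in_ball_iff[of \<beta> y] by (cases "y = -1") auto

lemma continuous_on_cayinv: "continuous_on {y. Re y > 0} (cayinv \<beta>)"
  using cayinv_holomorphic holomorphic_on_imp_continuous_on by blast

lemma cayinv_tendsto_infinity: "(cayinv \<beta> \<longlongrightarrow> \<beta>) at_infinity"
proof -
  have "((\<lambda>y. \<beta> - 2 * \<beta> / (y + 1)) \<longlongrightarrow> \<beta> - 0) at_infinity"
    by (intro tendsto_intros tendsto_divide_0[OF tendsto_const] tendsto_add_filterlim_at_infinity'[OF _ tendsto_const] filterlim_ident)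
  moreover have "\<forall>\<^sub>F y in at_infinity. \<beta> - 2 * \<beta> / (y + 1) = cayinv \<beta> y"
    unfolding eventually_at_infinity
  proof (intro exI[of _ 2] allI impI)
    fix y :: complex assume "norm y \<ge> 2"
    then have "y \<noteq> -1" by auto
    then have "y + 1 \<noteq> 0" by (simp add: add_eq_0_iff2)
    then show "\<beta> - 2 * \<beta> / (y + 1) = cayinv \<beta> y" by (simp add: cayinv_def field_simps)
  qed
  ultimately show ?thesis using Lim_transform_eventually by fastforce
qed

section \<open>Disc automorphisms as affine maps of the half plane, and their orbits\<close>

text \<open>An automorphism fixing \<open>\<beta>\<close> fixes infinity in the coordinate
  \<open>cay \<beta>\<close> and preserves the right half plane, so it is affine with positive
  factor and imaginary translation. The computation rests on
  \<open>cay \<beta> x = 2 * \<beta> / (\<beta> - x) - 1\<close>.\<close>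

lemma disc_moebius_cay:
  assumes c: "norm c = 1" "norm w < 1" and \<beta>: "norm \<beta> = 1" "disc_moebius c w \<beta> = \<beta>"
  obtains a b :: real where "a > 0"
    "\<And>z. z \<in> ball 0 1 \<Longrightarrow> cay \<beta> (disc_moebius c w z) = of_real a * cay \<beta> z + \<i> * of_real b"
proof -
  define E where "E = 1 - cnj w * \<beta>"
  define n where "n = 1 - (norm w)\<^sup>2"
  have n: "n > 0" using c by (simp add: n_def power_less_one_iff)
  have sq: "(of_real (norm x))\<^sup>2 = x * cnj x" for x using complex_norm_square[of x] by simp
  have nc: "of_real n = 1 - w * cnj w" by (simp add: n_def sq)
  have E0: "E \<noteq> 0" unfolding E_def using one_minus_cnj_mult_nonzero c \<beta> by simp
  have \<beta>0: "\<beta> \<noteq> 0" "\<beta> - w \<noteq> 0" using \<beta> c by auto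
  have \<beta>\<beta>: "\<beta> * cnj \<beta> = 1" using \<beta>(1) by (simp add: complex_norm_square[symmetric] flip: of_real_power)
  have cE: "c * (\<beta> - w) = \<beta> * E" using \<beta>(2) E0 by (simp add: disc_moebius_def E_def field_simps)
  have bw: "\<beta> - w = \<beta> * cnj E" unfolding E_def using \<beta>\<beta> by (simp add: algebra_simps)
  \<comment> \<open>The reciprocal of the derivative of the map at \<open>\<beta>\<close>. The
    constant \<open>d\<close> is what the computation leaves over.\<close>
  define a where "a = (norm E)\<^sup>2 / n"
  define d where "d = of_real a - 1 + 2 * (\<beta> - w) * cnj w / of_real n"
  have a: "a > 0" using E0 n by (simp add: a_def)
  have Red: "Re d = 0"
  proof -
    have "of_real n * d = E * cnj E - of_real n + 2 * (\<beta> - w) * cnj w"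
      using n by (simp add: d_def a_def sq field_simps)
    also have "\<dots> = (\<beta> * cnj w - cnj \<beta> * w) + cnj w * w * (\<beta> * cnj \<beta> - 1)"
      unfolding nc E_def by (simp add: algebra_simps)
    also have "\<dots> = \<beta> * cnj w - cnj (\<beta> * cnj w)" using \<beta>\<beta> by simp
    finally have "Re (of_real n * d) = Re (\<beta> * cnj w - cnj (\<beta> * cnj w))" by simp
    then have "n * Re d = 0" by simp
    then show ?thesis using n by simp
  qed
  have main: "cay \<beta> (disc_moebius c w z) = of_real a * cay \<beta> z + d" if z: "z \<in> ball 0 1" for z
  proof -
    define D where "D = 1 - cnj w * z"
    have D0: "D \<noteq> 0" unfolding D_def using one_minus_cnj_mult_nonzero c z by simp
    have bz: "\<beta> - z \<noteq> 0" using z \<beta> by auto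
    have D: "D = E + cnj w * (\<beta> - z)" by (simp add: D_def E_def algebra_simps)
    have c0: "c \<noteq> 0" using c by auto
    have n0: "of_real n \<noteq> (0::complex)" using n by simp
    have "\<beta> - disc_moebius c w z = disc_moebius c w \<beta> - disc_moebius c w z" using \<beta> by simp
    also have "\<dots> = c * ((\<beta> - w) * D - (z - w) * E) / (E * D)"
      unfolding disc_moebius_def D_def[symmetric] E_def[symmetric] using D0 E0 by (simp add: field_simps)
    also have "(\<beta> - w) * D - (z - w) * E = of_real n * (\<beta> - z)"
      unfolding D_def E_def nc by (simp add: algebra_simps)
    finally have diff: "\<beta> - disc_moebius c w z = c * (of_real n * (\<beta> - z)) / (E * D)" .
    have "2 * \<beta> / (\<beta> - disc_moebius c w z) = 2 * (\<beta> * E) * D / (c * of_real n * (\<beta> - z))"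
      unfolding diff using c0 n0 bz E0 D0 by (simp add: field_simps)
    also have "\<dots> = 2 * (\<beta> - w) * D / (of_real n * (\<beta> - z))"
      unfolding cE[symmetric] using c0 by simp
    also have "\<dots> = 2 * (\<beta> - w) * E / (of_real n * (\<beta> - z)) + 2 * (\<beta> - w) * cnj w / of_real n"
      unfolding D using n0 bz by (simp add: field_simps)
    also have "2 * (\<beta> - w) * E / (of_real n * (\<beta> - z)) = of_real a * (2 * \<beta> / (\<beta> - z))"
      unfolding bw using n0 bz by (simp add: a_def sq field_simps)
    finally have X: "2 * \<beta> / (\<beta> - disc_moebius c w z) = of_real a * (2 * \<beta> / (\<beta> - z)) + 2 * (\<beta> - w) * cnj w / of_real n" .
    have cayX: "cay \<beta> x = 2 * \<beta> / (\<beta> - x) - 1" if "\<beta> - x \<noteq> 0" for x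
      using that by (simp add: cay_def field_simps)
    have "\<beta> - disc_moebius c w z \<noteq> 0" unfolding diff using c0 n0 bz E0 D0 by simp
    then show ?thesis using X bz by (simp add: cayX d_def algebra_simps)
  qed
  have "d = \<i> * of_real (Im d)" using Red by (simp add: complex_eq_iff)
  then show thesis using that[OF a] main by metis
qed

lemma periodic_attains_bounds:
  fixes f :: "real \<Rightarrow> real"
  assumes f: "continuous_on UNIV f" "\<And>t. f (t + 1) = f t"
  obtains u v where "\<And>t. f u \<le> f t" "\<And>t. f t \<le> f v"
proof -
  have fn: "f (t + of_nat n) = f t" for t n
  proof (induction n)
    case (Suc n)
    then show ?case using f(2)[of "t + of_nat n"] by (simp add: algebra_simps)
  qed simp
  have fi: "f (frac t) = f t" for t
  proof (cases "t \<ge> 0")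
    case True
    then have "t = frac t + of_nat (nat \<lfloor>t\<rfloor>)" by (simp add: frac_def)
    then show ?thesis using fn by metis
  next
    case False
    then have "frac t = t + of_nat (nat (-\<lfloor>t\<rfloor>))" by (simp add: frac_def)
    then show ?thesis using fn by metis
  qed
  have c: "continuous_on {0..1} f" using f(1) by (rule continuous_on_subset) simp
  have "compact {0..1::real}" "{0..1::real} \<noteq> {}" by auto
  with c obtain u v where u: "\<And>t. t \<in> {0..1} \<Longrightarrow> f u \<le> f t" and v: "\<And>t. t \<in> {0..1} \<Longrightarrow> f t \<le> f v"
    by (metis continuous_attains_inf continuous_attains_sup)
  have "frac t \<in> {0..1}" for t :: real by (simp add: less_imp_le frac_lt_1)
  then show thesis using that[of u v] u v fi by metis
qed

text \<open>Subtracting \<open>\<i> * of_real (b * t)\<close> leaves a periodic, hence bounded,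
  function.\<close>

lemma translation_orbit_tends_to_infinity:
  fixes y :: "real \<Rightarrow> complex"
  assumes y: "continuous_on UNIV y" "\<And>t. y (t + 1) = y t + \<i> * of_real b" and b: "b \<noteq> 0"
  shows "filterlim y at_infinity at_top" "filterlim y at_infinity at_bot"
proof -
  define f where "f t = norm (y t - \<i> * of_real (b * t))" for t
  have "continuous_on UNIV f" unfolding f_def by (intro continuous_intros y)
  moreover have "f (t + 1) = f t" for t unfolding f_def y(2) by (simp add: algebra_simps)
  ultimately obtain v where v: "\<And>t. f t \<le> f v" using periodic_attains_bounds by metis
  have lb: "\<bar>b\<bar> * \<bar>t\<bar> - f v \<le> norm (y t)" for t
    using v[of t] norm_triangle_ineq2[of "\<i> * of_real (b * t)" "y t"] unfolding f_def
    by (simp add: norm_mult abs_mult norm_minus_commute)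
  have t1: "filterlim (\<lambda>t::real. \<bar>b\<bar> * \<bar>t\<bar> - f v) at_top at_top"
    "filterlim (\<lambda>t::real. \<bar>b\<bar> * \<bar>t\<bar> - f v) at_top at_bot"
    using b by real_asymp+
  show "filterlim y at_infinity at_top" "filterlim y at_infinity at_bot"
    using filterlim_at_top_mono[OF t1(1)] filterlim_at_top_mono[OF t1(2)] lb
    by (auto simp: filterlim_at_infinity_conv_norm_at_top)
qed

text \<open>\<open>norm (Z t) * a powr (- t)\<close> is periodic, so it stays between positive
  constants, and \<open>norm (Z t)\<close> grows and decays like \<open>a powr t\<close>.\<close>

lemma scaling_orbit_limits:
  fixes Z :: "real \<Rightarrow> complex"
  assumes Z: "continuous_on UNIV Z" "\<And>t. Z (t + 1) = of_real a * Z t" "\<And>t. Z t \<noteq> 0" and a: "a > 1"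
  shows "filterlim Z at_infinity at_top" "(Z \<longlongrightarrow> 0) at_bot"
proof -
  define f where "f t = norm (Z t) * a powr (- t)" for t
  have "continuous_on UNIV f" unfolding f_def using a by (intro continuous_intros Z) auto
  moreover have "f (t + 1) = f t" for t
    unfolding f_def Z(2) using a by (simp add: norm_mult powr_diff powr_minus field_simps powr_add)
  ultimately obtain u v where uv: "\<And>t. f u \<le> f t" "\<And>t. f t \<le> f v" using periodic_attains_bounds by metis
  have fu: "f u > 0" using a Z(3) by (simp add: f_def)
  have nZ: "norm (Z t) = f t * a powr t" for t using a by (simp add: f_def powr_minus field_simps)
  have lb: "f u * a powr t \<le> norm (Z t)" and ub: "norm (Z t) \<le> f v * a powr t" for t
    unfolding nZ using uv by (auto intro: mult_right_mono)
  have "filterlim (\<lambda>t. f u * a powr t) at_top at_top" using a fu by real_asymp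
  from filterlim_at_top_mono[OF this] lb show "filterlim Z at_infinity at_top"
    by (auto simp: filterlim_at_infinity_conv_norm_at_top)
  have "((\<lambda>t. f v * a powr t) \<longlongrightarrow> 0) at_bot" using a by real_asymp
  then show "(Z \<longlongrightarrow> 0) at_bot"
    by (rule Lim_null_comparison[rotated]) (use ub in auto)
qed

lemma line_completion:
  fixes s :: "real \<Rightarrow> complex"
  assumes s: "continuous_on UNIV s" "inj s"
    and lim: "(s \<longlongrightarrow> \<beta>0) at_bot" "(s \<longlongrightarrow> \<beta>1) at_top"
    and out: "\<beta>0 \<notin> range s" "\<beta>1 \<notin> range s"
  obtains \<gamma> where "path \<gamma>" "pathstart \<gamma> = \<beta>0" "pathfinish \<gamma> = \<beta>1"
    "path_image \<gamma> = insert \<beta>0 (insert \<beta>1 (range s))"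
    "path_image \<gamma> = closure (range s)" "\<beta>0 \<noteq> \<beta>1 \<Longrightarrow> arc \<gamma>" "\<beta>0 = \<beta>1 \<Longrightarrow> simple_path \<gamma>"
proof -
  \<comment> \<open>The logit map, an increasing bijection of the open unit interval onto the line,
    turns limits at infinity into limits at 0 and 1.\<close>
  define h where "h t = ln t - ln (1 - t)" for t :: real
  define S where "S t = s (h t)" for t
  have him: "h ` {0<..<1} = UNIV"
  proof -
    have "x = h (1 / (1 + exp (-x)))" for x :: real
    proof -
      have p: "1 + exp (-x) > 0" by (simp add: add_pos_pos)
      have "1 - 1 / (1 + exp (-x)) = exp (-x) / (1 + exp (-x))" using p by (simp add: field_simps)
      then show ?thesis using p unfolding h_def by (simp add: ln_div)
    qed
    moreover have "1 / (1 + exp (-x)) \<in> {0<..<1}" for x :: real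
      by (simp add: add_pos_pos)
    ultimately show ?thesis by (metis UNIV_eq_I imageI)
  qed
  have injh: "inj_on h {0<..<1}"
  proof (rule strict_mono_on_imp_inj_on)
    show "strict_mono_on {0<..<1} h"
      by (rule strict_mono_onI) (auto simp: h_def intro!: diff_strict_mono)
  qed
  have imS: "S ` {0<..<1} = range s" unfolding S_def him[symmetric] by (simp add: image_image)
  have hr: "filterlim h at_bot (at_right 0)" unfolding h_def by real_asymp
  have hl: "filterlim h at_top (at_left 1)" unfolding h_def by real_asymp
  obtain \<gamma> where "path \<gamma>" "\<gamma> 0 = \<beta>0" "\<gamma> 1 = \<beta>1" "\<And>t. 0 < t \<Longrightarrow> t < 1 \<Longrightarrow> \<gamma> t = S t"
    "path_image \<gamma> = insert \<beta>0 (insert \<beta>1 (S ` {0<..<1}))"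
    "path_image \<gamma> = closure (S ` {0<..<1})" "\<beta>0 \<noteq> \<beta>1 \<Longrightarrow> arc \<gamma>" "\<beta>0 = \<beta>1 \<Longrightarrow> simple_path \<gamma>"
  proof (rule path_completion[of S \<beta>0 \<beta>1])
    have "continuous_on {0<..<1} h" unfolding h_def by (intro continuous_intros) auto
    then show "continuous_on {0<..<1} S" unfolding S_def
      by (rule continuous_on_compose2[OF s(1)]) simp
    show "inj_on S {0<..<1}" unfolding S_def[abs_def]
      using comp_inj_on[OF injh inj_on_subset[OF s(2) subset_UNIV]] by (simp add: comp_def)
    show "(S \<longlongrightarrow> \<beta>0) (at_right 0)" unfolding S_def[abs_def] by (rule filterlim_compose[OF lim(1) hr])
    show "(S \<longlongrightarrow> \<beta>1) (at_left 1)" unfolding S_def[abs_def] by (rule filterlim_compose[OF lim(2) hl])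
    show "\<beta>0 \<notin> S ` {0<..<1}" "\<beta>1 \<notin> S ` {0<..<1}" using imS out by auto
  qed (rule that)
  then show thesis using that[of \<gamma>] unfolding imS by (simp add: pathstart_def pathfinish_def)
qed

lemma vertical_period_int:
  fixes f :: "complex \<Rightarrow> complex"
  assumes per: "\<And>y. Re y > 0 \<Longrightarrow> f (y + \<i> * of_real b) = f y" and y: "Re y > 0"
  shows "f (y + \<i> * of_real (of_int n * b)) = f y"
proof (induction n rule: int_induct[where k = 0])
  case (step1 i)
  have "f (y + \<i> * of_real (of_int (i + 1) * b)) = f ((y + \<i> * of_real (of_int i * b)) + \<i> * of_real b)"
    by (simp add: algebra_simps)
  also have "\<dots> = f (y + \<i> * of_real (of_int i * b))" using y by (intro per) simp
  finally show ?case using step1 by simp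
next
  case (step2 i)
  have "f (y + \<i> * of_real (of_int i * b)) = f ((y + \<i> * of_real (of_int (i - 1) * b)) + \<i> * of_real b)"
    by (simp add: algebra_simps)
  also have "\<dots> = f (y + \<i> * of_real (of_int (i - 1) * b))" using y by (intro per) simp
  finally show ?case using step2 by simp
qed simp

text \<open>In the coordinate \<open>exp (- 2 * pi * y / b)\<close> this is removability of the
  puncture 0. The argument is direct: Cauchy's inequality makes the oscillation over one period of
  order \<open>1 / Re y\<close>, so a sequence of vertical lines carries values near
  \<open>q\<close>, and the maximum principle spreads this to the strips between such lines.\<close>

lemma vertical_periodic_limit:
  fixes f :: "complex \<Rightarrow> complex"
  assumes f: "f holomorphic_on {y. Re y > 0}" "\<And>y. Re y > 0 \<Longrightarrow> norm (f y) \<le> M"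
    and nc: "\<not> f constant_on {y. Re y > 0}"
    and per: "\<And>y. Re y > 0 \<Longrightarrow> f (y + \<i> * of_real b) = f y" and b: "b > 0"
  obtains q where "\<And>\<epsilon>. \<epsilon> > 0 \<Longrightarrow> \<exists>x0>0. \<forall>y. Re y > x0 \<longrightarrow> dist (f y) q < \<epsilon>"
proof -
  define H where "H = {y::complex. Re y > 0}"
  have opH: "open H" unfolding H_def by (rule open_halfspace_Re_gt)
  have convH: "convex H" unfolding H_def by (rule convex_halfspace_Re_gt)
  have M: "M \<ge> 0" using f(2)[of 1] norm_ge_zero[of "f 1"] by (simp del: norm_ge_zero)
  have contf: "continuous_on H f" unfolding H_def using f(1) holomorphic_on_imp_continuous_on by blast
  have pern: "f (y + \<i> * of_real (of_int n * b)) = f y" if "Re y > 0" for y n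
    using vertical_period_int[of f b y n] per that by blast
  have red: "\<exists>y'. Re y' = Re y \<and> 0 \<le> Im y' \<and> Im y' \<le> b \<and> f y' = f y" if "Re y > 0" for y
  proof -
    define n where "n = - \<lfloor>Im y / b\<rfloor>"
    have "of_int \<lfloor>Im y / b\<rfloor> * b \<le> Im y" "Im y \<le> (of_int \<lfloor>Im y / b\<rfloor> + 1) * b"
      using floor_divide_lower[OF b, of "Im y"] floor_divide_upper[OF b, of "Im y"] by auto
    then show ?thesis
      using pern[OF that, of n] by (intro exI[of _ "y + \<i> * of_real (of_int n * b)"]) (auto simp: n_def algebra_simps)
  qed
  have der: "norm (deriv f y) \<le> 2 * M / Re y" if y: "Re y > 0" for y
  proof -
    have sub: "cball y (Re y / 2) \<subseteq> H"
    proof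
      fix z assume "z \<in> cball y (Re y / 2)"
      then have "\<bar>Re (y - z)\<bar> \<le> Re y / 2" using abs_Re_le_cmod[of "y - z"] by (simp add: dist_norm)
      then have "Re z \<ge> Re y / 2" unfolding abs_le_iff by simp
      then show "z \<in> H" using y by (simp add: H_def)
    qed
    have "norm ((deriv ^^ 1) f y) \<le> fact 1 * M / (Re y / 2) ^ 1"
    proof (rule Cauchy_inequality)
      show "f holomorphic_on ball y (Re y / 2)"
        using f(1) sub ball_subset_cball holomorphic_on_subset unfolding H_def by blast
      show "continuous_on (cball y (Re y / 2)) f" using contf sub continuous_on_subset by blast
      show "norm (f x) \<le> M" if "norm (y - x) = Re y / 2" for x
      proof -
        have "x \<in> H" using sub that by (auto simp: dist_norm)
        then show ?thesis using f(2) by (simp add: H_def)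
      qed
    qed (use y in auto)
    then show ?thesis by (simp add: mult.commute)
  qed
  have osc: "dist (f y) (f (of_real (Re y))) \<le> 2 * M * b / Re y" if y: "Re y > 0" "0 \<le> Im y" "Im y \<le> b" for y
  proof -
    define L where "L = {z. Re z = Re y}"
    have "norm (f y - f (of_real (Re y))) \<le> (2 * M / Re y) * norm (y - of_real (Re y))"
    proof (rule field_differentiable_bound[where S = L])
      have "convex ({z. Re z \<le> Re y} \<inter> {z. Re z \<ge> Re y})"
        by (intro convex_Int convex_halfspace_Re_le convex_halfspace_Re_ge)
      moreover have "{z. Re z \<le> Re y} \<inter> {z. Re z \<ge> Re y} = L" by (auto simp: L_def)
      ultimately show "convex L" by simp
      show "(f has_field_derivative deriv f z) (at z within L)" if "z \<in> L" for z
      proof -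
        have "z \<in> H" using that y by (simp add: L_def H_def)
        then have "(f has_field_derivative deriv f z) (at z)"
          using holomorphic_derivI[OF f(1)] opH unfolding H_def by blast
        then show ?thesis by (rule has_field_derivative_at_within)
      qed
      show "norm (deriv f z) \<le> 2 * M / Re y" if "z \<in> L" for z
        using der[of z] that y by (simp add: L_def)
    qed (auto simp: L_def)
    also have "norm (y - of_real (Re y)) = Im y" using y by (simp add: cmod_def)
    also have "2 * M / Re y * Im y \<le> 2 * M / Re y * b" using y M by (intro mult_left_mono) auto
    finally show ?thesis by (simp add: dist_norm)
  qed
  define u where "u n = f (of_nat (Suc n))" for n
  have "compact (cball (0::complex) M)" by simp
  moreover have "\<forall>n. u n \<in> cball 0 M" using f(2) by (auto simp: u_def simp del: of_nat_Suc)
  ultimately obtain q r where r: "strict_mono (r::nat\<Rightarrow>nat)" "(u \<circ> r) \<longlonglongrightarrow> q"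
    unfolding compact_def by meson
  define x where "x n = real (Suc (r n))" for n
  have x: "x n > 0" "real n < x n" for n using seq_suble[OF r(1), of n] by (auto simp: x_def)
  show thesis
  proof (rule that[of q])
    fix \<epsilon> :: real assume \<epsilon>: "\<epsilon> > 0"
    from tendstoD[OF r(2), of "\<epsilon>/2"] \<epsilon> obtain N1 where N1: "\<And>n. n \<ge> N1 \<Longrightarrow> dist (f (of_real (x n))) q < \<epsilon>/2"
      unfolding eventually_sequentially by (auto simp: x_def u_def)
    obtain N2 :: nat where N2: "2 * M * b * 2 / \<epsilon> < real N2" using reals_Archimedean2 by blast
    have line: "dist (f y) q < \<epsilon>" if n: "n \<ge> max N1 N2" and y: "Re y = x n" "0 \<le> Im y" "Im y \<le> b" for n y
    proof -
      have "2 * M * b * 2 / \<epsilon> < x n" using N2 x(2)[of n] n by linarith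
      then have "2 * M * b / x n < \<epsilon> / 2" using \<epsilon> x(1)[of n] by (simp add: field_simps)
      then have "dist (f y) (f (of_real (x n))) < \<epsilon>/2" using osc[of y] y x(1)[of n] by simp
      then show ?thesis using N1[of n] n dist_triangle[of "f y" q "f (of_real (x n))"] by simp
    qed
    define n0 where "n0 = max N1 N2"
    have "dist (f y) q < \<epsilon>" if y: "Re y > x n0" for y
    proof -
      obtain k :: nat where k: "Re y < real k" using reals_Archimedean2 by blast
      define n1 where "n1 = max n0 k"
      have n1: "Re y < x n1" "n1 \<ge> n0" using k x(2)[of n1] by (auto simp: n1_def)
      \<comment> \<open>By periodicity the supremum over the whole strip is attained in this compact
        box of height one period.\<close>
      define Q where "Q = cbox (Complex (x n0) 0) (Complex (x n1) b)"
      define S where "S = {z. x n0 < Re z \<and> Re z < x n1}"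
      have QH: "Q \<subseteq> H" using x(1)[of n0] by (auto simp: Q_def H_def in_cbox_complex_iff)
      have "continuous_on Q (\<lambda>z. dist (f z) q)"
        using contf QH by (intro continuous_intros) (auto intro: continuous_on_subset)
      moreover have "compact Q" by (simp add: Q_def)
      moreover have "Complex (x n0) 0 \<in> Q" using y n1 b by (simp add: Q_def in_cbox_complex_iff)
      then have "Q \<noteq> {}" by blast
      ultimately obtain m where m: "m \<in> Q" "\<And>z. z \<in> Q \<Longrightarrow> dist (f z) q \<le> dist (f m) q"
        using continuous_attains_sup by meson
      have strip: "dist (f z) q \<le> dist (f m) q" if "x n0 \<le> Re z" "Re z \<le> x n1" for z
      proof -
        have "Re z > 0" using that x(1)[of n0] by simp
        from red[OF this] obtain z' where z': "Re z' = Re z" "0 \<le> Im z'" "Im z' \<le> b" "f z' = f z" by blast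
        then have "z' \<in> Q" using that by (simp add: Q_def in_cbox_complex_iff)
        then show ?thesis using m(2)[of z'] z' by simp
      qed
      have mQ: "x n0 \<le> Re m" "Re m \<le> x n1" "0 \<le> Im m" "Im m \<le> b" using m(1) by (auto simp: Q_def in_cbox_complex_iff)
      \<comment> \<open>An interior maximum of the distance to \<open>q\<close> contradicts openness
        of \<open>f\<close>, so the maximum is on one of the two bounding lines, where it is
        small.\<close>
      have "\<not> (x n0 < Re m \<and> Re m < x n1)"
      proof
        assume "x n0 < Re m \<and> Re m < x n1"
        then have mS: "m \<in> S" by (simp add: S_def)
        have opS: "open S" unfolding S_def by (intro open_Collect_conj open_Collect_less continuous_intros)
        have SH: "S \<subseteq> H" using x(1)[of n0] by (auto simp: S_def H_def)
        have "open (f ` S)"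
          using open_mapping_thm[OF _ opH convex_connected[OF convH] opS SH] f(1) nc by (simp add: H_def)
        moreover have "f ` S \<subseteq> cball q (dist (f m) q)"
        proof
          fix v assume "v \<in> f ` S"
          then obtain z where "z \<in> S" "v = f z" by blast
          then show "v \<in> cball q (dist (f m) q)" using strip[of z] by (simp add: S_def dist_commute)
        qed
        ultimately have "f ` S \<subseteq> ball q (dist (f m) q)"
          by (metis interior_cball interior_maximal)
        then show False using mS by (auto simp: dist_commute)
      qed
      then have "Re m = x n0 \<or> Re m = x n1" using mQ by auto
      then have "dist (f m) q < \<epsilon>" using line[of n0 m] line[of n1 m] mQ n1(2) by (auto simp: n0_def)
      then show ?thesis using strip[of y] y n1 by simp
    qed
    then show "\<exists>x0>0. \<forall>y. Re y > x0 \<longrightarrow> dist (f y) q < \<epsilon>" using x(1) by blast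
  qed
qed

text \<open>
  The invariance moves the positive real axis into a compact box around the axis of the hyperbolic map.
\<close>

lemma scaling_invariant_compact_values:
  fixes f :: "complex \<Rightarrow> complex"
  assumes f: "continuous_on {y. Re y > 0} f" "\<And>y. Re y > 0 \<Longrightarrow> f y \<in> \<Omega>"
    and a: "a > 0" "a \<noteq> 1" and inv: "\<And>y. Re y > 0 \<Longrightarrow> f (of_real a * y + \<i> * of_real b) = f y"
  obtains K where "compact K" "K \<subseteq> \<Omega>" "\<And>x. x \<ge> 1 \<Longrightarrow> f (of_real x) \<in> K"
proof -
  \<comment> \<open>\<open>\<i> * of_real y0\<close> is the finite fixed point of the affine map;
    centred there, the map is multiplication by \<open>a\<close>.\<close>
  define y0 where "y0 = b / (1 - a)"
  have y0: "a * y0 + b = y0" using a by (simp add: y0_def field_simps)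
  define G where "G z = f (\<i> * of_real y0 + z)" for z
  have Ga: "G (of_real a * z) = G z" if "Re z > 0" for z
  proof -
    have "\<i> * of_real (a * y0 + b) + of_real a * z = of_real a * (\<i> * of_real y0 + z) + \<i> * of_real b"
      by (simp add: algebra_simps)
    then show ?thesis using inv[of "\<i> * of_real y0 + z"] that unfolding G_def y0 by simp
  qed
  \<comment> \<open>If necessary the map is replaced by its inverse, so that the factor exceeds
    1.\<close>
  define A where "A = max a (1 / a)"
  have A: "A > 1" using a by (cases "a > 1") (auto simp: A_def less_max_iff_disj)
  have GA: "G (z / of_real A) = G z" if "Re z > 0" for z
  proof (cases "a > 1")
    case True
    then have "1 / a < a" by (smt (verit) divide_less_eq_1)
    then have "A = a" by (simp add: A_def)
    then show ?thesis using Ga[of "z / of_real a"] that a by simp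
  next
    case False
    then have "a < 1" using a by simp
    then have "a < 1 / a" using a by (smt (verit) less_divide_eq_1_pos)
    then have "A = 1 / a" by (simp add: A_def)
    then show ?thesis using Ga[of z] that by (simp add: mult.commute)
  qed
  have GAn: "G (z / of_real (A ^ n)) = G z" if "Re z > 0" for z n
  proof (induction n)
    case (Suc n)
    have "Re (z / of_real (A ^ n)) > 0" using that A by simp
    from GA[OF this] Suc show ?case by (simp add: mult.commute)
  qed simp
  define B where "B = cbox (Complex 1 (-\<bar>y0\<bar>)) (Complex A \<bar>y0\<bar>)"
  have Bpos: "Re z > 0" if "z \<in> B" for z using that by (auto simp: B_def in_cbox_complex_iff)
  show thesis
  proof (rule that[of "G ` B"])
    show "compact (G ` B)"
    proof (rule compact_continuous_image)
      show "continuous_on B G" unfolding G_def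
        by (rule continuous_on_compose2[OF f(1)]) (auto intro!: continuous_intros dest: Bpos)
    qed (simp add: B_def)
    show "G ` B \<subseteq> \<Omega>" using f(2) Bpos by (auto simp: G_def)
    fix x :: real assume x: "x \<ge> 1"
    obtain n where "x < A ^ n" using real_arch_pow[OF A] by blast
    define k where "k = (LEAST n. x < A ^ n)"
    have k: "x < A ^ k" "\<And>j. j < k \<Longrightarrow> \<not> x < A ^ j"
      unfolding k_def using LeastI[of "\<lambda>n. x < A ^ n", OF \<open>x < A ^ n\<close>] not_less_Least by blast+
    have "k \<noteq> 0" using k(1) x by (cases k) auto
    then obtain j where j: "k = Suc j" by (cases k) auto
    have jx: "A ^ j \<le> x" "x < A * A ^ j" using k(1) k(2)[of j] j by auto
    have A1: "A ^ j \<ge> 1" using A by simp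
    \<comment> \<open>Dividing by the largest power of \<open>A\<close> not above \<open>x\<close>
      brings the real part between 1 and \<open>A\<close>, while the imaginary part only
      shrinks.\<close>
    define z where "z = (of_real x - \<i> * of_real y0) / of_real (A ^ j)"
    have "Re z = x / A ^ j" "Im z = - y0 / A ^ j" by (auto simp: z_def)
    moreover have "1 \<le> x / A ^ j" "x / A ^ j \<le> A" using jx A1 by (auto simp: field_simps)
    moreover have "\<bar>- y0 / A ^ j\<bar> \<le> \<bar>y0\<bar>"
      using A1 mult_left_mono[OF A1, of "\<bar>y0\<bar>"] by (simp add: abs_divide divide_le_eq)
    then have "- \<bar>y0\<bar> \<le> - y0 / A ^ j" "- y0 / A ^ j \<le> \<bar>y0\<bar>" by linarith+
    ultimately have "z \<in> B" by (simp add: B_def in_cbox_complex_iff)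
    moreover have "G z = f (of_real x)"
      using GAn[of "of_real x - \<i> * of_real y0" j] x unfolding z_def by (simp add: G_def)
    ultimately show "f (of_real x) \<in> G ` B" by (metis imageI)
  qed
qed

text \<open>The ends depend on the transformation alone: the last clause concerns every curve
  \<open>s\<close> equivariant under it, because the same limits are later used for a curve pushed
  towards the puncture. For \<open>a = 1\<close> both ends are \<open>\<beta>\<close>; otherwise
  they are the two fixed points on the circle.\<close>

lemma moebius_orbit_limits:
  assumes c: "norm c = 1" "norm w < 1" and nf: "\<And>z. z \<in> ball 0 1 \<Longrightarrow> disc_moebius c w z \<noteq> z"
    and \<beta>: "norm \<beta> = 1" and a: "a > 0"
    and cay: "\<And>z. z \<in> ball 0 1 \<Longrightarrow> cay \<beta> (disc_moebius c w z) = of_real a * cay \<beta> z + \<i> * of_real b"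
    and MB: "\<And>z. z \<in> ball 0 1 \<Longrightarrow> disc_moebius c w z \<in> ball 0 1"
  obtains \<beta>0 \<beta>1 where "norm \<beta>0 = 1" "norm \<beta>1 = 1" "\<beta>0 = \<beta>1 \<longleftrightarrow> a = 1" "a = 1 \<Longrightarrow> \<beta>0 = \<beta> \<and> b \<noteq> 0"
    "\<And>s :: real \<Rightarrow> complex. continuous_on UNIV s \<Longrightarrow> range s \<subseteq> ball 0 1 \<Longrightarrow> (\<And>t. s (t + 1) = disc_moebius c w (s t))
      \<Longrightarrow> (s \<longlongrightarrow> \<beta>0) at_bot \<and> (s \<longlongrightarrow> \<beta>1) at_top"
proof -
  have \<beta>nb: "z \<noteq> \<beta>" if "z \<in> ball 0 1" for z using that \<beta> by auto
  have ycont: "continuous_on UNIV (\<lambda>t. cay \<beta> (s t))" if "continuous_on UNIV s" "range s \<subseteq> ball 0 1" for s :: "real \<Rightarrow> complex"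
    unfolding cay_def using that \<beta>nb by (intro continuous_intros) (auto simp: image_subset_iff)
  have cay_back: "cayinv \<beta> (cay \<beta> (s t)) = s t" if "range s \<subseteq> ball 0 1" for s :: "real \<Rightarrow> complex" and t
    using cayinv_cay[OF \<beta>] \<beta>nb that by (metis rangeI subsetD)
  show thesis
  proof (cases "a = 1")
    case True
    have b: "b \<noteq> 0"
    proof
      assume "b = 0"
      then have "cay \<beta> (disc_moebius c w 0) = cay \<beta> 0" using cay[of 0] True by simp
      then have "disc_moebius c w 0 = 0" using cayinv_cay[OF \<beta>] \<beta>nb MB[of 0] by (metis centre_in_ball zero_less_one)
      then show False using nf[of 0] by simp
    qed
    show thesis
    proof (rule that[of \<beta> \<beta>])
      fix s :: "real \<Rightarrow> complex" assume s: "continuous_on UNIV s" "range s \<subseteq> ball 0 1" "\<And>t. s (t + 1) = disc_moebius c w (s t)"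
      have "cay \<beta> (s (t + 1)) = cay \<beta> (s t) + \<i> * of_real b" for t
        using cay[of "s t"] s(2) True unfolding s(3) by (simp add: image_subset_iff)
      note tr = translation_orbit_tends_to_infinity[OF ycont[OF s(1,2)] this b]
      have "((\<lambda>t. cayinv \<beta> (cay \<beta> (s t))) \<longlongrightarrow> \<beta>) at_bot" "((\<lambda>t. cayinv \<beta> (cay \<beta> (s t))) \<longlongrightarrow> \<beta>) at_top"
        using filterlim_compose[OF cayinv_tendsto_infinity tr(2)] filterlim_compose[OF cayinv_tendsto_infinity tr(1)] by auto
      then show "(s \<longlongrightarrow> \<beta>) at_bot \<and> (s \<longlongrightarrow> \<beta>) at_top" using cay_back[OF s(2)] by simp
    qed (use \<beta> True b in auto)
  next
    case False
    \<comment> \<open>The second fixed point in the half plane coordinate lies on the imaginary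
      axis; \<open>cayinv \<beta>\<close> carries it to the circle.\<close>
    define y0 where "y0 = b / (1 - a)"
    have y0: "a * y0 + b = y0" using False by (simp add: y0_def field_simps)
    define \<beta>' where "\<beta>' = cayinv \<beta> (\<i> * of_real y0)"
    have i1: "\<i> * of_real y0 + 1 \<noteq> 0" by (simp add: complex_eq_iff)
    have n\<beta>': "norm \<beta>' = 1"
    proof -
      have "norm (\<i> * of_real y0 - 1) = norm (\<i> * of_real y0 + 1)" by (simp add: cmod_def)
      then show ?thesis using i1 \<beta> by (simp add: \<beta>'_def cayinv_def norm_divide norm_mult)
    qed
    have ne: "\<beta>' \<noteq> \<beta>"
    proof
      assume "\<beta>' = \<beta>"
      then have "\<beta> * (\<i> * of_real y0 - 1) = \<beta> * (\<i> * of_real y0 + 1)"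
        using i1 unfolding \<beta>'_def cayinv_def by (simp only: divide_eq_eq split: if_splits)
      then show False using \<beta> by auto
    qed
    have Zprops: "continuous_on UNIV (\<lambda>t. cay \<beta> (s t) - \<i> * of_real y0)"
      "\<And>t. cay \<beta> (s t) - \<i> * of_real y0 \<noteq> 0"
      "\<And>t. cay \<beta> (s (t + 1)) - \<i> * of_real y0 = of_real a * (cay \<beta> (s t) - \<i> * of_real y0)"
      if s: "continuous_on UNIV s" "range s \<subseteq> ball 0 1" "\<And>t. s (t + 1) = disc_moebius c w (s t)" for s :: "real \<Rightarrow> complex"
    proof -
      show "continuous_on UNIV (\<lambda>t. cay \<beta> (s t) - \<i> * of_real y0)" by (intro continuous_on_diff continuous_on_const ycont[OF s(1,2)])
      fix t
      have st: "s t \<in> ball 0 1" using s by blast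
      have "Re (cay \<beta> (s t) - \<i> * of_real y0) > 0" using Re_cay_pos[OF \<beta> st] by simp
      then show "cay \<beta> (s t) - \<i> * of_real y0 \<noteq> 0" by force
      have "cay \<beta> (s (t + 1)) - \<i> * of_real (a * y0 + b) = of_real a * (cay \<beta> (s t) - \<i> * of_real y0)"
        using cay[OF st] s(3)[of t] by (simp add: algebra_simps)
      then show "cay \<beta> (s (t + 1)) - \<i> * of_real y0 = of_real a * (cay \<beta> (s t) - \<i> * of_real y0)"
        unfolding y0 .
    qed
    have inf: "(s \<longlongrightarrow> \<beta>) F" if "filterlim (\<lambda>t. cay \<beta> (s t) - \<i> * of_real y0) at_infinity F" "range s \<subseteq> ball 0 1"
      for s :: "real \<Rightarrow> complex" and F
    proof -
      have "filterlim (\<lambda>t. (cay \<beta> (s t) - \<i> * of_real y0) + \<i> * of_real y0) at_infinity F"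
        by (rule tendsto_add_filterlim_at_infinity'[OF that(1) tendsto_const])
      then have "filterlim (\<lambda>t. cay \<beta> (s t)) at_infinity F" by simp
      from filterlim_compose[OF cayinv_tendsto_infinity[of \<beta>] this] show ?thesis using cay_back[OF that(2)] by simp
    qed
    have zero: "(s \<longlongrightarrow> \<beta>') F" if "((\<lambda>t. cay \<beta> (s t) - \<i> * of_real y0) \<longlongrightarrow> 0) F" "range s \<subseteq> ball 0 1"
      for s :: "real \<Rightarrow> complex" and F
    proof -
      have "((\<lambda>t. cay \<beta> (s t)) \<longlongrightarrow> \<i> * of_real y0) F" using that(1) by (simp add: LIM_zero_iff)
      then have "((\<lambda>t. cayinv \<beta> (cay \<beta> (s t))) \<longlongrightarrow> \<beta>') F"
        unfolding \<beta>'_def cayinv_def using i1 by (intro tendsto_intros)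
      then show ?thesis using cay_back[OF that(2)] by simp
    qed
    show thesis
    proof (cases "a > 1")
      case True
      show thesis
      proof (rule that[of \<beta>' \<beta>])
        fix s :: "real \<Rightarrow> complex" assume s: "continuous_on UNIV s" "range s \<subseteq> ball 0 1" "\<And>t. s (t + 1) = disc_moebius c w (s t)"
        note Z = scaling_orbit_limits[OF Zprops(1)[OF s] Zprops(3)[OF s] Zprops(2)[OF s] True]
        then show "(s \<longlongrightarrow> \<beta>') at_bot \<and> (s \<longlongrightarrow> \<beta>) at_top" using inf zero s by blast
      qed (use \<beta> n\<beta>' ne False in auto)
    next
      case F2: False
      then have a1: "1 / a > 1" using a False by simp
      show thesis
      proof (rule that[of \<beta> \<beta>'])
        fix s :: "real \<Rightarrow> complex" assume s: "continuous_on UNIV s" "range s \<subseteq> ball 0 1" "\<And>t. s (t + 1) = disc_moebius c w (s t)"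
        \<comment> \<open>For \<open>a < 1\<close> time is reversed, which replaces the factor by
          \<open>1 / a\<close> and exchanges the ends.\<close>
        define Y where "Y t = cay \<beta> (s t) - \<i> * of_real y0" for t
        have "filterlim (\<lambda>t. Y (-t)) at_infinity at_top \<and> ((\<lambda>t. Y (-t)) \<longlongrightarrow> 0) at_bot"
        proof -
          have "continuous_on UNIV (\<lambda>t. Y (-t))" unfolding Y_def
            by (rule continuous_on_compose2[OF Zprops(1)[OF s]]) (auto intro!: continuous_intros)
          moreover have "Y (- (t + 1)) = of_real (1 / a) * Y (-t)" for t
            using Zprops(3)[OF s, of "- (t + 1)"] a by (simp add: Y_def)
          moreover have "Y (-t) \<noteq> 0" for t unfolding Y_def by (rule Zprops(2)[OF s])
          ultimately show ?thesis using scaling_orbit_limits[of "\<lambda>t. Y (-t)" "1/a"] a1 by blast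
        qed
        then have "filterlim Y at_infinity at_bot" "(Y \<longlongrightarrow> 0) at_top"
          unfolding filterlim_at_bot_mirror[of Y] filterlim_at_top_mirror[of Y] by blast+
        then show "(s \<longlongrightarrow> \<beta>) at_bot \<and> (s \<longlongrightarrow> \<beta>') at_top" using inf zero s unfolding Y_def by blast
      qed (use \<beta> n\<beta>' ne False in auto)
    qed
  qed
qed

section \<open>Curves inside the domain\<close>

text \<open>At an end \<open>s t\<close> and \<open>s (t + 1)\<close> share their limit, and the
  transformation is continuous up to the circle.\<close>

lemma moebius_limit_fixed:
  fixes s :: "real \<Rightarrow> complex"
  assumes c: "norm w < 1" and \<beta>: "norm \<beta> = 1" and s: "range s \<subseteq> ball 0 1" "\<And>t. s (t + 1) = disc_moebius c w (s t)"
    and lim: "(s \<longlongrightarrow> \<beta>) at_top \<or> (s \<longlongrightarrow> \<beta>) at_bot"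
  shows "disc_moebius c w \<beta> = \<beta>"
proof -
  have "\<exists>F::real filter. F \<noteq> bot \<and> (s \<longlongrightarrow> \<beta>) F \<and> filterlim (\<lambda>t. t + 1) F F"
    using lim
  proof
    assume "(s \<longlongrightarrow> \<beta>) at_top"
    moreover have "filterlim (\<lambda>t::real. t + 1) at_top at_top" by real_asymp
    ultimately show ?thesis using trivial_limit_at_top_linorder by blast
  next
    assume "(s \<longlongrightarrow> \<beta>) at_bot"
    moreover have "filterlim (\<lambda>t::real. t + 1) at_bot at_bot" by real_asymp
    ultimately show ?thesis using trivial_limit_at_bot_linorder by blast
  qed
  then obtain F :: "real filter" where F: "F \<noteq> bot" "(s \<longlongrightarrow> \<beta>) F" "filterlim (\<lambda>t. t + 1) F F" by blast
  have "((\<lambda>t. s (t + 1)) \<longlongrightarrow> \<beta>) F" by (rule filterlim_compose[OF F(2,3)])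
  moreover have "((\<lambda>t. disc_moebius c w (s t)) \<longlongrightarrow> disc_moebius c w \<beta>) F"
    unfolding disc_moebius_def
    using one_minus_cnj_mult_nonzero[OF c, of \<beta>] \<beta> by (intro tendsto_intros F(2)) auto
  ultimately show ?thesis using tendsto_unique[OF F(1)] unfolding s(2) by blast
qed

text \<open>The half plane to the right of \<open>m\<close> corresponds to a horodisc, a ball
  tangent to the circle at \<open>\<beta>\<close>. In this form \<open>inside_subset_ball\<close>
  shows that a region enclosed by a curve in the closed horodisc stays in it.\<close>

lemma horodisc_eq_cball:
  assumes \<beta>: "norm \<beta> = 1" and m: "m > 0" and z: "z \<in> ball 0 1"
  shows "m \<le> Re (cay \<beta> z) \<longleftrightarrow> z \<in> cball (\<beta> * of_real (m / (1 + m))) (1 / (1 + m))"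
proof -
  define y where "y = cay \<beta> z"
  have zb: "z \<noteq> \<beta>" using z \<beta> by auto
  have y: "Re y > 0" unfolding y_def by (rule Re_cay_pos[OF \<beta> z])
  have y1: "y + 1 \<noteq> 0" using y by (auto simp: complex_eq_iff)
  have m1: "of_real (1 + m) \<noteq> (0::complex)" using m by (simp del: of_real_add)
  have "z = cayinv \<beta> y" unfolding y_def using cayinv_cay[OF \<beta> zb] by simp
  then have "z - \<beta> * of_real (m / (1 + m)) = \<beta> * (y - 1) / (y + 1) - \<beta> * of_real m / of_real (1 + m)"
    by (simp add: cayinv_def)
  also have "\<dots> = \<beta> * (y - of_real (1 + 2 * m)) / ((y + 1) * of_real (1 + m))"
    using y1 m1 by (simp add: field_simps)
  finally have "dist z (\<beta> * of_real (m / (1 + m))) = norm (y - of_real (1 + 2 * m)) / (norm (y + 1) * (1 + m))"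
    using \<beta> m by (simp add: dist_norm norm_mult norm_divide del: of_real_add of_real_mult of_real_divide)
  then have "z \<in> cball (\<beta> * of_real (m / (1 + m))) (1 / (1 + m)) \<longleftrightarrow> norm (y - of_real (1 + 2 * m)) \<le> norm (y + 1)"
  proof -
    have ny: "norm (y + 1) > 0" using y1 by simp
    have "A / (n * k) \<le> 1 / k \<longleftrightarrow> A \<le> n" if "k > 0" "n > 0" for A n k :: real
      using that by (simp add: pos_divide_le_eq)
    from this[of "1 + m", OF _ ny] m have "norm (y - of_real (1 + 2 * m)) / (norm (y + 1) * (1 + m)) \<le> 1 / (1 + m)
        \<longleftrightarrow> norm (y - of_real (1 + 2 * m)) \<le> norm (y + 1)" by simp
    then show ?thesis using \<open>dist z _ = _\<close> by (simp add: dist_commute)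
  qed
  also have "\<dots> \<longleftrightarrow> (norm (y - of_real (1 + 2 * m)))\<^sup>2 \<le> (norm (y + 1))\<^sup>2"
    by (metis abs_norm_cancel abs_le_square_iff)
  also have "\<dots> \<longleftrightarrow> 0 \<le> 4 * (1 + m) * (Re y - m)"
    unfolding cmod_power2 by (simp add: power2_eq_square algebra_simps)
  also have "\<dots> \<longleftrightarrow> m \<le> Re y" using m by (simp add: zero_le_mult_iff)
  finally show ?thesis by (simp add: y_def)
qed

section \<open>Deck transformations\<close>

context disc_covering
begin

text \<open>\<open>\<phi>\<close> is lifted through itself in both directions between
  \<open>z0\<close> and \<open>z1\<close>. Uniqueness of lifts makes the two lifts inverse to each
  other; it also excludes fixed points, since a lift with one is the identity.\<close>

lemma deck_moebius:
  assumes z: "z0 \<in> ball 0 1" "z1 \<in> ball 0 1" "\<phi> z0 = \<phi> z1" "z0 \<noteq> z1"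
  obtains c w where "norm c = 1" "norm w < 1" "\<And>z. z \<in> ball 0 1 \<Longrightarrow> disc_moebius c w z \<in> ball 0 1"
    "\<And>z. z \<in> ball 0 1 \<Longrightarrow> \<phi> (disc_moebius c w z) = \<phi> z" "\<And>z. z \<in> ball 0 1 \<Longrightarrow> disc_moebius c w z \<noteq> z"
    "disc_moebius c w z0 = z1"
proof -
  have T: "\<exists>T. T holomorphic_on ball 0 1 \<and> (\<forall>z\<in>ball 0 1. T z \<in> ball 0 1) \<and> T u = v \<and> (\<forall>z\<in>ball 0 1. \<phi> (T z) = \<phi> z)"
    if uv: "u \<in> ball 0 1" "v \<in> ball 0 1" "\<phi> u = \<phi> v" for u v
  proof -
    obtain T where T: "continuous_on (ball 0 1) T" "\<And>x. x \<in> ball 0 1 \<Longrightarrow> T x \<in> ball 0 1" "T u = v"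
        "\<And>x. x \<in> ball 0 1 \<Longrightarrow> \<phi> (T x) = \<phi> x"
      using lift[OF convex_ball uv(1,2) cont in_domain uv(3)] by metis
    moreover have "T holomorphic_on ball 0 1"
      by (rule covering_space_lift_is_holomorphic[OF cov open_ball hol hol]) (use T in_domain in auto)
    ultimately show ?thesis by blast
  qed
  obtain T where T: "T holomorphic_on ball 0 1" "\<And>z. z \<in> ball 0 1 \<Longrightarrow> T z \<in> ball 0 1" "T z0 = z1"
      "\<And>z. z \<in> ball 0 1 \<Longrightarrow> \<phi> (T z) = \<phi> z"
    using T[OF z(1-3)] by blast
  obtain T' where T': "T' holomorphic_on ball 0 1" "\<And>z. z \<in> ball 0 1 \<Longrightarrow> T' z \<in> ball 0 1" "T' z1 = z0"
      "\<And>z. z \<in> ball 0 1 \<Longrightarrow> \<phi> (T' z) = \<phi> z"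
    using \<open>\<And>v u. \<lbrakk>u \<in> ball 0 1; v \<in> ball 0 1; \<phi> u = \<phi> v\<rbrakk> \<Longrightarrow> _\<close>[OF z(2,1) z(3)[symmetric]] by blast
  have cT: "continuous_on (ball 0 1) T" "continuous_on (ball 0 1) T'"
    using T T' holomorphic_on_imp_continuous_on by blast+
  have comp: "continuous_on (ball 0 1) (\<lambda>z. T' (T z))" "continuous_on (ball 0 1) (\<lambda>z. T (T' z))"
    using continuous_on_compose2[OF cT(2) cT(1)] continuous_on_compose2[OF cT(1) cT(2)] T(2) T'(2) by blast+
  have inv1: "T' (T z) = z" if "z \<in> ball 0 1" for z
    by (rule lift_unique[where U = "ball 0 1" and a = z0 and ?g1.0 = "\<lambda>z. T' (T z)" and ?g2.0 = "\<lambda>z. z"])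
      (use T T' z that comp in auto)
  have inv2: "T (T' z) = z" if "z \<in> ball 0 1" for z
    by (rule lift_unique[where U = "ball 0 1" and a = z1 and ?g1.0 = "\<lambda>z. T (T' z)" and ?g2.0 = "\<lambda>z. z"])
      (use T T' z that comp in auto)
  have nf: "T u \<noteq> u" if "u \<in> ball 0 1" for u
  proof
    assume Tu: "T u = u"
    have "T z0 = z0"
    proof (rule lift_unique[where U = "ball 0 1" and a = u and ?g1.0 = T and ?g2.0 = "\<lambda>z. z"])
      show "continuous_on (ball 0 1) T" by (rule cT)
      show "T x \<in> ball 0 1" "\<phi> (T x) = \<phi> x" if "x \<in> ball 0 1" for x using T(2,4) that by blast+
    qed (use Tu z(1) that in auto)
    then show False using T(3) z(4) by simp
  qed
  obtain c w where cw: "norm c = 1" "norm w < 1" "\<And>z. z \<in> ball 0 1 \<Longrightarrow> T z = disc_moebius c w z"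
    using disc_automorphism_eq_moebius[OF T(1,2) T'(1,2) inv1 inv2] by metis
  show thesis
    by (rule that[OF cw(1,2)]) (use cw(3) T nf z in metis)+
qed

lemma cay_invariance:
  assumes \<beta>: "norm \<beta> = 1"
    and cay: "\<And>z. z \<in> ball 0 1 \<Longrightarrow> cay \<beta> (disc_moebius c w z) = of_real a * cay \<beta> z + \<i> * of_real b"
    and M: "\<And>z. z \<in> ball 0 1 \<Longrightarrow> disc_moebius c w z \<in> ball 0 1" "\<And>z. z \<in> ball 0 1 \<Longrightarrow> \<phi> (disc_moebius c w z) = \<phi> z"
    and y: "Re y > 0"
  shows "\<phi> (cayinv \<beta> (of_real a * y + \<i> * of_real b)) = \<phi> (cayinv \<beta> y)"
proof -
  have y1: "y \<noteq> -1" using y by auto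
  define z where "z = cayinv \<beta> y"
  have z: "z \<in> ball 0 1" unfolding z_def using cayinv_in_ball_iff[OF \<beta> y1] y by simp
  have "cay \<beta> z = y" unfolding z_def by (rule cay_cayinv[OF \<beta> y1])
  then have "cayinv \<beta> (of_real a * y + \<i> * of_real b) = cayinv \<beta> (cay \<beta> (disc_moebius c w z))" using cay[OF z] by simp
  also have "\<dots> = disc_moebius c w z" using M(1)[OF z] \<beta> by (intro cayinv_cay) auto
  finally show ?thesis using M(2)[OF z] by (simp add: z_def)
qed

text \<open>In the coordinate \<open>cay \<alpha>\<close> the radius runs along the real axis from 1
  to infinity, where the invariance keeps the values of \<open>\<phi>\<close> in a compact subset of
  \<open>\<Omega>\<close>.\<close>

lemma hyperbolic_fixpoint_radial_limit:
  assumes \<alpha>: "norm \<alpha> = 1" and rad: "((\<lambda>r::real. \<phi> (of_real r * \<alpha>)) \<longlongrightarrow> p) (at_left 1)"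
    and a: "a > 0" "a \<noteq> 1"
    and inv: "\<And>y. Re y > 0 \<Longrightarrow> \<phi> (cayinv \<alpha> (of_real a * y + \<i> * of_real b)) = \<phi> (cayinv \<alpha> y)"
  shows "p \<in> \<Omega>"
proof -
  have cont': "continuous_on {y. Re y > 0} (\<lambda>y. \<phi> (cayinv \<alpha> y))"
    by (rule continuous_on_compose2[OF cont continuous_on_cayinv]) (use cayinv_ball[OF \<alpha>] in auto)
  have dom: "\<phi> (cayinv \<alpha> y) \<in> \<Omega>" if "Re y > 0" for y using in_domain cayinv_ball[OF \<alpha> that] by blast
  obtain K where K: "compact K" "K \<subseteq> \<Omega>" "\<And>x. x \<ge> 1 \<Longrightarrow> \<phi> (cayinv \<alpha> (of_real x)) \<in> K"
    using scaling_invariant_compact_values[OF cont' dom a inv] by metis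
  have "\<phi> (of_real r * \<alpha>) \<in> K" if r: "0 < r" "r < 1" for r
  proof -
    have c: "cay \<alpha> (of_real r * \<alpha>) = of_real ((1 + r) / (1 - r))"
    proof -
      have "\<alpha> \<noteq> 0" using \<alpha> by auto
      have "cay \<alpha> (of_real r * \<alpha>) = (\<alpha> * (1 + of_real r)) / (\<alpha> * (1 - of_real r))"
        by (simp add: cay_def algebra_simps)
      also have "\<dots> = (1 + of_real r) / (1 - of_real r)" using \<open>\<alpha> \<noteq> 0\<close> by simp
      finally show ?thesis by simp
    qed
    have "of_real r * \<alpha> \<noteq> \<alpha>" using r \<alpha> by auto
    then have "of_real r * \<alpha> = cayinv \<alpha> (of_real ((1 + r) / (1 - r)))"
      using cayinv_cay[OF \<alpha>] c by metis
    moreover have "(1 + r) / (1 - r) \<ge> 1" using r by (simp add: field_simps)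
    ultimately show ?thesis using K(3) by metis
  qed
  then have "\<forall>\<^sub>F r in at_left 1. \<phi> (of_real r * \<alpha>) \<in> K"
    unfolding eventually_at_left_field by (intro exI[of _ 0]) auto
  then have "p \<in> K"
    using Lim_in_closed_set[OF compact_imp_closed[OF K(1)] _ _ rad] by simp
  then show ?thesis using K(2) by blast
qed

end

context disc_covering_curve
begin

lemma interior_curve_lift:
  assumes full: "path_image g \<subseteq> \<Omega>" and C: "C \<in> components (ball 0 1 \<inter> \<phi> -` path_image g)" and z: "z \<in> C"
  obtains s t0 where "continuous_on UNIV s" "range s = C" "inj s" "\<And>t. s t \<in> ball 0 1" "\<And>t. \<phi> (s t) = e t" "s t0 = z"
proof -
  have Cz: "C = connected_component_set (ball 0 1 \<inter> \<phi> -` path_image g) z"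
    using C z unfolding components_def using connected_component_eq by blast
  have zb: "z \<in> ball 0 1" "\<phi> z \<in> path_image g" using in_components_subset[OF C] z by auto
  then obtain t where t: "\<phi> z = e t" using e_range by auto
  have et: "e t \<in> \<Omega>" using t in_domain[OF zb(1)] by simp
  obtain s where s: "continuous_on (param_component t) s" "\<And>x. x \<in> param_component t \<Longrightarrow> s x \<in> ball 0 1"
    "s t = z" "\<And>x. x \<in> param_component t \<Longrightarrow> \<phi> (s x) = e x"
    using lift_param[OF zb(1) t] by metis
  have "C = s ` param_component t"
    unfolding Cz by (rule component_eq_lift_image[OF zb(1) t s])
  moreover have "inj_on s (param_component t)" by (rule lift_injective[OF et s(1,2,4)])
  moreover note U = param_component_UNIV[OF full, of t]
  ultimately show thesis using that[of s t] s unfolding U by blast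
qed

text \<open>Taken to be the deck transformation from \<open>s 0\<close> to \<open>s 1\<close>; by
  uniqueness of lifts it shifts the whole curve by one period.\<close>

lemma interior_curve_deck:
  assumes s: "continuous_on UNIV s" "inj s" "\<And>t. s t \<in> ball 0 1" "\<And>t. \<phi> (s t) = e t"
  obtains c w where "norm c = 1" "norm w < 1" "\<And>z. z \<in> ball 0 1 \<Longrightarrow> disc_moebius c w z \<in> ball 0 1"
    "\<And>z. z \<in> ball 0 1 \<Longrightarrow> \<phi> (disc_moebius c w z) = \<phi> z" "\<And>z. z \<in> ball 0 1 \<Longrightarrow> disc_moebius c w z \<noteq> z"
    "\<And>t. s (t + 1) = disc_moebius c w (s t)"
proof -
  have e1: "e (t + 1) = e t" for t using e_periodic[of t 1] by simp
  have "s 0 \<noteq> s 1" using s(2) by (auto dest: injD)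
  moreover have "\<phi> (s 0) = \<phi> (s 1)" using s(4) e1[of 0] by simp
  ultimately obtain c w where cw: "norm c = 1" "norm w < 1" "\<And>z. z \<in> ball 0 1 \<Longrightarrow> disc_moebius c w z \<in> ball 0 1"
    "\<And>z. z \<in> ball 0 1 \<Longrightarrow> \<phi> (disc_moebius c w z) = \<phi> z" "\<And>z. z \<in> ball 0 1 \<Longrightarrow> disc_moebius c w z \<noteq> z"
    "disc_moebius c w (s 0) = s 1"
    using deck_moebius[OF s(3) s(3), of 0 1] by metis
  have "s (t + 1) = disc_moebius c w (s t)" for t
  proof (rule lift_unique[where U = UNIV and a = 0 and ?g1.0 = "\<lambda>t. s (t + 1)" and ?g2.0 = "\<lambda>t. disc_moebius c w (s t)"])
    show "continuous_on UNIV (\<lambda>t. s (t + 1))"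
      by (rule continuous_on_compose2[OF s(1)]) (auto intro!: continuous_intros)
    have sub: "range s \<subseteq> cball 0 1" using s(3) by (auto simp: less_imp_le image_subset_iff)
    show "continuous_on UNIV (\<lambda>t. disc_moebius c w (s t))"
      by (rule continuous_on_compose2[OF continuous_on_disc_moebius[OF cw(2)] s(1) sub])
    show "\<phi> (s (t + 1)) = \<phi> (disc_moebius c w (s t))" for t
      using s(4)[of "t + 1"] s(4)[of t] cw(4)[OF s(3)] e1[of t] by simp
  qed (use s(3) cw in auto)
  then show thesis using that[OF cw(1-5)] by blast
qed

text \<open>
  The image under \<^term>\<open>\<phi>\<close> of the region cut off by an invariant curve of a parabolic deck transformation has
  its boundary in the curve together with the limit \<^term>\<open>q\<close> of \<^term>\<open>\<phi>\<close> along horodiscs. Boundary sequences tending to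
  the fixed point are first moved by the deck group into a fundamental strip.
\<close>

lemma parabolic_isolated:
  assumes \<beta>: "norm \<beta> = 1" and b: "b \<noteq> 0"
    and s: "continuous_on UNIV s" "\<And>t. s t \<in> ball 0 1" "\<And>t. \<phi> (s t) = e t"
    and cay: "\<And>t. cay \<beta> (s (t + 1)) = cay \<beta> (s t) + \<i> * of_real b"
    and inv: "\<And>y. Re y > 0 \<Longrightarrow> \<phi> (cayinv \<beta> (y + \<i> * of_real b)) = \<phi> (cayinv \<beta> y)"
    and \<gamma>: "simple_path \<gamma>" "pathfinish \<gamma> = pathstart \<gamma>" "path_image \<gamma> = insert \<beta> (range s)"
  shows "\<not> p islimpt frontier \<Omega>"
proof -
  define f where "f y = \<phi> (cayinv \<beta> y)" for y
  have sb: "range s \<subseteq> ball 0 1" using s(2) by auto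
  have nb: "z \<noteq> \<beta>" if "z \<in> ball 0 1" for z using that \<beta> by auto
  have cc: "cayinv \<beta> (cay \<beta> z) = z" if "z \<in> ball 0 1" for z using cayinv_cay[OF \<beta> nb[OF that]] .
  have cc': "cay \<beta> (cayinv \<beta> y) = y" if "Re y > 0" for y using that by (intro cay_cayinv[OF \<beta>]) auto
  have Rc: "Re (cay \<beta> z) > 0" if "z \<in> ball 0 1" for z by (rule Re_cay_pos[OF \<beta> that])
  have perf: "f (y + \<i> * of_real (of_int n * b)) = f y" if "Re y > 0" for y n
    by (rule vertical_period_int[OF _ that]) (use inv in \<open>simp add: f_def\<close>)
  \<comment> \<open>The sign of \<open>b\<close> is not known; \<open>B\<close> is the positive
    generator of the same group of translations.\<close>
  define B where "B = \<bar>b\<bar>"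
  have B: "B > 0" using b by (simp add: B_def)
  have Bint: "\<exists>j::int. of_int n * B = of_int j * b" for n :: int
    using b by (cases "b > 0") (auto simp: B_def intro: exI[of _ n] exI[of _ "-n"])
  have perB: "f (y + \<i> * of_real (of_int n * B)) = f y" if "Re y > 0" for y n
    using Bint[of n] perf[OF that] by metis
  have cayn: "\<exists>t'. s t' = cayinv \<beta> (cay \<beta> (s t) + \<i> * of_real (of_int n * b))" for t n
  proof -
    have up: "cay \<beta> (s (t + of_nat k)) = cay \<beta> (s t) + \<i> * of_real (of_nat k * b)" for t and k :: nat
    proof (induction k)
      case (Suc k)
      then show ?case using cay[of "t + of_nat k"] by (simp add: algebra_simps)
    qed simp
    show ?thesis
    proof (cases "n \<ge> 0")
      case True
      then have "cay \<beta> (s (t + of_nat (nat n))) = cay \<beta> (s t) + \<i> * of_real (of_int n * b)" using up[of t "nat n"] by simp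
      then show ?thesis using cc[OF s(2)] by metis
    next
      case False
      then have "cay \<beta> (s t) = cay \<beta> (s (t - of_nat (nat (-n)))) - \<i> * of_real (of_int n * b)"
        using up[of "t - of_nat (nat (-n))" "nat (-n)"] by simp
      then have "cay \<beta> (s (t - of_nat (nat (-n)))) = cay \<beta> (s t) + \<i> * of_real (of_int n * b)" by simp
      then show ?thesis using cc[OF s(2)] by metis
    qed
  qed
  have caynB: "\<exists>t'. s t' = cayinv \<beta> (cay \<beta> (s t) + \<i> * of_real (of_int n * B))" for t n
    using Bint[of n] cayn by metis
  obtain M where M: "\<And>z. z \<in> ball 0 1 \<Longrightarrow> norm (\<phi> z) \<le> M" using norm_bound by blast
  have holf: "f holomorphic_on {y. Re y > 0}" unfolding f_def
    by (rule holomorphic_on_compose_gen[OF cayinv_holomorphic hol, unfolded o_def]) (use cayinv_ball[OF \<beta>] in blast)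
  have contf: "continuous_on {y. Re y > 0} f" using holf holomorphic_on_imp_continuous_on by blast
  obtain q where q: "\<And>\<epsilon>. \<epsilon> > 0 \<Longrightarrow> \<exists>x0>0. \<forall>y. Re y > x0 \<longrightarrow> dist (f y) q < \<epsilon>"
  proof (rule vertical_periodic_limit[OF holf _ _ _ B])
    show "norm (f y) \<le> M" if "Re y > 0" for y unfolding f_def using M cayinv_ball[OF \<beta> that] by blast
    show "\<not> f constant_on {y. Re y > 0}"
    proof
      assume "f constant_on {y. Re y > 0}"
      then obtain k where k: "\<And>y. Re y > 0 \<Longrightarrow> f y = k" unfolding constant_on_def by blast
      have "\<phi> z = k" if "z \<in> ball 0 1" for z
        using k[OF Rc[OF that]] cc[OF that] by (simp add: f_def)
      then show False using nonconstant unfolding constant_on_def by blast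
    qed
    show "f (y + \<i> * of_real B) = f y" if "Re y > 0" for y using perB[OF that, of 1] by simp
  qed (rule that)
  \<comment> \<open>The real part along the curve is positive and periodic, so the curve stays in a
    closed horodisc; hence so does the enclosed region \<open>V\<close>.\<close>
  obtain m where m: "m > 0" "\<And>t. m \<le> Re (cay \<beta> (s t))"
  proof -
    have "continuous_on UNIV (\<lambda>t. Re (cay \<beta> (s t)))"
      unfolding cay_def using nb[OF s(2)] by (intro continuous_intros s(1)) auto
    moreover have "Re (cay \<beta> (s (t + 1))) = Re (cay \<beta> (s t))" for t by (simp add: cay)
    ultimately obtain u where "\<And>t. Re (cay \<beta> (s u)) \<le> Re (cay \<beta> (s t))"
      using periodic_attains_bounds[of "\<lambda>t. Re (cay \<beta> (s t))"] by metis
    then show thesis using that[of "Re (cay \<beta> (s u))"] Rc[OF s(2)] by blast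
  qed
  define V where "V = inside (path_image \<gamma>)"
  note J = Jordan_inside_outside[OF \<gamma>(1,2), folded V_def]
  have cl: "closed (path_image \<gamma>)" using \<gamma>(1) by (simp add: closed_path_image simple_path_imp_path)
  have g1: "path_image \<gamma> \<subseteq> cball 0 1" using \<gamma>(3) sb \<beta> by (auto simp: less_imp_le subset_iff)
  have V1: "V \<subseteq> ball 0 1" unfolding V_def by (rule inside_subset_ball[OF g1 cl])
  have Vm: "m \<le> Re (cay \<beta> z)" if "z \<in> V" for z
  proof -
    have "path_image \<gamma> \<subseteq> cball (\<beta> * of_real (m / (1 + m))) (1 / (1 + m))"
    proof -
      have "dist (\<beta> * of_real (m / (1 + m))) \<beta> = norm (\<beta> * of_real (m / (1 + m) - 1))"
        by (simp add: dist_norm algebra_simps)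
      also have "\<dots> = \<bar>m / (1 + m) - 1\<bar>" using \<beta> by (simp only: norm_mult norm_of_real) simp
      also have "m / (1 + m) - 1 = - (1 / (1 + m))" using m by (simp add: field_simps)
      finally have "\<beta> \<in> cball (\<beta> * of_real (m / (1 + m))) (1 / (1 + m))" using m by simp
      moreover have "s t \<in> cball (\<beta> * of_real (m / (1 + m))) (1 / (1 + m))" for t
        using horodisc_eq_cball[OF \<beta> m(1) s(2)] m(2) by blast
      ultimately show ?thesis using \<gamma>(3) by auto
    qed
    then have "V \<subseteq> ball (\<beta> * of_real (m / (1 + m))) (1 / (1 + m))"
      unfolding V_def by (rule inside_subset_ball[OF _ cl])
    then have "z \<in> cball (\<beta> * of_real (m / (1 + m))) (1 / (1 + m))" using that ball_subset_cball by blast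
    then show ?thesis using horodisc_eq_cball[OF \<beta> m(1)] V1 that by blast
  qed
  have sub: "inside (path_image g) - {q} \<subseteq> \<phi> ` V"
    unfolding V_def
  proof (rule Jordan_inside_subset_image_inside[OF g \<gamma>(1,2) g1 hol nonconstant])
    show "bounded (\<phi> ` ball 0 1)" by (simp add: image bounded_domain)
    fix u z y
    assume u: "\<And>n::nat. u n \<in> inside (path_image \<gamma>)" "u \<longlonglongrightarrow> z" "z \<in> path_image \<gamma>"
      "(\<lambda>n. \<phi> (u n)) \<longlonglongrightarrow> y" "y \<notin> \<phi> ` inside (path_image \<gamma>)"
    have uV: "u n \<in> V" "u n \<in> ball 0 1" for n using u(1)[of n] V1 by (auto simp: V_def)
    have Sin: "\<phi> v \<in> path_image g" if "v \<in> range s" for v using that s(3) e_range by auto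
    show "y \<in> insert q (path_image g)"
    proof (cases "z = \<beta> \<and> y \<noteq> q")
      case False
      then show ?thesis using cluster_value_interior[OF _ u(2,4)] u(3) \<gamma>(3) sb Sin by blast
    next
      case True
      \<comment> \<open>Here the sequence tends to \<open>\<beta>\<close> although its values tend
        to a point other than \<open>q\<close>. From some index on its real parts in the half plane
        lie between \<open>m\<close> and \<open>x0\<close>, and translations bring it into the
        compact box \<open>Q\<close>.\<close>
      define d where "d = dist y q / 2"
      have d: "d > 0" using True by (simp add: d_def)
      obtain x0 where x0: "x0 > 0" "\<And>y. Re y > x0 \<Longrightarrow> dist (f y) q < d" using q[OF d] by blast
      obtain N where N: "\<And>n. n \<ge> N \<Longrightarrow> dist (\<phi> (u n)) y < d"
        using tendstoD[OF u(4) d] unfolding eventually_sequentially by blast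
      have fu: "f (cay \<beta> (u n)) = \<phi> (u n)" for n by (simp add: f_def cc[OF uV(2)])
      have Rx: "Re (cay \<beta> (u n)) \<le> x0" if "n \<ge> N" for n
      proof (rule ccontr)
        assume "\<not> Re (cay \<beta> (u n)) \<le> x0"
        then have "dist (\<phi> (u n)) q < d" using x0(2)[of "cay \<beta> (u n)"] fu by simp
        then show False using N[OF that] dist_triangle2[of y q "\<phi> (u n)"] by (simp add: d_def dist_commute)
      qed
      define k where "k n = - \<lfloor>Im (cay \<beta> (u n)) / B\<rfloor>" for n
      define Y where "Y n = cay \<beta> (u n) + \<i> * of_real (of_int (k n) * B)" for n
      define Q where "Q = cbox (Complex m 0) (Complex x0 B)"
      have YQ: "Y (n + N) \<in> Q" for n
      proof -
        have "of_int \<lfloor>Im x / B\<rfloor> * B \<le> Im x" "Im x \<le> (of_int \<lfloor>Im x / B\<rfloor> + 1) * B" for x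
          using floor_divide_lower[OF B, of "Im x"] floor_divide_upper[OF B, of "Im x"] by auto
        from this[of "cay \<beta> (u (n + N))"] show ?thesis
          using Vm[OF uV(1), of "n + N"] Rx[of "n + N"]
          by (simp add: Q_def in_cbox_complex_iff Y_def k_def algebra_simps)
      qed
      have "compact Q" by (simp add: Q_def)
      with YQ obtain Y0 r where r: "Y0 \<in> Q" "strict_mono (r::nat\<Rightarrow>nat)" "((\<lambda>n. Y (n + N)) \<circ> r) \<longlonglongrightarrow> Y0"
        unfolding compact_def by meson
      have Y0: "Re Y0 > 0" using r(1) m(1) by (simp add: Q_def in_cbox_complex_iff)
      define v where "v = cayinv \<beta> Y0"
      define i where "i n = r n + N" for n
      have Ylim: "(\<lambda>n. Y (i n)) \<longlonglongrightarrow> Y0" using r(3) by (simp add: o_def i_def)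
      have v1: "v \<in> ball 0 1" unfolding v_def by (rule cayinv_ball[OF \<beta> Y0])
      have "isCont (cayinv \<beta>) Y0"
        using continuous_on_cayinv Y0 by (simp add: continuous_on_eq_continuous_at open_halfspace_Re_gt)
      then have vlim: "(\<lambda>n. cayinv \<beta> (Y (i n))) \<longlonglongrightarrow> v" unfolding v_def using Ylim isCont_tendsto_compose by blast
      have fY: "\<phi> (cayinv \<beta> (Y n)) = \<phi> (u n)" for n
        using perB[OF Rc[OF uV(2)], of n "k n"] fu[of n] by (simp add: f_def Y_def)
      have "(\<lambda>n. \<phi> (u (i n))) \<longlonglongrightarrow> y"
      proof -
        have "strict_mono i" using r(2) by (simp add: i_def strict_mono_def)
        then show ?thesis using LIMSEQ_subseq_LIMSEQ[OF u(4)] by (simp add: o_def)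
      qed
      then have yv: "y = \<phi> v" using cluster_value_interior[OF v1 vlim] fY by simp
      show ?thesis
      proof (cases "v \<in> range s")
        case True then show ?thesis using yv Sin by blast
      next
        case False
        then have "v \<in> ball 0 1 - path_image \<gamma>" using v1 \<gamma>(3) nb by auto
        moreover have "open (ball 0 1 - path_image \<gamma>)" using cl by (simp add: open_Diff)
        ultimately obtain \<rho> where \<rho>: "\<rho> > 0" "ball v \<rho> \<subseteq> ball 0 1 - path_image \<gamma>" by (meson openE)
        from tendstoD[OF vlim \<rho>(1)] obtain n where n: "cayinv \<beta> (Y (i n)) \<in> ball v \<rho>"
          unfolding eventually_sequentially by (auto simp: dist_commute)
        define K where "K = k (i n)"
        \<comment> \<open>\<open>\<tau>\<close> undoes the translation used for the index
          \<open>i n\<close>. It takes a disc around \<open>v\<close> off the curve to a connected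
          set off the curve that contains \<open>u (i n)\<close>, hence into \<open>V\<close>; so
          \<open>y = \<phi> (\<tau> v)\<close> would be a value on \<open>V\<close>, which
          \<open>u(5)\<close> excludes.\<close>
        define \<tau> where "\<tau> x = cayinv \<beta> (cay \<beta> x + \<i> * of_real (of_int (- K) * B))" for x
        have \<tau>b: "\<tau> x \<in> ball 0 1" if "x \<in> ball 0 1" for x
          unfolding \<tau>_def using Rc[OF that] by (intro cayinv_ball[OF \<beta>]) simp
        have \<tau>C: "x \<in> range s" if x: "x \<in> ball 0 1" "\<tau> x \<in> range s" for x
        proof -
          obtain t where t: "\<tau> x = s t" using x(2) by blast
          have "cay \<beta> (\<tau> x) = cay \<beta> x + \<i> * of_real (of_int (- K) * B)"
            unfolding \<tau>_def using Rc[OF x(1)] by (intro cc') simp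
          then have "cay \<beta> x = cay \<beta> (s t) + \<i> * of_real (of_int K * B)" using t by simp
          then show ?thesis using caynB[of t K] cc[OF x(1)] by (metis rangeI)
        qed
        have "connected (\<tau> ` ball v \<rho>)"
        proof (rule connected_continuous_image)
          have "\<beta> - x \<noteq> 0" if "x \<in> ball v \<rho>" for x using nb[of x] \<rho>(2) that by auto
          then have "continuous_on (ball v \<rho>) (cay \<beta>)" unfolding cay_def
            by (intro continuous_intros) blast
          then have "continuous_on (ball v \<rho>) (\<lambda>x. cay \<beta> x + \<i> * of_real (of_int (- K) * B))"
            by (intro continuous_intros)
          then show "continuous_on (ball v \<rho>) \<tau>" unfolding \<tau>_def
            by (rule continuous_on_compose2[OF continuous_on_cayinv]) (use \<rho>(2) Rc in auto)
        qed simp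
        moreover have "\<tau> ` ball v \<rho> \<inter> frontier V = {}"
        proof -
          have "\<tau> x \<notin> path_image \<gamma>" if "x \<in> ball v \<rho>" for x
            using that \<rho>(2) \<tau>b[of x] \<tau>C[of x] nb \<gamma>(3) by blast
          moreover have "frontier V = path_image \<gamma>" using J by (simp add: V_def)
          ultimately show ?thesis by blast
        qed
        moreover have "u (i n) \<in> \<tau> ` ball v \<rho>"
        proof -
          have "Re (Y (i n)) > 0" using Rc[OF uV(2), of "i n"] by (simp add: Y_def)
          then have "\<tau> (cayinv \<beta> (Y (i n))) = cayinv \<beta> (cay \<beta> (u (i n)))"
            unfolding \<tau>_def by (simp add: cc') (simp add: Y_def K_def)
          then show ?thesis using n cc[OF uV(2)] by (metis imageI)
        qed
        ultimately have "\<tau> ` ball v \<rho> \<subseteq> V"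
          using connected_Int_frontier[of "\<tau> ` ball v \<rho>" V] uV(1)[of "i n"] by blast
        then have "\<tau> v \<in> V" using \<rho>(1) by auto
        moreover have "\<phi> (\<tau> v) = \<phi> v"
          using perB[OF Rc[OF v1], of "-K"] cc[OF v1] by (simp add: f_def \<tau>_def)
        ultimately have "y \<in> \<phi> ` V" using yv by (metis imageI)
        then show ?thesis using u(5) by (simp add: V_def)
      qed
    qed
  qed
  moreover have "\<phi> ` V \<subseteq> \<Omega>" using V1 in_domain by blast
  \<comment> \<open>Every point inside the curve other than \<open>q\<close> is a value of
    \<open>\<phi>\<close>, and \<open>p\<close> is not one; so \<open>p = q\<close> is the only
    possible boundary point of \<open>\<Omega>\<close> inside the curve.\<close>
  ultimately have pq: "p = q" using p_inside p_notin by blast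
  have "open (inside (path_image g))" using Jordan_inside_outside[OF g] by blast
  moreover have "inside (path_image g) \<inter> frontier \<Omega> \<subseteq> {p}"
    using sub pq \<open>\<phi> ` V \<subseteq> \<Omega>\<close> open_domain by (auto simp: frontier_def interior_open)
  ultimately show ?thesis using p_inside unfolding islimpt_def by blast
qed

lemma interior_curve_arc:
  assumes full: "path_image g \<subseteq> \<Omega>" and C: "C \<in> components (ball 0 1 \<inter> \<phi> -` path_image g)"
    and \<alpha>: "norm \<alpha> = 1" and rad: "((\<lambda>r::real. \<phi> (of_real r * \<alpha>)) \<longlongrightarrow> p) (at_left 1)"
    and lp: "p islimpt frontier \<Omega>"
  shows "path_connected C \<and> (\<exists>\<gamma>. arc \<gamma> \<and> path_image \<gamma> = closure C) \<and> \<alpha> \<notin> closure C"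
proof -
  obtain z where "z \<in> C" using in_components_nonempty[OF C] by blast
  then obtain s t0 where s: "continuous_on UNIV s" "range s = C" "inj s" "\<And>t. s t \<in> ball 0 1" "\<And>t. \<phi> (s t) = e t"
    using interior_curve_lift[OF full C] by metis
  obtain c w where cw: "norm c = 1" "norm w < 1" "\<And>z. z \<in> ball 0 1 \<Longrightarrow> disc_moebius c w z \<in> ball 0 1"
    "\<And>z. z \<in> ball 0 1 \<Longrightarrow> \<phi> (disc_moebius c w z) = \<phi> z" "\<And>z. z \<in> ball 0 1 \<Longrightarrow> disc_moebius c w z \<noteq> z"
    "\<And>t. s (t + 1) = disc_moebius c w (s t)"
    using interior_curve_deck[OF s(1,3,4,5)] by metis
  have sb: "range s \<subseteq> ball 0 1" using s(4) by auto
  \<comment> \<open>If \<open>\<alpha>\<close> is fixed, it is chosen as the point sent to infinity,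
    so that \<open>hyperbolic_fixpoint_radial_limit\<close> applies; otherwise any fixed point on
    the circle serves.\<close>
  obtain \<beta> where \<beta>: "norm \<beta> = 1" "disc_moebius c w \<beta> = \<beta>" "disc_moebius c w \<alpha> = \<alpha> \<Longrightarrow> \<beta> = \<alpha>"
  proof (cases "disc_moebius c w \<alpha> = \<alpha>")
    case True then show thesis using that[of \<alpha>] \<alpha> by simp
  next
    case False then show thesis using that disc_moebius_boundary_fixpoint[OF cw(1,2,5)] by metis
  qed
  obtain a b where a: "a > 0"
    and cay: "\<And>z. z \<in> ball 0 1 \<Longrightarrow> cay \<beta> (disc_moebius c w z) = of_real a * cay \<beta> z + \<i> * of_real b"
    using disc_moebius_cay[OF cw(1,2) \<beta>(1,2)] by metis
  obtain \<beta>0 \<beta>1 where ends: "norm \<beta>0 = 1" "norm \<beta>1 = 1" "\<beta>0 = \<beta>1 \<longleftrightarrow> a = 1" "a = 1 \<Longrightarrow> \<beta>0 = \<beta> \<and> b \<noteq> 0"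
    "\<And>s::real\<Rightarrow>complex. continuous_on UNIV s \<Longrightarrow> range s \<subseteq> ball 0 1 \<Longrightarrow> (\<And>t. s (t + 1) = disc_moebius c w (s t))
      \<Longrightarrow> (s \<longlongrightarrow> \<beta>0) at_bot \<and> (s \<longlongrightarrow> \<beta>1) at_top"
    using moebius_orbit_limits[OF cw(1,2,5) \<beta>(1) a cay cw(3)] by metis
  have lim: "(s \<longlongrightarrow> \<beta>0) at_bot" "(s \<longlongrightarrow> \<beta>1) at_top" using ends(5)[OF s(1) sb cw(6)] by auto
  have out: "\<beta>0 \<notin> range s" "\<beta>1 \<notin> range s" using sb ends(1,2) by auto
  obtain \<gamma> where \<gamma>: "path \<gamma>" "pathstart \<gamma> = \<beta>0" "pathfinish \<gamma> = \<beta>1"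
    "path_image \<gamma> = insert \<beta>0 (insert \<beta>1 (range s))"
    "path_image \<gamma> = closure (range s)" "\<beta>0 \<noteq> \<beta>1 \<Longrightarrow> arc \<gamma>" "\<beta>0 = \<beta>1 \<Longrightarrow> simple_path \<gamma>"
    using line_completion[OF s(1,3) lim out] by metis
  have inv: "\<phi> (cayinv \<beta> (of_real a * y + \<i> * of_real b)) = \<phi> (cayinv \<beta> y)" if "Re y > 0" for y
    using cay_invariance[of \<beta> c w a b y, OF \<beta>(1)] cay cw(3,4) that by blast
  have a1: "a \<noteq> 1"
  proof
    assume a1: "a = 1"
    then have e: "\<beta>0 = \<beta>" "\<beta>1 = \<beta>" "b \<noteq> 0" using ends by auto
    have "\<not> p islimpt frontier \<Omega>"
    proof (rule parabolic_isolated[OF \<beta>(1) e(3) s(1,4,5)])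
      show "cay \<beta> (s (t + 1)) = cay \<beta> (s t) + \<i> * of_real b" for t
        using cay[OF s(4), of t] cw(6)[of t] a1 by simp
      show "\<phi> (cayinv \<beta> (y + \<i> * of_real b)) = \<phi> (cayinv \<beta> y)" if "Re y > 0" for y
        using inv[OF that] a1 by simp
    qed (use \<gamma> e s in auto)
    then show False using lp by blast
  qed
  have fixed: "disc_moebius c w \<beta>0 = \<beta>0" "disc_moebius c w \<beta>1 = \<beta>1"
    using moebius_limit_fixed[OF cw(2) ends(1) sb cw(6)] moebius_limit_fixed[OF cw(2) ends(2) sb cw(6)] lim by auto
  have "disc_moebius c w \<alpha> \<noteq> \<alpha>"
  proof
    assume "disc_moebius c w \<alpha> = \<alpha>"
    then have "\<beta> = \<alpha>" using \<beta>(3) by simp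
    then have "p \<in> \<Omega>" using hyperbolic_fixpoint_radial_limit[OF \<alpha> rad a a1] inv by metis
    then show False using p_notin by simp
  qed
  then have "\<alpha> \<noteq> \<beta>0" "\<alpha> \<noteq> \<beta>1" using fixed by auto
  moreover have "\<alpha> \<notin> range s" using sb \<alpha> by auto
  ultimately have "\<alpha> \<notin> closure C" using \<gamma>(4,5) s(2) by auto
  moreover have "arc \<gamma>" using \<gamma>(6) ends(3) a1 by blast
  moreover have "path_connected C" unfolding s(2)[symmetric]
    by (rule path_connected_continuous_image[OF s(1)]) (simp add: convex_imp_path_connected)
  ultimately show ?thesis using \<gamma>(5) s(2) by metis
qed

text \<open>
  The punctured disc around \<^term>\<open>p\<close> is uniformised by the exponential function, whose lift \<^term>\<open>\<psi>\<close> conjugates a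
  translation to the deck transformation. Small images force small sets, hence \<^term>\<open>\<psi>\<close> tends to \<^term>\<open>\<alpha>\<close> as the real
  part tends to minus infinity, and both ends of every orbit must be \<^term>\<open>\<alpha>\<close>.
\<close>

lemma interior_curve_loop:
  assumes full: "path_image g \<subseteq> \<Omega>" and C: "C \<in> components (ball 0 1 \<inter> \<phi> -` path_image g)"
    and \<alpha>: "norm \<alpha> = 1" and rad: "((\<lambda>r::real. \<phi> (of_real r * \<alpha>)) \<longlongrightarrow> p) (at_left 1)"
    and \<epsilon>0: "\<epsilon>0 > 0" "ball p \<epsilon>0 - {p} \<subseteq> \<Omega>" "path_image g \<subseteq> ball p \<epsilon>0"
    and r0: "0 \<le> r0" "\<And>r. r0 < r \<Longrightarrow> r < 1 \<Longrightarrow> dist (\<phi> (of_real r * \<alpha>)) p < \<epsilon>0"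
    and r1: "r0 < r1" "r1 < 1" "of_real r1 * \<alpha> \<in> C"
  shows "path_connected C \<and> (\<exists>\<gamma>. simple_path \<gamma> \<and> pathfinish \<gamma> = pathstart \<gamma> \<and> path_image \<gamma> = closure C) \<and>
     closure C \<inter> sphere 0 1 = {\<alpha>}"
proof -
  obtain s t0 where s: "continuous_on UNIV s" "range s = C" "inj s" "\<And>t. s t \<in> ball 0 1" "\<And>t. \<phi> (s t) = e t"
      "s t0 = of_real r1 * \<alpha>"
    using interior_curve_lift[OF full C r1(3)] by metis
  obtain c w where cw: "norm c = 1" "norm w < 1" "\<And>z. z \<in> ball 0 1 \<Longrightarrow> disc_moebius c w z \<in> ball 0 1"
    "\<And>z. z \<in> ball 0 1 \<Longrightarrow> \<phi> (disc_moebius c w z) = \<phi> z" "\<And>z. z \<in> ball 0 1 \<Longrightarrow> disc_moebius c w z \<noteq> z"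
    "\<And>t. s (t + 1) = disc_moebius c w (s t)"
    using interior_curve_deck[OF s(1,3,4,5)] by metis
  have sb: "range s \<subseteq> ball 0 1" using s(4) by auto
  obtain \<beta> where \<beta>: "norm \<beta> = 1" "disc_moebius c w \<beta> = \<beta>"
    using disc_moebius_boundary_fixpoint[OF cw(1,2,5)] by metis
  obtain a b where a: "a > 0"
    and cay: "\<And>z. z \<in> ball 0 1 \<Longrightarrow> cay \<beta> (disc_moebius c w z) = of_real a * cay \<beta> z + \<i> * of_real b"
    using disc_moebius_cay[OF cw(1,2) \<beta>(1,2)] by metis
  obtain \<beta>0 \<beta>1 where ends: "norm \<beta>0 = 1" "norm \<beta>1 = 1" "\<beta>0 = \<beta>1 \<longleftrightarrow> a = 1" "a = 1 \<Longrightarrow> \<beta>0 = \<beta> \<and> b \<noteq> 0"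
    "\<And>s::real\<Rightarrow>complex. continuous_on UNIV s \<Longrightarrow> range s \<subseteq> ball 0 1 \<Longrightarrow> (\<And>t. s (t + 1) = disc_moebius c w (s t))
      \<Longrightarrow> (s \<longlongrightarrow> \<beta>0) at_bot \<and> (s \<longlongrightarrow> \<beta>1) at_top"
    using moebius_orbit_limits[OF cw(1,2,5) \<beta>(1) a cay cw(3)] by metis
  have lim: "(s \<longlongrightarrow> \<beta>0) at_bot" "(s \<longlongrightarrow> \<beta>1) at_top" using ends(5)[OF s(1) sb cw(6)] by auto
  have rb: "of_real r * \<alpha> \<in> ball 0 1" if "r0 < r" "r < 1" for r using that r0 \<alpha> by (simp add: norm_mult)
  have phip: "\<phi> z \<noteq> p" if "z \<in> ball 0 1" for z using in_domain[OF that] p_notin by auto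
  define H0 where "H0 = {x. Re x < ln \<epsilon>0}"
  have convH0: "convex H0" unfolding H0_def by (rule convex_halfspace_Re_lt)
  define I where "I = {r0<..<1}"
  have contR: "continuous_on I (\<lambda>r. \<phi> (of_real r * \<alpha>))"
    by (rule continuous_on_compose2[OF cont]) (use rb in \<open>auto simp: I_def intro!: continuous_intros\<close>)
  \<comment> \<open>A logarithm of \<open>\<phi> - p\<close> along the tail of the radius. The lift
    \<open>\<psi>\<close> maps it back to the radius, and this ties \<open>\<psi>\<close> to
    \<open>\<alpha>\<close>.\<close>
  obtain lam where lam: "continuous_on I lam" "\<And>r. r \<in> I \<Longrightarrow> \<phi> (of_real r * \<alpha>) - p = exp (lam r)"
  proof (rule continuous_logarithm_on_contractible[of I "\<lambda>r. \<phi> (of_real r * \<alpha>) - p"])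
    show "continuous_on I (\<lambda>r. \<phi> (of_real r * \<alpha>) - p)" using contR by (intro continuous_intros)
    show "contractible I" unfolding I_def by (intro convex_imp_contractible convex_real_interval)
    show "\<phi> (of_real r * \<alpha>) - p \<noteq> 0" if "r \<in> I" for r using phip[OF rb] that by (simp add: I_def)
  qed (rule that)
  have r1I: "r1 \<in> I" using r1 by (simp add: I_def)
  have norm_lt: "x \<in> H0" if "norm (exp x) < \<epsilon>0" for x
    using that \<epsilon>0(1) ln_less_cancel_iff[of "exp (Re x)" \<epsilon>0] by (simp add: H0_def)
  have lamH: "lam r \<in> H0" if "r \<in> I" for r
    using norm_lt[of "lam r"] lam(2)[OF that] r0(2)[of r] that by (simp add: I_def dist_norm)
  define P where "P x = p + exp x" for x
  have PH: "P x \<in> \<Omega>" "dist (P x) p < \<epsilon>0" if "x \<in> H0" for x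
  proof -
    have "exp (Re x) < \<epsilon>0" using that \<epsilon>0(1) exp_less_cancel_iff[of "Re x" "ln \<epsilon>0"] by (simp add: H0_def)
    then show "dist (P x) p < \<epsilon>0" by (simp add: P_def dist_norm)
    then have "P x \<in> ball p \<epsilon>0 - {p}" by (simp add: P_def dist_commute)
    then show "P x \<in> \<Omega>" using \<epsilon>0(2) by blast
  qed
  have contP: "continuous_on A P" for A unfolding P_def by (intro continuous_intros)
  have "P (lam r1) = \<phi> (of_real r1 * \<alpha>)" using lam(2)[OF r1I] unfolding P_def by (metis add.commute diff_add_cancel)
  then obtain \<psi> where \<psi>: "continuous_on H0 \<psi>" "\<And>x. x \<in> H0 \<Longrightarrow> \<psi> x \<in> ball 0 1" "\<psi> (lam r1) = of_real r1 * \<alpha>"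
      "\<And>x. x \<in> H0 \<Longrightarrow> \<phi> (\<psi> x) = P x"
    using lift[OF convH0 lamH[OF r1I] rb[OF r1(1,2)] contP PH(1)] by metis
  have \<psi>lam: "\<psi> (lam r) = of_real r * \<alpha>" if "r \<in> I" for r
  proof (rule lift_unique[where U = I and a = r1 and ?g1.0 = "\<lambda>r. \<psi> (lam r)" and ?g2.0 = "\<lambda>r. of_real r * \<alpha>"])
    show "connected I" by (simp add: I_def)
    show "continuous_on I (\<lambda>r. \<psi> (lam r))" by (rule continuous_on_compose2[OF \<psi>(1) lam(1)]) (use lamH in auto)
    show "\<phi> (\<psi> (lam r)) = \<phi> (of_real r * \<alpha>)" if "r \<in> I" for r
      using \<psi>(4)[OF lamH[OF that]] lam(2)[OF that] unfolding P_def by (metis add.commute diff_add_cancel)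
  qed (use r1I that \<psi> lamH rb in \<open>auto simp: I_def intro!: continuous_intros\<close>)
  have ep: "e t - p \<noteq> 0" for t
    using e_range p_inside inside_no_overlap[of "path_image g"] by (metis disjoint_iff eq_iff_diff_eq_0 rangeI)
  obtain l0 where l0: "continuous_on UNIV l0" "\<And>t. e t - p = exp (l0 t)"
  proof (rule continuous_logarithm_on_contractible[of "UNIV::real set" "\<lambda>t. e t - p"])
    show "continuous_on UNIV (\<lambda>t. e t - p)" by (intro continuous_intros e_cont)
    show "contractible (UNIV::real set)" by (intro convex_imp_contractible convex_UNIV)
    show "e t - p \<noteq> 0" for t by (rule ep)
    fix h assume "continuous_on UNIV h" "\<And>t. t \<in> UNIV \<Longrightarrow> e t - p = exp (h t)"
    then show thesis using that[of h] by simp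
  qed
  \<comment> \<open>The logarithm of the curve is normalised to equal \<open>lam r1\<close> at
    \<open>t0\<close>; then \<open>\<psi> (l t)\<close> and \<open>s t\<close> agree at
    \<open>t0\<close> and hence everywhere.\<close>
  define l where "l t = l0 t - l0 t0 + lam r1" for t
  have lcont: "continuous_on UNIV l" unfolding l_def using l0(1) by (intro continuous_intros)
  have lexp: "exp (l t) = e t - p" for t
  proof -
    have "exp (lam r1) = exp (l0 t0)" using lam(2)[OF r1I] l0(2)[of t0] s(5)[of t0] s(6) by simp
    then show ?thesis unfolding l_def by (simp add: exp_add exp_diff l0(2))
  qed
  have lH: "l t \<in> H0" for t
  proof (rule norm_lt)
    have "e t \<in> ball p \<epsilon>0" using e_range \<epsilon>0(3) by blast
    then show "norm (exp (l t)) < \<epsilon>0" by (simp add: lexp dist_norm norm_minus_commute)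
  qed
  have Pl: "P (l t) = e t" for t by (simp add: P_def lexp)
  have \<psi>l: "\<psi> (l t) = s t" for t
  proof (rule lift_unique[where U = UNIV and a = t0 and ?g1.0 = "\<lambda>t. \<psi> (l t)" and ?g2.0 = s])
    show "continuous_on UNIV (\<lambda>t. \<psi> (l t))" by (rule continuous_on_compose2[OF \<psi>(1) lcont]) (use lH in auto)
    show "\<psi> (l t0) = s t0" using \<psi>(3) s(6) by (simp add: l_def)
  qed (use \<psi> lH s Pl in auto)
  define \<kappa> where "\<kappa> = l 1 - l 0"
  have e1: "e (t + 1) = e t" for t using e_periodic[of t 1] by simp
  have exp\<kappa>: "exp (l (t + 1) - l t) = 1" for t
    using lexp[of "t + 1"] lexp[of t] e1[of t] ep[of t] by (simp add: exp_diff)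
  \<comment> \<open>The increment over one period is continuous with values in the countable set of
    multiples of \<open>2 * pi * \<i>\<close>, hence constant.\<close>
  have l1: "l (t + 1) = l t + \<kappa>" for t
  proof -
    define d where "d t = l (t + 1) - l t" for t
    have "continuous_on UNIV d" unfolding d_def
      by (intro continuous_on_diff lcont continuous_on_compose2[OF lcont]) (auto intro!: continuous_intros)
    moreover have "\<exists>n::int. d t = of_int (2 * n) * pi * \<i>" for t
      using exp\<kappa>[of t] unfolding d_def exp_eq_1 by (auto simp: complex_eq_iff)
    then have "range d \<subseteq> range (\<lambda>n::int. of_int (2 * n) * pi * \<i>)" by auto
    then have "countable (range d)" using countable_subset by blast
    then have "\<not> uncountable (range d)" by simp
    moreover have "connected (range d)" using \<open>continuous_on UNIV d\<close> by (intro connected_continuous_image) auto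
    ultimately obtain v where v: "\<And>t. d t = v"
      using connected_uncountable[of "range d"] by (metis rangeI)
    then show ?thesis using v[of t] v[of 0] by (simp add: d_def \<kappa>_def algebra_simps)
  qed
  have Re\<kappa>: "Re \<kappa> = 0" and exp1: "exp \<kappa> = 1"
    using exp\<kappa>[of 0] by (auto simp: \<kappa>_def exp_eq_1)
  have H0\<kappa>: "x + \<kappa> \<in> H0" if "x \<in> H0" for x using that Re\<kappa> by (simp add: H0_def)
  have M\<psi>: "disc_moebius c w (\<psi> x) = \<psi> (x + \<kappa>)" if "x \<in> H0" for x
  proof (rule lift_unique[where U = H0 and a = "l 0" and ?g1.0 = "\<lambda>x. disc_moebius c w (\<psi> x)" and ?g2.0 = "\<lambda>x. \<psi> (x + \<kappa>)"])
    show "connected H0" using convH0 by (rule convex_connected)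
    have "l 1 = l 0 + \<kappa>" by (simp add: \<kappa>_def)
    then show "disc_moebius c w (\<psi> (l 0)) = \<psi> (l 0 + \<kappa>)" using \<psi>l[of 0] \<psi>l[of 1] cw(6)[of 0] by simp
    have "\<psi> ` H0 \<subseteq> cball 0 1" using \<psi>(2) by (force simp: less_imp_le)
    then show "continuous_on H0 (\<lambda>x. disc_moebius c w (\<psi> x))"
      by (rule continuous_on_compose2[OF continuous_on_disc_moebius[OF cw(2)] \<psi>(1)])
    show "continuous_on H0 (\<lambda>x. \<psi> (x + \<kappa>))"
      by (rule continuous_on_compose2[OF \<psi>(1)]) (use H0\<kappa> in \<open>auto intro!: continuous_intros\<close>)
    show "\<phi> (disc_moebius c w (\<psi> x)) = \<phi> (\<psi> (x + \<kappa>))" if "x \<in> H0" for x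
      using cw(4)[OF \<psi>(2)[OF that]] \<psi>(4)[OF that] \<psi>(4)[OF H0\<kappa>[OF that]] by (simp add: P_def exp_add exp1)
  qed (use that \<psi>(2) H0\<kappa> cw(3) lH in auto)
  have close: "dist \<beta>0 \<alpha> \<le> \<delta> \<and> dist \<beta>1 \<alpha> \<le> \<delta>" if \<delta>: "\<delta> > 0" for \<delta>
  proof -
    obtain \<epsilon> where \<epsilon>: "\<epsilon> > 0"
      "\<And>C z w. path_connected C \<Longrightarrow> C \<subseteq> ball 0 1 \<Longrightarrow> (\<And>x. x \<in> C \<Longrightarrow> dist (\<phi> x) p < \<epsilon>)
        \<Longrightarrow> z \<in> C \<Longrightarrow> w \<in> C \<Longrightarrow> dist z w \<le> \<delta>"
      using small_image_imp_small_set[OF p_notin \<delta>] by metis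
    define \<epsilon>1 where "\<epsilon>1 = min \<epsilon> \<epsilon>0"
    have \<epsilon>1: "\<epsilon>1 > 0" "\<epsilon>1 \<le> \<epsilon>" "\<epsilon>1 \<le> \<epsilon>0" using \<epsilon> \<epsilon>0 by (auto simp: \<epsilon>1_def)
    define H1 where "H1 = {x. Re x < ln \<epsilon>1}"
    have H10: "H1 \<subseteq> H0" using \<epsilon>1 by (force simp: H1_def H0_def intro: less_le_trans)
    have diam: "dist (\<psi> x) (\<psi> y) \<le> \<delta>" if xy: "x \<in> H1" "y \<in> H1" for x y
    proof (rule \<epsilon>(2)[of "\<psi> ` H1"])
      have "convex H1" unfolding H1_def by (rule convex_halfspace_Re_lt)
      then show "path_connected (\<psi> ` H1)"
        using continuous_on_subset[OF \<psi>(1) H10] by (intro path_connected_continuous_image convex_imp_path_connected)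
      show "\<psi> ` H1 \<subseteq> ball 0 1" using \<psi>(2) H10 by blast
      fix z assume "z \<in> \<psi> ` H1"
      then obtain x where x: "x \<in> H1" "z = \<psi> x" by blast
      have "exp (Re x) < \<epsilon>1" using x(1) \<epsilon>1(1) exp_less_cancel_iff[of "Re x" "ln \<epsilon>1"] by (simp add: H1_def)
      then have "dist (P x) p < \<epsilon>" using \<epsilon>1(2) by (simp add: P_def dist_norm)
      then show "dist (\<phi> z) p < \<epsilon>" using \<psi>(4)[of x] x H10 by auto
    qed (use xy in auto)
    have da: "dist (\<psi> x) \<alpha> \<le> \<delta>" if x: "x \<in> H1" for x
    proof (rule tendsto_upperbound)
      have "((\<lambda>r::real. of_real r * \<alpha>) \<longlongrightarrow> of_real 1 * \<alpha>) (at_left 1)" by (intro tendsto_intros)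
      then show "((\<lambda>r::real. dist (\<psi> x) (of_real r * \<alpha>)) \<longlongrightarrow> dist (\<psi> x) \<alpha>) (at_left 1)"
        by (intro tendsto_dist tendsto_const) simp
      have "\<forall>\<^sub>F r in at_left 1. dist (\<phi> (of_real r * \<alpha>)) p < \<epsilon>1" using tendstoD[OF rad \<epsilon>1(1)] .
      moreover have "\<forall>\<^sub>F r in at_left 1. r \<in> I"
        unfolding eventually_at_left_field I_def using r1 by (intro exI[of _ r0]) auto
      ultimately show "\<forall>\<^sub>F r in at_left 1. dist (\<psi> x) (of_real r * \<alpha>) \<le> \<delta>"
      proof eventually_elim
        case (elim r)
        have "norm (exp (lam r)) < \<epsilon>1" using elim lam(2)[of r] by (simp add: dist_norm)
        then have "lam r \<in> H1"
          using \<epsilon>1(1) ln_less_cancel_iff[of "exp (Re (lam r))" \<epsilon>1] by (simp add: H1_def)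
        then show ?case using diam[OF x, of "lam r"] \<psi>lam elim by simp
      qed
    qed simp
    \<comment> \<open>Shifting the logarithm of the curve to the left by \<open>X\<close> moves it
      into \<open>H1\<close>, where \<open>\<psi>\<close> is within \<open>\<delta>\<close> of
      \<open>\<alpha>\<close>. The shifted curve is equivariant under the same transformation, so it
      has the same ends as \<open>s\<close>.\<close>
    define X where "X = ln \<epsilon>0 - ln \<epsilon>1"
    have X: "X \<ge> 0" using \<epsilon>1 \<epsilon>0 by (simp add: X_def)
    have lX: "l t - of_real X \<in> H1" "l t - of_real X \<in> H0" for t using lH[of t] X by (auto simp: H0_def H1_def X_def)
    define sX where "sX t = \<psi> (l t - of_real X)" for t
    have "(sX \<longlongrightarrow> \<beta>0) at_bot \<and> (sX \<longlongrightarrow> \<beta>1) at_top"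
    proof (rule ends(5))
      show "continuous_on UNIV sX" unfolding sX_def
        by (rule continuous_on_compose2[OF \<psi>(1)]) (use lX lcont in \<open>auto intro!: continuous_intros\<close>)
      show "range sX \<subseteq> ball 0 1" using \<psi>(2) lX(2) by (auto simp: sX_def)
      show "sX (t + 1) = disc_moebius c w (sX t)" for t
        using M\<psi>[OF lX(2), of t] l1[of t] by (simp add: sX_def algebra_simps)
    qed
    then have l: "(sX \<longlongrightarrow> \<beta>0) at_bot" "(sX \<longlongrightarrow> \<beta>1) at_top" by auto
    have dX: "dist (sX t) \<alpha> \<le> \<delta>" for t unfolding sX_def by (rule da[OF lX(1)])
    have "dist \<beta>0 \<alpha> \<le> \<delta>"
      by (rule tendsto_upperbound[OF tendsto_dist[OF l(1) tendsto_const]]) (use dX in auto)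
    moreover have "dist \<beta>1 \<alpha> \<le> \<delta>"
      by (rule tendsto_upperbound[OF tendsto_dist[OF l(2) tendsto_const]]) (use dX in auto)
    ultimately show ?thesis by blast
  qed
  have eq: "\<beta>0 = \<alpha>" "\<beta>1 = \<alpha>"
    using close by (metis dist_nz linorder_not_le dense)+
  have out: "\<beta>0 \<notin> range s" "\<beta>1 \<notin> range s" using sb ends(1,2) by auto
  obtain \<gamma> where \<gamma>: "path \<gamma>" "pathstart \<gamma> = \<beta>0" "pathfinish \<gamma> = \<beta>1"
    "path_image \<gamma> = insert \<beta>0 (insert \<beta>1 (range s))"
    "path_image \<gamma> = closure (range s)" "\<beta>0 = \<beta>1 \<Longrightarrow> simple_path \<gamma>"
    using line_completion[OF s(1,3) lim out] by metis
  have "closure C = insert \<alpha> C" using \<gamma>(4,5) eq s(2) by simp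
  moreover have "C \<inter> sphere 0 1 = {}" using sb s(2) by auto
  ultimately have "closure C \<inter> sphere 0 1 = {\<alpha>}" using \<alpha> by auto
  moreover have "path_connected C" unfolding s(2)[symmetric]
    by (rule path_connected_continuous_image[OF s(1)]) (simp add: convex_imp_path_connected)
  ultimately show ?thesis using \<gamma> eq s(2) by metis
qed

end

section \<open>The separating component\<close>

text \<open>Separation by a single component holds for closed subsets of the plane, whereas
  \<open>A\<close> is closed only relative to the disc; a homeomorphism of the open disc with the
  plane bridges the gap.\<close>

lemma disc_separation_by_component:
  fixes A :: "complex set"
  assumes A: "closedin (top_of_set (ball 0 1)) A" and sep: "\<not> connected_component (ball 0 1 - A) x y"
    and xy: "x \<in> ball 0 1" "y \<in> ball 0 1"
  obtains C where "C \<in> components A" "\<not> connected_component (ball 0 1 - C) x y"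
proof -
  obtain h k where hk: "homeomorphism (ball (0::complex) 1) (UNIV::complex set) h k"
    using homeomorphic_ball01_UNIV unfolding homeomorphic_def by blast
  have kh: "k (h z) = z" if "z \<in> ball 0 1" for z using hk that by (simp add: homeomorphism_def)
  have hk': "h (k z) = z" "k z \<in> ball 0 1" for z using hk by (auto simp: homeomorphism_def)
  have conts: "continuous_on (ball 0 1) h" "continuous_on UNIV k" using hk by (auto simp: homeomorphism_def)
  have AB: "A \<subseteq> ball 0 1" using A closedin_imp_subset by blast
  have "h ` A = k -` A" using AB kh hk' by (auto simp: image_iff) (metis hk'(1))
  moreover have "closed (k -` A)"
  proof -
    have "closedin (top_of_set UNIV) (UNIV \<inter> k -` A)"
      by (rule continuous_closedin_preimage_gen[OF conts(2) _ A]) (use hk' in auto)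
    then show ?thesis by simp
  qed
  ultimately have "closed (h ` A)" by simp
  moreover have "\<not> connected_component (- (h ` A)) (h x) (h y)"
  proof
    assume "connected_component (- (h ` A)) (h x) (h y)"
    then obtain T where T: "connected T" "T \<subseteq> - (h ` A)" "h x \<in> T" "h y \<in> T"
      unfolding connected_component_def by blast
    have "connected (k ` T)" using T conts by (meson connected_continuous_image continuous_on_subset subset_UNIV)
    moreover have "k ` T \<subseteq> ball 0 1 - A" using T(2) hk' by (auto simp: image_iff) (metis ComplD hk'(1) imageI subsetD)
    moreover have "x \<in> k ` T" "y \<in> k ` T" using T(3,4) kh xy by (metis imageI)+
    ultimately show False using sep unfolding connected_component_def by blast
  qed
  ultimately obtain C' where C': "C' \<in> components (h ` A)" "\<not> connected_component (- C') (h x) (h y)"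
    using separation_by_component_closed_pointwise by metis
  have "connected (k ` C')" using in_components_connected[OF C'(1)] conts
    by (meson connected_continuous_image continuous_on_subset subset_UNIV)
  moreover have kCA: "k ` C' \<subseteq> A"
  proof
    fix v assume "v \<in> k ` C'"
    then obtain x where "x \<in> A" "v = k (h x)" using in_components_subset[OF C'(1)] by blast
    then show "v \<in> A" using kh[of x] AB by auto
  qed
  moreover have "A \<noteq> {}" using in_components_nonempty[OF C'(1)] kCA by blast
  ultimately obtain C where C: "C \<in> components A" "k ` C' \<subseteq> C"
    using exists_component_superset by metis
  have "\<not> connected_component (ball 0 1 - C) x y"
  proof
    assume "connected_component (ball 0 1 - C) x y"
    then obtain T where T: "connected T" "T \<subseteq> ball 0 1 - C" "x \<in> T" "y \<in> T"
      unfolding connected_component_def by blast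
    have "connected (h ` T)" using T conts by (meson Diff_subset connected_continuous_image continuous_on_subset subset_trans)
    moreover have "h ` T \<subseteq> - C'"
    proof
      fix v assume "v \<in> h ` T"
      then obtain z where z: "z \<in> T" "v = h z" by blast
      then have "k v = z" using kh T(2) by auto
      moreover have "z \<notin> C" using z T(2) by blast
      ultimately show "v \<in> - C'" using C(2) by blast
    qed
    ultimately show False using C'(2) T(3,4) unfolding connected_component_def by blast
  qed
  then show thesis using that C by blast
qed

text \<open>A path from 0 to \<open>\<alpha>\<close> in the closed disc that avoids the closure of
  \<open>C\<close> keeps a positive distance from it. Contracted slightly towards 0 it lies in the
  open disc, still avoids \<open>C\<close>, and ends on the radius beyond \<open>r1\<close>.\<close>

lemma closure_separates_radius_end:
  fixes \<alpha> :: complex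
  assumes \<alpha>: "norm \<alpha> = 1" and C: "C \<subseteq> ball 0 1" and r1: "0 \<le> r1" "r1 < 1"
    and sep: "\<And>r. r1 < r \<Longrightarrow> r < 1 \<Longrightarrow> \<not> connected_component (ball 0 1 - C) 0 (of_real r * \<alpha>)"
  shows "\<not> connected_component (cball 0 1 - closure C) 0 \<alpha>"
proof
  assume cc: "connected_component (cball 0 1 - closure C) 0 \<alpha>"
  have "openin (top_of_set (cball (0::complex) 1)) (cball 0 1 - closure C)"
    by (metis Diff_eq closed_closure open_Compl openin_open_Int)
  then have "locally path_connected (cball 0 1 - closure C)"
    by (rule locally_open_subset[OF convex_imp_locally_path_connected[OF convex_cball]])
  then have "path_component (cball 0 1 - closure C) 0 \<alpha>"
    using cc by (simp add: path_component_eq_connected_component)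
  then obtain h where h: "path h" "path_image h \<subseteq> cball 0 1 - closure C" "pathstart h = 0" "pathfinish h = \<alpha>"
    unfolding path_component_def by blast
  have "compact (path_image h)" using h by blast
  then obtain d where d: "d > 0" "\<And>x y. x \<in> path_image h \<Longrightarrow> y \<in> closure C \<Longrightarrow> d \<le> dist x y"
    using separate_compact_closed[of "path_image h" "closure C"] h(2) by blast
  define \<kappa> where "\<kappa> = min (d / 2) ((1 - r1) / 2)"
  have \<kappa>: "0 < \<kappa>" "\<kappa> < d" "r1 < 1 - \<kappa>" "\<kappa> < 1" using d r1 by (auto simp: \<kappa>_def min_def field_simps)
  define h' where "h' x = of_real (1 - \<kappa>) * x" for x :: complex
  have "connected (h' ` path_image h)"
    unfolding h'_def by (intro connected_continuous_image continuous_intros connected_path_image h)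
  moreover have "h' ` path_image h \<subseteq> ball 0 1 - C"
  proof
    fix v assume "v \<in> h' ` path_image h"
    then obtain x where x: "x \<in> path_image h" "v = h' x" by blast
    have nx: "norm x \<le> 1" using x h(2) by auto
    have "norm v = (1 - \<kappa>) * norm x" using x \<kappa> by (simp add: h'_def norm_mult del: of_real_diff)
    also have "\<dots> \<le> (1 - \<kappa>) * 1" using nx \<kappa> by (intro mult_left_mono) auto
    finally have "norm v < 1" using \<kappa> by simp
    moreover have "v \<notin> C"
    proof
      assume "v \<in> C"
      then have "d \<le> dist x v" using d(2)[OF x(1)] closure_subset by blast
      also have "dist x v = norm (of_real \<kappa> * x)" by (simp add: x h'_def dist_norm algebra_simps)
      also have "\<dots> = \<kappa> * norm x" using \<kappa> by (simp add: norm_mult)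
      also have "\<dots> \<le> \<kappa> * 1" using nx \<kappa> by (intro mult_left_mono) auto
      finally show False using \<kappa> by simp
    qed
    ultimately show "v \<in> ball 0 1 - C" by simp
  qed
  moreover have "0 \<in> h' ` path_image h"
    using h(3) pathstart_in_path_image[of h] by (intro image_eqI[of _ _ 0]) (auto simp: h'_def)
  moreover have "of_real (1 - \<kappa>) * \<alpha> \<in> h' ` path_image h"
    using h(4) pathfinish_in_path_image[of h] by (intro image_eqI[of _ _ \<alpha>]) (auto simp: h'_def)
  ultimately have "connected_component (ball 0 1 - C) 0 (of_real (1 - \<kappa>) * \<alpha>)"
    unfolding connected_component_def by blast
  then show False using sep[of "1 - \<kappa>"] \<kappa> by (simp del: of_real_diff)
qed

lemma (in disc_covering) radial_limit_notin_domain: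
  assumes \<alpha>: "norm \<alpha> = 1" and rad: "((\<lambda>r::real. \<phi> (of_real r * \<alpha>)) \<longlongrightarrow> p) (at_left 1)"
  shows "p \<notin> \<Omega>"
proof (rule lift_image_end_notin_domain[where s = "\<lambda>r. of_real r * \<alpha>" and a = 0 and b = 1, OF _ _ _ rad])
  have "((\<lambda>r::real. of_real r * \<alpha>) \<longlongrightarrow> of_real 1 * \<alpha>) (at_left 1)" by (intro tendsto_intros)
  then show "((\<lambda>r::real. of_real r * \<alpha>) \<longlongrightarrow> \<alpha>) (at_left 1)" by simp
  show "continuous_on {0..<1} (\<lambda>r. complex_of_real r * \<alpha>)" by (intro continuous_intros)
qed (use \<alpha> in \<open>auto simp: norm_mult\<close>)

context disc_covering_curve
begin

text \<open>Near \<open>\<alpha>\<close> the radius maps inside the curve while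
  \<open>\<phi> 0\<close> is outside, so the preimage, and then one component, separates 0 from a
  point of the tail. With \<open>r1\<close> the last parameter of the radius in \<open>C\<close>,
  all later points are joined to one another along the radius and so are separated from 0
  together.\<close>

lemma separating_component:
  assumes \<alpha>: "norm \<alpha> = 1" and rad: "((\<lambda>r::real. \<phi> (of_real r * \<alpha>)) \<longlongrightarrow> p) (at_left 1)"
    and out: "\<phi> 0 \<notin> path_image g" "\<phi> 0 \<notin> inside (path_image g)"
  obtains C r1 where "C \<in> components (ball 0 1 \<inter> \<phi> -` path_image g)" "0 \<le> r1" "r1 < 1" "of_real r1 * \<alpha> \<in> C"
    "\<And>r. r1 < r \<Longrightarrow> r < 1 \<Longrightarrow> of_real r * \<alpha> \<notin> C"
    "\<And>r. r1 < r \<Longrightarrow> r < 1 \<Longrightarrow> \<not> connected_component (ball 0 1 - C) 0 (of_real r * \<alpha>)"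
proof -
  define A where "A = ball 0 1 \<inter> \<phi> -` path_image g"
  note J = Jordan_inside_outside[OF g]
  have clg: "closed (path_image g)" using g by (simp add: closed_path_image simple_path_imp_path)
  have clA: "closedin (top_of_set (ball 0 1)) A"
    unfolding A_def by (rule continuous_closedin_preimage[OF cont clg])
  have "\<forall>\<^sub>F r in at_left 1. \<phi> (of_real r * \<alpha>) \<in> inside (path_image g)"
    using rad J p_inside by (intro topological_tendstoD) auto
  then obtain r0' where r0': "r0' < 1" "\<And>r. r0' < r \<Longrightarrow> r < 1 \<Longrightarrow> \<phi> (of_real r * \<alpha>) \<in> inside (path_image g)"
    unfolding eventually_at_left_field by blast
  define r0 where "r0 = max 0 r0'"
  have r0: "0 \<le> r0" "r0 < 1" "\<And>r. r0 < r \<Longrightarrow> r < 1 \<Longrightarrow> \<phi> (of_real r * \<alpha>) \<in> inside (path_image g)"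
    using r0' by (auto simp: r0_def)
  have rb: "of_real r * \<alpha> \<in> ball 0 1" if "0 \<le> r" "r < 1" for r using that \<alpha> by (simp add: norm_mult)
  have tailA: "of_real r * \<alpha> \<notin> A" if "r0 < r" "r < 1" for r
    using r0(3)[OF that] inside_no_overlap[of "path_image g"] unfolding A_def by blast
  define r2 where "r2 = (1 + r0) / 2"
  have r2: "r0 < r2" "r2 < 1" "0 \<le> r2" using r0 by (auto simp: r2_def)
  have "\<not> connected_component (ball 0 1 - A) 0 (of_real r2 * \<alpha>)"
  proof
    assume "connected_component (ball 0 1 - A) 0 (of_real r2 * \<alpha>)"
    then obtain T where T: "connected T" "T \<subseteq> ball 0 1 - A" "0 \<in> T" "of_real r2 * \<alpha> \<in> T"
      unfolding connected_component_def by blast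
    have "connected (\<phi> ` T)" using T cont by (meson Diff_subset connected_continuous_image continuous_on_subset subset_trans)
    moreover have "\<phi> ` T \<inter> frontier (inside (path_image g)) = {}" using T(2) J by (auto simp: A_def)
    moreover have "\<phi> (of_real r2 * \<alpha>) \<in> \<phi> ` T \<inter> inside (path_image g)" using T(4) r0(3) r2 by auto
    ultimately have "\<phi> ` T \<subseteq> inside (path_image g)"
      using connected_Int_frontier[of "\<phi> ` T" "inside (path_image g)"] by blast
    then show False using T(3) out(2) by blast
  qed
  then obtain C where C: "C \<in> components A" "\<not> connected_component (ball 0 1 - C) 0 (of_real r2 * \<alpha>)"
    using disc_separation_by_component[OF clA] rb[OF r2(3,2)] by (metis centre_in_ball zero_less_one)
  have CA: "C \<subseteq> A" by (rule in_components_subset[OF C(1)])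
  have clC: "closedin (top_of_set (ball 0 1)) C"
    using closedin_component[OF C(1)] clA closedin_trans by blast
  have seg: "connected ((\<lambda>r. of_real r * \<alpha>) ` {a..b})" for a b :: real
    by (intro connected_continuous_image continuous_intros) auto
  \<comment> \<open>\<open>C\<close> is closed only relative to the disc, so the last crossing is
    sought on the compact segment up to \<open>r2\<close>; from \<open>r2\<close> on the radius
    misses the whole preimage.\<close>
  define R where "R = {0..r2} \<inter> (\<lambda>r::real. of_real r * \<alpha>) -` C"
  have "closedin (top_of_set {0..r2}) R"
    unfolding R_def by (rule continuous_closedin_preimage_gen[OF _ _ clC]) (use rb r2 in \<open>auto intro!: continuous_intros\<close>)
  then have clR: "closed R" using closedin_closed_trans closed_atLeastAtMost by blast
  have "R \<noteq> {}"
  proof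
    assume "R = {}"
    then have "(\<lambda>r. of_real r * \<alpha>) ` {0..r2} \<subseteq> ball 0 1 - C" using rb r2 by (fastforce simp: R_def)
    moreover have "0 \<in> (\<lambda>r. of_real r * \<alpha>) ` {0..r2}" using r2 by (intro image_eqI[of _ _ 0]) auto
    moreover have "of_real r2 * \<alpha> \<in> (\<lambda>r. of_real r * \<alpha>) ` {0..r2}" using r2 by auto
    ultimately show False using C(2) seg unfolding connected_component_def by blast
  qed
  moreover have bdd: "bdd_above R" by (auto simp: R_def intro!: bdd_aboveI[of _ r2])
  ultimately have "Sup R \<in> R" using clR closed_contains_Sup by blast
  define r1 where "r1 = Sup R"
  have r1: "0 \<le> r1" "r1 \<le> r2" "of_real r1 * \<alpha> \<in> C" using \<open>Sup R \<in> R\<close> by (auto simp: R_def r1_def)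
  have beyond: "of_real r * \<alpha> \<notin> C" if r: "r1 < r" "r < 1" for r
  proof (cases "r \<le> r2")
    case True
    then have "r \<notin> R" using cSup_upper[OF _ bdd, of r] r by (auto simp: r1_def)
    then show ?thesis using True r r1(1) by (auto simp: R_def)
  next
    case False
    then show ?thesis using tailA[of r] CA r r2 by auto
  qed
  have "r1 \<noteq> r2" using r1(3) tailA[of r2] r2 CA by auto
  then have r12: "r1 < r2" using r1 by simp
  have "\<not> connected_component (ball 0 1 - C) 0 (of_real r * \<alpha>)" if r: "r1 < r" "r < 1" for r
  proof
    assume cc: "connected_component (ball 0 1 - C) 0 (of_real r * \<alpha>)"
    have "connected_component (ball 0 1 - C) (of_real r * \<alpha>) (of_real r2 * \<alpha>)"
      unfolding connected_component_def
    proof (intro exI conjI)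
      show "connected ((\<lambda>r. of_real r * \<alpha>) ` {min r r2..max r r2})" by (rule seg)
      show "(\<lambda>r. of_real r * \<alpha>) ` {min r r2..max r r2} \<subseteq> ball 0 1 - C"
      proof
        fix v assume "v \<in> (\<lambda>r. of_real r * \<alpha>) ` {min r r2..max r r2}"
        then obtain x where x: "min r r2 \<le> x" "x \<le> max r r2" "v = of_real x * \<alpha>" by auto
        then have "r1 < x" "x < 1" using r r12 r2 by auto
        then show "v \<in> ball 0 1 - C" using x(3) rb[of x] beyond[of x] r1(1) by simp
      qed
    qed auto
    then show False using C(2) cc connected_component_trans by blast
  qed
  then show thesis using that[of C r1] C(1) r1 r12 r2 beyond by (simp add: A_def)
qed

end

lemma diameter_less_of_dist_le:
  fixes C :: "complex set"
  assumes "\<delta> > 0" "\<And>z w. z \<in> C \<Longrightarrow> w \<in> C \<Longrightarrow> dist z w \<le> \<delta> / 2"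
  shows "diameter C < \<delta>"
proof -
  have "diameter C \<le> \<delta> / 2" by (rule diameter_le) (use assms in \<open>auto simp: dist_norm\<close>)
  then show ?thesis using assms(1) by simp
qed

theorem theorem2p6:
  fixes \<Omega> :: "complex set" and \<phi> :: "complex \<Rightarrow> complex" and \<alpha> p :: complex
  assumes "bounded \<Omega>" and "connected \<Omega>" and "open \<Omega>"
    and "\<phi> holomorphic_on ball 0 1"
    and "covering_space (ball 0 1) \<phi> \<Omega>"
    and "norm \<alpha> = 1"
    and "((\<lambda>r::real. \<phi> (complex_of_real r * \<alpha>)) \<longlongrightarrow> p) (at_left 1)"
  shows
    "(p islimpt frontier \<Omega> \<longrightarrow>
       (\<forall>\<delta>>0. \<exists>\<epsilon>>0. \<forall>g::real \<Rightarrow> complex.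
          simple_path g \<and> pathfinish g = pathstart g \<and>
          path_image g \<subseteq> ball p \<epsilon> \<and> p \<in> inside (path_image g) \<longrightarrow>
          (\<exists>C \<in> components (ball 0 1 \<inter> \<phi> -` path_image g).
             (\<exists>\<gamma>. arc \<gamma> \<and> path_image \<gamma> = closure C) \<and>
             0 \<notin> closure C \<and> \<alpha> \<notin> closure C \<and>
             \<not> connected_component (cball 0 1 - closure C) 0 \<alpha> \<and>
             diameter C < \<delta>)))
     \<and>
     (\<not> p islimpt frontier \<Omega> \<longrightarrow>
       (\<forall>\<delta>>0. \<exists>\<epsilon>>0. \<forall>g::real \<Rightarrow> complex.
          simple_path g \<and> pathfinish g = pathstart g \<and> path_image g \<subseteq> \<Omega> \<and>
          path_image g \<subseteq> ball p \<epsilon> \<and> p \<in> inside (path_image g) \<longrightarrow>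
          (\<exists>C \<in> components (ball 0 1 \<inter> \<phi> -` path_image g).
             (\<exists>\<gamma>. simple_path \<gamma> \<and> pathfinish \<gamma> = pathstart \<gamma> \<and>
                   path_image \<gamma> = closure C) \<and>
             closure C \<inter> sphere 0 1 = {\<alpha>} \<and>
             diameter C < \<delta>)))"
proof -
  interpret disc_covering \<Omega> \<phi> by unfold_locales (use assms in auto)
  note \<alpha> = assms(6) and rad = assms(7)
  have pn: "p \<notin> \<Omega>" by (rule radial_limit_notin_domain[OF \<alpha> rad])
  have inball: "inside (path_image g) \<subseteq> ball p \<epsilon>" if "simple_path g" "path_image g \<subseteq> ball p \<epsilon>" for g :: "real \<Rightarrow> complex" and \<epsilon>
    using that by (intro inside_subset_ball) (auto simp: closed_path_image simple_path_imp_path less_imp_le)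
  have curve: "\<exists>e. disc_covering_curve \<Omega> \<phi> g p e"
    if g: "simple_path g" "pathfinish g = pathstart g" "p \<in> inside (path_image g)" for g
  proof -
    obtain e :: "real \<Rightarrow> complex" where "continuous_on UNIV e" "range e = path_image g" "\<And>s t. e s = e t \<longleftrightarrow> s - t \<in> \<int>"
      using simple_closed_curve_periodic_param[OF g(1,2)] by metis
    then have "disc_covering_curve \<Omega> \<phi> g p e" by unfold_locales (use g pn in auto)
    then show ?thesis by blast
  qed
  show ?thesis
  proof (intro conjI impI allI)
    fix \<delta> :: real assume lp: "p islimpt frontier \<Omega>" and \<delta>: "\<delta> > 0"
    obtain \<epsilon>1 where \<epsilon>1: "\<epsilon>1 > 0"
      "\<And>C z w. path_connected C \<Longrightarrow> C \<subseteq> ball 0 1 \<Longrightarrow> (\<And>x. x \<in> C \<Longrightarrow> dist (\<phi> x) p < \<epsilon>1)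
        \<Longrightarrow> z \<in> C \<Longrightarrow> w \<in> C \<Longrightarrow> dist z w \<le> \<delta> / 2"
      using small_image_imp_small_set[OF pn, of "\<delta> / 2"] \<delta> by (metis half_gt_zero)
    \<comment> \<open>Values within \<open>d\<close> of \<open>p\<close> occur only at points of
      norm above 1/2. This puts \<open>\<phi> 0\<close> outside the curve and keeps the closure of
      \<open>C\<close> away from 0.\<close>
    obtain d where d: "d > 0" "\<And>z. z \<in> ball 0 1 \<Longrightarrow> dist (\<phi> z) p < d \<Longrightarrow> 1/2 < norm z"
      using near_omitted_value_imp_norm_gt[OF pn, of "1/2"] by auto
    define \<epsilon> where "\<epsilon> = min \<epsilon>1 d"
    show "\<exists>\<epsilon>>0. \<forall>g::real \<Rightarrow> complex.
          simple_path g \<and> pathfinish g = pathstart g \<and>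
          path_image g \<subseteq> ball p \<epsilon> \<and> p \<in> inside (path_image g) \<longrightarrow>
          (\<exists>C \<in> components (ball 0 1 \<inter> \<phi> -` path_image g).
             (\<exists>\<gamma>. arc \<gamma> \<and> path_image \<gamma> = closure C) \<and>
             0 \<notin> closure C \<and> \<alpha> \<notin> closure C \<and>
             \<not> connected_component (cball 0 1 - closure C) 0 \<alpha> \<and>
             diameter C < \<delta>)"
    proof (intro exI[of _ \<epsilon>] conjI allI impI)
      show "\<epsilon> > 0" using \<epsilon>1 d by (simp add: \<epsilon>_def)
      fix g :: "real \<Rightarrow> complex"
      assume gh: "simple_path g \<and> pathfinish g = pathstart g \<and> path_image g \<subseteq> ball p \<epsilon> \<and> p \<in> inside (path_image g)"
      then obtain e where "disc_covering_curve \<Omega> \<phi> g p e" using curve by blast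
      then interpret disc_covering_curve \<Omega> \<phi> g p e .
      have in\<epsilon>: "inside (path_image g) \<subseteq> ball p \<epsilon>" using inball gh by blast
      have "\<not> dist (\<phi> 0) p < d" using d(2)[of 0] by auto
      then have "\<phi> 0 \<notin> ball p \<epsilon>" by (simp add: \<epsilon>_def dist_commute)
      then have out: "\<phi> 0 \<notin> path_image g" "\<phi> 0 \<notin> inside (path_image g)" using gh in\<epsilon> by auto
      obtain C r1 where C: "C \<in> components (ball 0 1 \<inter> \<phi> -` path_image g)" "0 \<le> r1" "r1 < 1" "of_real r1 * \<alpha> \<in> C"
        "\<And>r. r1 < r \<Longrightarrow> r < 1 \<Longrightarrow> of_real r * \<alpha> \<notin> C"
        "\<And>r. r1 < r \<Longrightarrow> r < 1 \<Longrightarrow> \<not> connected_component (ball 0 1 - C) 0 (of_real r * \<alpha>)"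
        using separating_component[OF \<alpha> rad out] by metis
      have Cb: "C \<subseteq> ball 0 1" and Cg: "\<And>x. x \<in> C \<Longrightarrow> \<phi> x \<in> ball p \<epsilon>"
        using in_components_subset[OF C(1)] gh by auto
      have arc: "path_connected C \<and> (\<exists>\<gamma>. arc \<gamma> \<and> path_image \<gamma> = closure C) \<and> \<alpha> \<notin> closure C"
      \<comment> \<open>A small curve around a nonisolated boundary point may still lie in
        \<open>\<Omega>\<close>, for instance if the boundary is totally disconnected near
        \<open>p\<close>; so both kinds of curve occur.\<close>
      proof (cases "path_image g \<subseteq> \<Omega>")
        case True
        show ?thesis by (rule interior_curve_arc[OF True C(1) \<alpha> rad lp])
      next
        case False
        show ?thesis by (rule crossing_curve_arc[OF False \<alpha> rad C(1-5)])
      qed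
      have "C \<subseteq> {z. 1/2 \<le> norm z}"
        using d(2) Cb Cg by (force simp: \<epsilon>_def dist_commute)
      then have "closure C \<subseteq> {z. 1/2 \<le> norm z}"
        by (intro closure_minimal closed_Collect_le continuous_intros)
      then have "0 \<notin> closure C" by auto
      moreover have "\<not> connected_component (cball 0 1 - closure C) 0 \<alpha>"
        by (rule closure_separates_radius_end[OF \<alpha> Cb C(2,3,6)])
      moreover have "diameter C < \<delta>"
      proof (rule diameter_less_of_dist_le[OF \<delta>])
        show "dist z w \<le> \<delta> / 2" if "z \<in> C" "w \<in> C" for z w
          using \<epsilon>1(2)[of C z w] arc Cb Cg that by (force simp: \<epsilon>_def dist_commute)
      qed
      ultimately show "\<exists>C \<in> components (ball 0 1 \<inter> \<phi> -` path_image g).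
             (\<exists>\<gamma>. arc \<gamma> \<and> path_image \<gamma> = closure C) \<and>
             0 \<notin> closure C \<and> \<alpha> \<notin> closure C \<and>
             \<not> connected_component (cball 0 1 - closure C) 0 \<alpha> \<and>
             diameter C < \<delta>"
        using C(1) arc by blast
    qed
  next
    fix \<delta> :: real assume nlp: "\<not> p islimpt frontier \<Omega>" and \<delta>: "\<delta> > 0"
    obtain T where T: "open T" "p \<in> T" "\<And>y. y \<in> frontier \<Omega> \<Longrightarrow> y \<in> T \<Longrightarrow> y = p"
      using nlp unfolding islimpt_def by blast
    obtain \<epsilon>0 where \<epsilon>0: "\<epsilon>0 > 0" "ball p \<epsilon>0 \<subseteq> T" using T by (meson openE)
    obtain r0' where r0': "r0' < 1" "\<And>r. r0' < r \<Longrightarrow> r < 1 \<Longrightarrow> dist (\<phi> (of_real r * \<alpha>)) p < \<epsilon>0"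
      using tendstoD[OF rad \<epsilon>0(1)] unfolding eventually_at_left_field by blast
    define r0 where "r0 = max 0 r0'"
    have r0: "0 \<le> r0" "r0 < 1" "\<And>r. r0 < r \<Longrightarrow> r < 1 \<Longrightarrow> dist (\<phi> (of_real r * \<alpha>)) p < \<epsilon>0"
      using r0' by (auto simp: r0_def)
    \<comment> \<open>The punctured disc is connected, misses the frontier of
      \<open>\<Omega>\<close> and meets \<open>\<Omega>\<close> in the image of the radius.\<close>
    have punct: "ball p \<epsilon>0 - {p} \<subseteq> \<Omega>"
    proof -
      have "connected (ball p \<epsilon>0 - {p})" by (rule connected_punctured_ball) simp
      moreover have "(ball p \<epsilon>0 - {p}) \<inter> frontier \<Omega> = {}" using T(3) \<epsilon>0(2) by blast
      moreover have "(ball p \<epsilon>0 - {p}) \<inter> \<Omega> \<noteq> {}"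
      proof -
        define r where "r = (1 + r0) / 2"
        have r: "r0 < r" "r < 1" using r0 by (auto simp: r_def)
        then have "of_real r * \<alpha> \<in> ball 0 1" using r0(1) \<alpha> by (simp add: norm_mult)
        then have "\<phi> (of_real r * \<alpha>) \<in> \<Omega>" by (rule in_domain)
        then show ?thesis using r0(3)[OF r] pn by (auto simp: dist_commute)
      qed
      ultimately show ?thesis using connected_Int_frontier[of "ball p \<epsilon>0 - {p}" \<Omega>] by blast
    qed
    obtain \<epsilon>1 where \<epsilon>1: "\<epsilon>1 > 0"
      "\<And>C z w. path_connected C \<Longrightarrow> C \<subseteq> ball 0 1 \<Longrightarrow> (\<And>x. x \<in> C \<Longrightarrow> dist (\<phi> x) p < \<epsilon>1)
        \<Longrightarrow> z \<in> C \<Longrightarrow> w \<in> C \<Longrightarrow> dist z w \<le> \<delta> / 2"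
      using small_image_imp_small_set[OF pn, of "\<delta> / 2"] \<delta> by (metis half_gt_zero)
    \<comment> \<open>The threshold \<open>r0\<close> forces \<open>C\<close> to meet the radius on
      its tail, whose image stays within \<open>\<epsilon>0\<close> of \<open>p\<close>; this is
      where the logarithm along the radius can be used.\<close>
    obtain d where d: "d > 0" "\<And>z. z \<in> ball 0 1 \<Longrightarrow> dist (\<phi> z) p < d \<Longrightarrow> r0 < norm z"
      using near_omitted_value_imp_norm_gt[OF pn r0(2)] by auto
    define \<epsilon> where "\<epsilon> = min (min \<epsilon>1 d) \<epsilon>0"
    show "\<exists>\<epsilon>>0. \<forall>g::real \<Rightarrow> complex.
          simple_path g \<and> pathfinish g = pathstart g \<and> path_image g \<subseteq> \<Omega> \<and>
          path_image g \<subseteq> ball p \<epsilon> \<and> p \<in> inside (path_image g) \<longrightarrow>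
          (\<exists>C \<in> components (ball 0 1 \<inter> \<phi> -` path_image g).
             (\<exists>\<gamma>. simple_path \<gamma> \<and> pathfinish \<gamma> = pathstart \<gamma> \<and>
                   path_image \<gamma> = closure C) \<and>
             closure C \<inter> sphere 0 1 = {\<alpha>} \<and>
             diameter C < \<delta>)"
    proof (intro exI[of _ \<epsilon>] conjI allI impI)
      show "\<epsilon> > 0" using \<epsilon>1 d \<epsilon>0 by (simp add: \<epsilon>_def)
      fix g :: "real \<Rightarrow> complex"
      assume gh: "simple_path g \<and> pathfinish g = pathstart g \<and> path_image g \<subseteq> \<Omega> \<and> path_image g \<subseteq> ball p \<epsilon> \<and> p \<in> inside (path_image g)"
      then obtain e where "disc_covering_curve \<Omega> \<phi> g p e" using curve by blast
      then interpret disc_covering_curve \<Omega> \<phi> g p e .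
      have in\<epsilon>: "inside (path_image g) \<subseteq> ball p \<epsilon>" using inball gh by blast
      have "\<not> dist (\<phi> 0) p < d" using d(2)[of 0] r0(1) by auto
      then have "\<phi> 0 \<notin> ball p \<epsilon>" by (simp add: \<epsilon>_def dist_commute)
      then have out: "\<phi> 0 \<notin> path_image g" "\<phi> 0 \<notin> inside (path_image g)" using gh in\<epsilon> by auto
      obtain C r1 where C: "C \<in> components (ball 0 1 \<inter> \<phi> -` path_image g)" "0 \<le> r1" "r1 < 1" "of_real r1 * \<alpha> \<in> C"
        using separating_component[OF \<alpha> rad out] by metis
      have Cb: "C \<subseteq> ball 0 1" and Cg: "\<And>x. x \<in> C \<Longrightarrow> \<phi> x \<in> ball p \<epsilon>"
        using in_components_subset[OF C(1)] gh by auto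
      have "dist (\<phi> (of_real r1 * \<alpha>)) p < d" using Cg[OF C(4)] by (simp add: \<epsilon>_def dist_commute)
      then have r01: "r0 < r1" using d(2)[of "of_real r1 * \<alpha>"] Cb C(2,4) \<alpha> by (auto simp: norm_mult)
      have full: "path_image g \<subseteq> \<Omega>" using gh by blast
      have g\<epsilon>0: "path_image g \<subseteq> ball p \<epsilon>0" using gh by (auto simp: \<epsilon>_def)
      have loop: "path_connected C \<and> (\<exists>\<gamma>. simple_path \<gamma> \<and> pathfinish \<gamma> = pathstart \<gamma> \<and> path_image \<gamma> = closure C) \<and>
          closure C \<inter> sphere 0 1 = {\<alpha>}"
        by (rule interior_curve_loop[OF full C(1) \<alpha> rad \<epsilon>0(1) punct g\<epsilon>0 r0(1,3) r01 C(3,4)])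
      have "diameter C < \<delta>"
      proof (rule diameter_less_of_dist_le[OF \<delta>])
        show "dist z w \<le> \<delta> / 2" if "z \<in> C" "w \<in> C" for z w
          using \<epsilon>1(2)[of C z w] loop Cb Cg that by (force simp: \<epsilon>_def dist_commute)
      qed
      then show "\<exists>C \<in> components (ball 0 1 \<inter> \<phi> -` path_image g).
             (\<exists>\<gamma>. simple_path \<gamma> \<and> pathfinish \<gamma> = pathstart \<gamma> \<and>
                   path_image \<gamma> = closure C) \<and>
             closure C \<inter> sphere 0 1 = {\<alpha>} \<and>
             diameter C < \<delta>"
        using C(1) loop by blast
    qed
  qed
qed

end
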